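(* Let $n\ge 1$ and let $M$ be a compact metric space such that each $x\in M$ admits a neighborhood which is bi-Lipschitz embeddable in $\mathbb{R}^n$. Then there is a complemented copy of $\mathcal{F}(M)$ in $\mathcal{F}(\mathbb{R}^n)$, i.e. $\mathcal{F}(\mathbb{R}^n)$ has a complemented subspace isomorphic to $\mathcal{F}(M)$. If moreover the closed unit ball of $\mathbb{R}^n$ is bi-Lipschitz embeddable into $M$, then $\mathcal{F}(M)\simeq \mathcal{F}(\mathbb{R}^n)$. In particular, the Lipschitz-free space over any $n$-dimensional compact connected Riemannian manifold equipped with its geodesic metric is isomorphic to $\mathcal{F}(\mathbb{R}^n)$.
   Context: For a pointed metric space $(M,d,0)$, $Lip_0(M)$ is the Banach space of all real-valued Lipschitz functions $f$ on $M$ with $f(0)=0$, with norm $\|f\|_{Lip}=\sup_{x\ne y}\frac{|f(x)-f(y)|}{d(x,y)}$. The Lipschitz-free space $\mathcal{F}(M)$ is the norm closure in $Lip_0(M)^*$ of the linear span of the evaluation functionals $\delta_x: f\mapsto f(x)$, $x\in M$. Different choices of base point give isometrically isomorphic spaces, so the base point need not be specified. $\simeq$ denotes linear isomorphism of Banach spaces. $\mathbb{R}^n$ carries the Euclidean metric. A metric space $A$ is bi-Lipschitz embeddable in $B$ if there is a bi-Lipschitz map from $A$ onto a subset of $B$. A subspace of a Banach space is complemented if it is the range of a bounded linear projection. *)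

theory Defs
  imports "HOL-Analysis.Analysis"
begin

section \<open>Pointed metric spaces and Lipschitz-free spaces\<close>

class pointed_metric_space = metric_space +
  fixes basepoint :: 'a

instantiation vec :: ("{metric_space, zero}", finite) pointed_metric_space
begin
definition basepoint_vec :: "'a ^ 'b" where "basepoint_vec = 0"
instance ..
end

typedef (overloaded) 'a lip0 =
  "{f :: 'a::pointed_metric_space \<Rightarrow> real. (\<exists>L. L-lipschitz_on UNIV f) \<and> f basepoint = 0}"
  morphisms apply_lip0 Abs_lip0
  by (rule exI[of _ "\<lambda>_. 0"]) (auto intro!: lipschitz_on_constant)

setup_lifting type_definition_lip0

instantiation lip0 :: (pointed_metric_space) real_vector
begin

lift_definition zero_lip0 :: "'a lip0" is "\<lambda>_. 0"
  by (auto intro!: lipschitz_on_constant)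

lift_definition plus_lip0 :: "'a lip0 \<Rightarrow> 'a lip0 \<Rightarrow> 'a lip0" is "\<lambda>f g x. f x + g x"
  by (auto intro: lipschitz_on_add)

lift_definition minus_lip0 :: "'a lip0 \<Rightarrow> 'a lip0 \<Rightarrow> 'a lip0" is "\<lambda>f g x. f x - g x"
  by (auto intro: lipschitz_on_diff)

lift_definition uminus_lip0 :: "'a lip0 \<Rightarrow> 'a lip0" is "\<lambda>f x. - f x"
  by (auto intro: lipschitz_on_minus)

lift_definition scaleR_lip0 :: "real \<Rightarrow> 'a lip0 \<Rightarrow> 'a lip0" is "\<lambda>c f x. c * f x"
  by (auto intro: lipschitz_on_cmult_real)

instance
  by standard (transfer; auto simp: algebra_simps fun_eq_iff)+

end

instantiation lip0 :: (pointed_metric_space) real_normed_vector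
begin

text \<open>The supremum runs over all pairs; pairs on the diagonal contribute \<open>0 / 0 = 0\<close>.\<close>

lift_definition norm_lip0 :: "'a lip0 \<Rightarrow> real"
  is "\<lambda>f. SUP p. \<bar>f (fst p) - f (snd p)\<bar> / dist (fst p) (snd p)" .

definition dist_lip0 :: "'a lip0 \<Rightarrow> 'a lip0 \<Rightarrow> real" where
  "dist_lip0 f g = norm (f - g)"

definition sgn_lip0 :: "'a lip0 \<Rightarrow> 'a lip0" where
  "sgn_lip0 f = f /\<^sub>R norm f"

definition uniformity_lip0 :: "('a lip0 \<times> 'a lip0) filter" where
  "uniformity_lip0 = (INF e\<in>{0<..}. principal {(f, g). dist f g < e})"

definition open_lip0 :: "'a lip0 set \<Rightarrow> bool" where
  "open_lip0 S = (\<forall>f\<in>S. \<forall>\<^sub>F (f', g) in uniformity. f' = f \<longrightarrow> g \<in> S)"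

lemma lip0_quotient_le_norm:
  "\<bar>apply_lip0 f x - apply_lip0 f y\<bar> / dist x y \<le> norm f"
proof -
  obtain L where L: "L-lipschitz_on UNIV (apply_lip0 f)"
    using apply_lip0[of f] by auto
  have "bdd_above (range (\<lambda>p. \<bar>apply_lip0 f (fst p) - apply_lip0 f (snd p)\<bar> / dist (fst p) (snd p)))"
  proof (intro bdd_aboveI2)
    fix p :: "'a \<times> 'a"
    show "\<bar>apply_lip0 f (fst p) - apply_lip0 f (snd p)\<bar> / dist (fst p) (snd p) \<le> L"
      using lipschitz_onD[OF L, of "fst p" "snd p"] lipschitz_on_nonneg[OF L]
      by (cases "fst p = snd p") (auto simp: dist_real_def divide_simps)
  qed
  from cSUP_upper[OF UNIV_I this, of "(x, y)"] show ?thesis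
    by (simp add: norm_lip0.rep_eq)
qed

lemma lip0_diff_le_norm: "\<bar>apply_lip0 f x - apply_lip0 f y\<bar> \<le> norm f * dist x y"
  using lip0_quotient_le_norm[of f x y] by (cases "x = y") (auto simp: divide_simps)

lemma lip0_norm_nonneg: "0 \<le> norm (f :: 'a lip0)"
  using lip0_quotient_le_norm[of f basepoint basepoint] by simp

lemma lip0_norm_le:
  assumes "0 \<le> L" "\<And>x y. \<bar>apply_lip0 f x - apply_lip0 f y\<bar> \<le> L * dist x y"
  shows "norm f \<le> L"
  unfolding norm_lip0.rep_eq
proof (rule cSUP_least)
  fix p :: "'a \<times> 'a"
  show "\<bar>apply_lip0 f (fst p) - apply_lip0 f (snd p)\<bar> / dist (fst p) (snd p) \<le> L"
    using assms(1) assms(2)[of "fst p" "snd p"]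
    by (cases "fst p = snd p") (auto simp: divide_simps)
qed simp

lemma apply_lip0_basepoint [simp]: "apply_lip0 f basepoint = 0"
  using apply_lip0[of f] by simp

instance
proof
  fix f g :: "'a lip0" and c :: real
  show "norm f = 0 \<longleftrightarrow> f = 0"
  proof
    assume "norm f = 0"
    then have "apply_lip0 f x = 0" for x
      using lip0_diff_le_norm[of f x basepoint] by simp
    then show "f = 0" by transfer auto
  next
    assume "f = 0"
    then have "norm f \<le> 0" by (intro lip0_norm_le) (auto simp: zero_lip0.rep_eq)
    with lip0_norm_nonneg[of f] show "norm f = 0" by simp
  qed
  show "norm (f + g) \<le> norm f + norm g"
  proof (intro lip0_norm_le)
    fix x y
    show "\<bar>apply_lip0 (f + g) x - apply_lip0 (f + g) y\<bar> \<le> (norm f + norm g) * dist x y"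
      using lip0_diff_le_norm[of f x y] lip0_diff_le_norm[of g x y]
      by (simp add: plus_lip0.rep_eq algebra_simps)
  qed (simp add: lip0_norm_nonneg)
  have le: "norm (a *\<^sub>R h) \<le> \<bar>a\<bar> * norm h" for a and h :: "'a lip0"
  proof (intro lip0_norm_le)
    fix x y
    have "\<bar>apply_lip0 (a *\<^sub>R h) x - apply_lip0 (a *\<^sub>R h) y\<bar>
          = \<bar>a\<bar> * \<bar>apply_lip0 h x - apply_lip0 h y\<bar>"
      by (simp add: scaleR_lip0.rep_eq abs_mult[symmetric] algebra_simps)
    then show "\<bar>apply_lip0 (a *\<^sub>R h) x - apply_lip0 (a *\<^sub>R h) y\<bar> \<le> \<bar>a\<bar> * norm h * dist x y"
      using lip0_diff_le_norm[of h x y] by (simp add: mult_left_mono mult.assoc)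
  qed (simp add: lip0_norm_nonneg)
  show "norm (c *\<^sub>R f) = \<bar>c\<bar> * norm f"
  proof (cases "c = 0")
    case True
    then show ?thesis using le[of 0 f] lip0_norm_nonneg[of "0 *\<^sub>R f"] by simp
  next
    case False
    then have "norm f \<le> inverse \<bar>c\<bar> * norm (c *\<^sub>R f)"
      using le[of "inverse c" "c *\<^sub>R f"] by simp
    then have "\<bar>c\<bar> * norm f \<le> norm (c *\<^sub>R f)"
      using False by (simp add: field_simps)
    with le[of c f] show ?thesis by simp
  qed
qed (simp_all add: dist_lip0_def sgn_lip0_def uniformity_lip0_def open_lip0_def)

end

lift_definition lip0_eval :: "'a::pointed_metric_space \<Rightarrow> 'a lip0 \<Rightarrow>\<^sub>L real"
  is "\<lambda>x f. apply_lip0 f x"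
proof (rule bounded_linear_intro)
  fix x :: 'a and f :: "'a lip0"
  show "norm (apply_lip0 f x) \<le> norm f * dist x basepoint"
    using lip0_diff_le_norm[of f x basepoint] by simp
qed (simp_all add: plus_lip0.rep_eq scaleR_lip0.rep_eq)

lemma subspace_closure_span: "subspace (closure (span S))"
  for S :: "'b::real_normed_vector set"
proof (rule subspaceI)
  show "0 \<in> closure (span S)"
    using closure_subset[of "span S"] span_zero[of S] by blast
next
  fix x y assume "x \<in> closure (span S)" "y \<in> closure (span S)"
  then obtain f g where "\<forall>n. f n \<in> span S" "f \<longlonglongrightarrow> x" "\<forall>n. g n \<in> span S" "g \<longlonglongrightarrow> y"
    unfolding closure_sequential by auto
  then show "x + y \<in> closure (span S)"
    unfolding closure_sequential
    by (intro exI[of _ "\<lambda>n. f n + g n"]) (auto intro!: tendsto_add span_add)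
next
  fix c x assume "x \<in> closure (span S)"
  then obtain f where "\<forall>n. f n \<in> span S" "f \<longlonglongrightarrow> x"
    unfolding closure_sequential by auto
  then show "c *\<^sub>R x \<in> closure (span S)"
    unfolding closure_sequential
    by (intro exI[of _ "\<lambda>n. c *\<^sub>R f n"]) (auto intro!: tendsto_scaleR span_scale)
qed

typedef (overloaded) 'a lipfree =
  "closure (span (range (lip0_eval :: 'a::pointed_metric_space \<Rightarrow> 'a lip0 \<Rightarrow>\<^sub>L real)))"
  by (rule exI[of _ 0]) (rule subspace_0[OF subspace_closure_span])

setup_lifting type_definition_lipfree

instantiation lipfree :: (pointed_metric_space) real_vector
begin

lift_definition zero_lipfree :: "'a lipfree" is 0
  by (rule subspace_0[OF subspace_closure_span])

lift_definition plus_lipfree :: "'a lipfree \<Rightarrow> 'a lipfree \<Rightarrow> 'a lipfree" is "(+)"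
  by (rule subspace_add[OF subspace_closure_span])

lift_definition minus_lipfree :: "'a lipfree \<Rightarrow> 'a lipfree \<Rightarrow> 'a lipfree" is "(-)"
  by (rule subspace_diff[OF subspace_closure_span])

lift_definition uminus_lipfree :: "'a lipfree \<Rightarrow> 'a lipfree" is uminus
  by (rule subspace_neg[OF subspace_closure_span])

lift_definition scaleR_lipfree :: "real \<Rightarrow> 'a lipfree \<Rightarrow> 'a lipfree" is "(*\<^sub>R)"
  by (rule subspace_scale[OF subspace_closure_span])

instance
  by standard (transfer; simp add: algebra_simps)+

end

instantiation lipfree :: (pointed_metric_space) real_normed_vector
begin

lift_definition norm_lipfree :: "'a lipfree \<Rightarrow> real" is norm .

definition dist_lipfree :: "'a lipfree \<Rightarrow> 'a lipfree \<Rightarrow> real" where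
  "dist_lipfree u v = norm (u - v)"

definition sgn_lipfree :: "'a lipfree \<Rightarrow> 'a lipfree" where
  "sgn_lipfree u = u /\<^sub>R norm u"

definition uniformity_lipfree :: "('a lipfree \<times> 'a lipfree) filter" where
  "uniformity_lipfree = (INF e\<in>{0<..}. principal {(u, v). dist u v < e})"

definition open_lipfree :: "'a lipfree set \<Rightarrow> bool" where
  "open_lipfree S = (\<forall>u\<in>S. \<forall>\<^sub>F (u', v) in uniformity. u' = u \<longrightarrow> v \<in> S)"

instance
proof
  fix u v :: "'a lipfree" and c :: real
  show "norm u = 0 \<longleftrightarrow> u = 0" by transfer simp
  show "norm (u + v) \<le> norm u + norm v" by transfer (rule norm_triangle_ineq)
  show "norm (c *\<^sub>R u) = \<bar>c\<bar> * norm u" by transfer simp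
qed (simp_all add: dist_lipfree_def sgn_lipfree_def uniformity_lipfree_def open_lipfree_def)

end

lemma dist_Rep_lipfree: "dist (Rep_lipfree u) (Rep_lipfree v) = dist u v"
  by (simp add: dist_norm norm_lipfree.rep_eq minus_lipfree.rep_eq)

instance lipfree :: (pointed_metric_space) banach
proof
  fix u :: "nat \<Rightarrow> 'a lipfree"
  assume "Cauchy u"
  then have "Cauchy (\<lambda>n. Rep_lipfree (u n))"
    by (simp add: Cauchy_def dist_Rep_lipfree)
  then obtain w where w: "(\<lambda>n. Rep_lipfree (u n)) \<longlonglongrightarrow> w"
    by (auto simp: Cauchy_convergent_iff convergent_def)
  have "w \<in> closure (span (range lip0_eval))"
    by (rule closed_sequentially[OF closed_closure _ w]) (rule Rep_lipfree)
  then have "Rep_lipfree (Abs_lipfree w) = w"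
    by (rule Abs_lipfree_inverse)
  with w have "u \<longlonglongrightarrow> Abs_lipfree w"
    by (simp add: tendsto_iff dist_Rep_lipfree flip: dist_Rep_lipfree)
  then show "convergent u"
    by (rule convergentI)
qed


section \<open>Linear isomorphisms, complemented subspaces, bi-Lipschitz embeddings\<close>

text \<open>The last conjunct is boundedness of the inverse of \<open>T\<close> on \<open>Y\<close>.\<close>

definition linear_isomorphism_onto ::
    "('a::real_normed_vector \<Rightarrow> 'b::real_normed_vector) \<Rightarrow> 'b set \<Rightarrow> bool" where
  "linear_isomorphism_onto T Y \<longleftrightarrow>
     bounded_linear T \<and> inj T \<and> range T = Y \<and> (\<exists>B. \<forall>x. norm x \<le> B * norm (T x))"

definition complemented_subspace :: "'a::real_normed_vector set \<Rightarrow> bool" where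
  "complemented_subspace Y \<longleftrightarrow> (\<exists>P. bounded_linear P \<and> P \<circ> P = P \<and> range P = Y)"

definition bilipschitz_on :: "'a::metric_space set \<Rightarrow> ('a \<Rightarrow> 'b::metric_space) \<Rightarrow> bool" where
  "bilipschitz_on A f \<longleftrightarrow>
     (\<exists>c>0. \<exists>C. \<forall>x\<in>A. \<forall>y\<in>A. c * dist x y \<le> dist (f x) (f y) \<and> dist (f x) (f y) \<le> C * dist x y)"

definition bilipschitz_embeddable :: "'a::metric_space set \<Rightarrow> 'b::metric_space set \<Rightarrow> bool" where
  "bilipschitz_embeddable A B \<longleftrightarrow> (\<exists>f. f ` A \<subseteq> B \<and> bilipschitz_on A f)"


section \<open>Riemannian manifolds and the geodesic distance\<close>

text \<open>
  \<open>C\<^sup>k\<close> functions on an open set \<open>S\<close>. Instead of the higher Frechet derivatives, which live in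
  varying spaces, the recursion uses the directional derivatives \<open>x \<mapsto> Df(x) v\<close>; in finite
  dimensions \<open>x \<mapsto> Df(x)\<close> is \<open>C\<^sup>k\<close> iff all of these are.
\<close>

primrec Ck_on :: "nat \<Rightarrow> 'a::euclidean_space set \<Rightarrow> ('a \<Rightarrow> 'b::euclidean_space) \<Rightarrow> bool" where
  "Ck_on 0 S f \<longleftrightarrow> continuous_on S f"
| "Ck_on (Suc k) S f \<longleftrightarrow>
     (\<forall>x\<in>S. f differentiable (at x)) \<and> (\<forall>v. Ck_on k S (\<lambda>x. frechet_derivative f (at x) v))"

definition smooth_on :: "'a::euclidean_space set \<Rightarrow> ('a \<Rightarrow> 'b::euclidean_space) \<Rightarrow> bool" where
  "smooth_on S f \<longleftrightarrow> (\<forall>k. Ck_on k S f)"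

type_synonym ('m, 'n) chart = "'m set \<times> ('m \<Rightarrow> real ^ 'n)"

definition transition :: "('m, 'n::finite) chart \<Rightarrow> ('m, 'n) chart \<Rightarrow> real ^ 'n \<Rightarrow> real ^ 'n" where
  "transition c c' = snd c' \<circ> inv_into (fst c) (snd c)"

definition smooth_manifold :: "'m topology \<Rightarrow> ('m, 'n::finite) chart set \<Rightarrow> bool" where
  "smooth_manifold X A \<longleftrightarrow>
     Hausdorff_space X \<and> second_countable X \<and> (\<Union>c\<in>A. fst c) = topspace X \<and>
     (\<forall>(U, \<phi>)\<in>A. openin X U \<and> open (\<phi> ` U) \<and>
        homeomorphic_map (subtopology X U) (top_of_set (\<phi> ` U)) \<phi>) \<and>
     (\<forall>c\<in>A. \<forall>c'\<in>A. smooth_on (snd c ` (fst c \<inter> fst c')) (transition c c'))"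

text \<open>
  A Riemannian metric is given by its coordinate representations: \<open>g c p v w\<close> is the inner product
  of the tangent vectors at \<open>p\<close> whose components with respect to the chart \<open>c\<close> are \<open>v\<close> and \<open>w\<close>.
  The last condition is the transformation law of a covariant 2-tensor under change of chart.
\<close>

definition riemannian_metric ::
    "('m, 'n::finite) chart set \<Rightarrow>
     (('m, 'n) chart \<Rightarrow> 'm \<Rightarrow> real ^ 'n \<Rightarrow> real ^ 'n \<Rightarrow> real) \<Rightarrow> bool" where
  "riemannian_metric A g \<longleftrightarrow>
     (\<forall>c\<in>A. \<forall>p\<in>fst c. bilinear (g c p) \<and> (\<forall>v w. g c p v w = g c p w v) \<and>
        (\<forall>v. v \<noteq> 0 \<longrightarrow> g c p v v > 0)) \<and>
     (\<forall>c\<in>A. \<forall>v w. smooth_on (snd c ` fst c) (\<lambda>x. g c (inv_into (fst c) (snd c) x) v w)) \<and>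
     (\<forall>c\<in>A. \<forall>c'\<in>A. \<forall>p\<in>fst c \<inter> fst c'. \<forall>v w.
        g c p v w = g c' p (frechet_derivative (transition c c') (at (snd c p)) v)
                           (frechet_derivative (transition c c') (at (snd c p)) w))"

definition riemannian_manifold ::
    "'m topology \<Rightarrow> ('m, 'n::finite) chart set \<Rightarrow>
     (('m, 'n) chart \<Rightarrow> 'm \<Rightarrow> real ^ 'n \<Rightarrow> real ^ 'n \<Rightarrow> real) \<Rightarrow> bool" where
  "riemannian_manifold X A g \<longleftrightarrow> smooth_manifold X A \<and> riemannian_metric A g"

text \<open>\<open>C\<^sup>1\<close> on the compact interval \<open>{a..b}\<close>, with one-sided derivatives at the end points.\<close>

definition C1_curve_on ::
    "'m topology \<Rightarrow> ('m, 'n::finite) chart set \<Rightarrow> real \<Rightarrow> real \<Rightarrow> (real \<Rightarrow> 'm) \<Rightarrow> bool" where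
  "C1_curve_on X A a b \<gamma> \<longleftrightarrow>
     continuous_map (top_of_set {a..b}) X \<gamma> \<and>
     (\<forall>(U, \<phi>)\<in>A. \<exists>D. continuous_on {t\<in>{a..b}. \<gamma> t \<in> U} D \<and>
        (\<forall>t\<in>{a..b}. \<gamma> t \<in> U \<longrightarrow>
           ((\<lambda>s. \<phi> (\<gamma> s)) has_vector_derivative D t) (at t within {a..b})))"

definition piecewise_C1_curve ::
    "'m topology \<Rightarrow> ('m, 'n::finite) chart set \<Rightarrow> (real \<Rightarrow> 'm) \<Rightarrow> bool" where
  "piecewise_C1_curve X A \<gamma> \<longleftrightarrow>
     (\<exists>k (s :: nat \<Rightarrow> real). s 0 = 0 \<and> s k = 1 \<and>
        (\<forall>i<k. s i < s (Suc i) \<and> C1_curve_on X A (s i) (s (Suc i)) \<gamma>))"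

text \<open>
  The speed does not depend on the chart selected. The two-sided derivative may fail to exist at
  the finitely many break points and at 0 and 1; these do not affect the length integral.
\<close>

definition curve_speed ::
    "('m, 'n::finite) chart set \<Rightarrow> (('m, 'n) chart \<Rightarrow> 'm \<Rightarrow> real ^ 'n \<Rightarrow> real ^ 'n \<Rightarrow> real) \<Rightarrow>
     (real \<Rightarrow> 'm) \<Rightarrow> real \<Rightarrow> real" where
  "curve_speed A g \<gamma> t =
     (let c = (SOME c. c \<in> A \<and> \<gamma> t \<in> fst c);
          v = vector_derivative (\<lambda>s. snd c (\<gamma> s)) (at t)
      in sqrt (g c (\<gamma> t) v v))"

definition curve_length ::
    "('m, 'n::finite) chart set \<Rightarrow> (('m, 'n) chart \<Rightarrow> 'm \<Rightarrow> real ^ 'n \<Rightarrow> real ^ 'n \<Rightarrow> real) \<Rightarrow>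
     (real \<Rightarrow> 'm) \<Rightarrow> real" where
  "curve_length A g \<gamma> = integral {0..1} (curve_speed A g \<gamma>)"

definition geodesic_dist ::
    "'m topology \<Rightarrow> ('m, 'n::finite) chart set \<Rightarrow>
     (('m, 'n) chart \<Rightarrow> 'm \<Rightarrow> real ^ 'n \<Rightarrow> real ^ 'n \<Rightarrow> real) \<Rightarrow> 'm \<Rightarrow> 'm \<Rightarrow> real" where
  "geodesic_dist X A g p q =
     Inf {curve_length A g \<gamma> |\<gamma>. piecewise_C1_curve X A \<gamma> \<and> \<gamma> 0 = p \<and> \<gamma> 1 = q}"

end

theory Submission
  imports Defs
begin

text \<open>
  A bounded operator \<open>E : Lip\<^sub>0(N) \<rightarrow> Lip\<^sub>0(M)\<close> whose values at each point are finite combinations of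
  values of the argument is the adjoint of an operator from \<open>F(M)\<close> to \<open>F(N)\<close>. So \<open>F(M)\<close> is
  complemented in \<open>F(N)\<close> as soon as the identity of \<open>Lip\<^sub>0(M)\<close> factors through \<open>Lip\<^sub>0(N)\<close> by such
  operators.

  Cutting a function on \<open>\<real>\<^sup>n\<close> into dyadic annular pieces and placing scaled copies of the pieces in
  disjoint balls inside the unit ball shows that the \<open>\<ell>\<^sub>1\<close>-sum of countably many copies of \<open>F(\<real>\<^sup>n)\<close>
  is complemented in \<open>F(\<real>\<^sup>n)\<close>, and that \<open>F(\<real>\<^sup>n)\<close> is complemented in \<open>F(M)\<close> if \<open>M\<close> contains a
  bi-Lipschitz copy of the ball. A linear Lipschitz extension operator from compact subsets of
  \<open>\<real>\<^sup>n\<close> and a Lipschitz partition of unity on \<open>M\<close> give that \<open>F(M)\<close> is complemented in a finite power of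
  \<open>F(\<real>\<^sup>n)\<close>, hence in \<open>F(\<real>\<^sup>n)\<close>. Pelczynski's decomposition method yields the isomorphism. Finally,
  the geodesic distance is bi-Lipschitz to the Euclidean one in small charts.
\<close>

section \<open>Operators with preadjoints\<close>

text \<open>On the function side every operator is an explicit formula, but an operator between dual
  spaces need not be an adjoint. Requiring finite combinations of point values settles this and
  dictates the constructions: the nonlinear McShane extension is excluded, and all dyadic sums have
  finitely many nonzero terms at each point. The l1-sum is never formed as a space. Coordinate maps
  with a summability bound stand for it, and that bound is dual to the fact that any number of
  functions can be placed in disjoint balls at a Lipschitz cost independent of their number. A
  function on all of R^n has no scaled copy in one ball, hence the cut into annuli. Cutting near
  radius 2^k costs a bounded factor because f(0) = 0 gives |f| <= L 2^k up to a constant, which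
  balances the slope 2^-k of the cutoff. Base points of the two sides are unrelated, so operators
  are built up to an additive constant. For manifolds the obstacle is a curve that leaves the chart
  between two nearby points: such a curve is shown to be long.\<close>

lemma lip0_eqI: "(\<And>x. apply_lip0 f x = apply_lip0 g x) \<Longrightarrow> f = g"
  using apply_lip0_inject by blast

text \<open>Functionals are taken as bare functions of \<open>f\<close>, so that an operator can be
  described by its pointwise formula; agreement with a member of the span then supplies linearity in
  \<open>f\<close>.\<close>

definition molecular :: "('a::pointed_metric_space lip0 \<Rightarrow> real) \<Rightarrow> bool" where
  "molecular \<Lambda> \<longleftrightarrow> (\<exists>v\<in>span (range lip0_eval). \<forall>f. blinfun_apply v f = \<Lambda> f)"

lemma molecular_eval [intro]: "molecular (\<lambda>f. apply_lip0 f x)"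
  unfolding molecular_def
  by (rule bexI[of _ "lip0_eval x"]) (auto simp: lip0_eval.rep_eq intro: span_base)

lemma molecular_zero [intro]: "molecular (\<lambda>f. 0)"
  unfolding molecular_def by (rule bexI[of _ 0]) (auto intro: span_zero)

lemma molecular_add [intro]:
  "molecular \<Lambda> \<Longrightarrow> molecular \<Gamma> \<Longrightarrow> molecular (\<lambda>f. \<Lambda> f + \<Gamma> f)"
  unfolding molecular_def by (metis blinfun.add_left span_add)

lemma molecular_diff [intro]:
  "molecular \<Lambda> \<Longrightarrow> molecular \<Gamma> \<Longrightarrow> molecular (\<lambda>f. \<Lambda> f - \<Gamma> f)"
  unfolding molecular_def by (metis blinfun.diff_left span_diff)

lemma molecular_scale [intro]: "molecular \<Lambda> \<Longrightarrow> molecular (\<lambda>f. c * \<Lambda> f)"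
  unfolding molecular_def by (metis blinfun.scaleR_left real_scaleR_def span_scale)

lemma molecular_sum [intro]:
  "(\<And>i. i \<in> I \<Longrightarrow> molecular (\<Lambda> i)) \<Longrightarrow> molecular (\<lambda>f. \<Sum>i\<in>I. \<Lambda> i f)"
  by (induction I rule: infinite_finite_induct) auto

text \<open>Linearity of \<open>\<Phi>\<close> in \<open>f\<close> is inherited from pointwise
  molecularity. Subtracting the value at the base point leaves all differences alone, hence also the
  constant \<open>C\<close>.\<close>

lemma lip0_operator:
  fixes \<Phi> :: "'b::pointed_metric_space lip0 \<Rightarrow> 'a::pointed_metric_space \<Rightarrow> real"
  assumes "0 \<le> C"
    and lip: "\<And>f x y. \<bar>\<Phi> f x - \<Phi> f y\<bar> \<le> C * norm f * dist x y"
    and mol: "\<And>x. molecular (\<lambda>f. \<Phi> f x)"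
  shows "\<exists>E :: 'b lip0 \<Rightarrow>\<^sub>L 'a lip0.
    (\<forall>f x. apply_lip0 (blinfun_apply E f) x = \<Phi> f x - \<Phi> f basepoint) \<and>
    (\<forall>x. molecular (\<lambda>f. apply_lip0 (blinfun_apply E f) x)) \<and> norm E \<le> C"
proof -
  define E0 where "E0 f = Abs_lip0 (\<lambda>x. \<Phi> f x - \<Phi> f basepoint)" for f
  have E0: "apply_lip0 (E0 f) x = \<Phi> f x - \<Phi> f basepoint" for f x
  proof -
    have "(C * norm f)-lipschitz_on UNIV (\<lambda>x. \<Phi> f x - \<Phi> f basepoint)"
      using lip[of f] \<open>0 \<le> C\<close> by (intro lipschitz_onI) (auto simp: dist_real_def)
    then show ?thesis
      unfolding E0_def by (subst Abs_lip0_inverse) auto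
  qed
  have add: "\<Phi> (f + g) x = \<Phi> f x + \<Phi> g x" for f g x
    using mol[of x] unfolding molecular_def by (metis blinfun.add_right)
  have scale: "\<Phi> (r *\<^sub>R f) x = r * \<Phi> f x" for r f x
    using mol[of x] unfolding molecular_def by (metis blinfun.scaleR_right real_scaleR_def)
  have norm_E0: "norm (E0 f) \<le> C * norm f" for f
    using \<open>0 \<le> C\<close> lip[of f] by (intro lip0_norm_le) (auto simp: E0)
  have bl: "bounded_linear E0"
  proof (rule bounded_linear_intro[of _ C])
    show "E0 (f + g) = E0 f + E0 g" for f g
      by (rule lip0_eqI) (simp add: E0 plus_lip0.rep_eq add)
    show "E0 (r *\<^sub>R f) = r *\<^sub>R E0 f" for r f
      by (rule lip0_eqI) (simp add: E0 scaleR_lip0.rep_eq scale algebra_simps)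
    show "norm (E0 f) \<le> norm f * C" for f
      using norm_E0[of f] by (simp add: mult.commute)
  qed
  show ?thesis
  proof (intro exI[of _ "Blinfun E0"] conjI allI)
    show "apply_lip0 (Blinfun E0 f) x = \<Phi> f x - \<Phi> f basepoint" for f x
      by (simp add: bounded_linear_Blinfun_apply[OF bl] E0)
    show "molecular (\<lambda>f. apply_lip0 (Blinfun E0 f) x)" for x
      unfolding bounded_linear_Blinfun_apply[OF bl] E0 by (intro molecular_diff mol)
    show "norm (Blinfun E0) \<le> C"
      using \<open>0 \<le> C\<close> norm_E0
      by (intro norm_blinfun_bound) (auto simp: bounded_linear_Blinfun_apply[OF bl])
  qed
qed

definition preadjoint ::
    "('b::pointed_metric_space lip0 \<Rightarrow>\<^sub>L 'a::pointed_metric_space lip0) \<Rightarrow> 'a lipfree \<Rightarrow> 'b lipfree" where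
  "preadjoint E \<mu> = Abs_lipfree (Rep_lipfree \<mu> o\<^sub>L E)"

text \<open>Composition with \<open>E\<close> is continuous and sends each evaluation functional to
  a finite combination of evaluations, so it maps the closed span into the closed span. This makes
  \<open>Abs_lipfree\<close> in the definition of \<open>preadjoint\<close> meaningful.\<close>

lemma Rep_preadjoint:
  assumes "\<And>x. molecular (\<lambda>f. apply_lip0 (blinfun_apply E f) x)"
  shows "Rep_lipfree (preadjoint E \<mu>) = Rep_lipfree \<mu> o\<^sub>L E"
proof -
  let ?L = "\<lambda>v. v o\<^sub>L E"
  have bl: "bounded_linear ?L"
    by (rule bounded_bilinear.bounded_linear_left[OF bounded_bilinear_blinfun_compose])
  have ev: "?L (lip0_eval x) \<in> span (range lip0_eval)" for x
  proof -
    obtain v where v: "v \<in> span (range lip0_eval)"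
      "\<And>f. blinfun_apply v f = apply_lip0 (blinfun_apply E f) x"
      using assms[of x] unfolding molecular_def by blast
    have "?L (lip0_eval x) = v"
      by (rule blinfun_eqI) (simp add: v(2) lip0_eval.rep_eq)
    with v(1) show ?thesis by simp
  qed
  have "?L ` span (range lip0_eval) \<subseteq> span (range lip0_eval)"
    unfolding linear_span_image[OF bounded_linear.linear[OF bl], symmetric]
    using ev by (intro span_minimal subspace_span) auto
  then have "?L ` closure (span (range lip0_eval)) \<subseteq> closure (span (range lip0_eval))"
    using closure_subset
    by (intro image_closure_subset linear_continuous_on bl) blast+
  then have "?L (Rep_lipfree \<mu>) \<in> closure (span (range lip0_eval))"
    using Rep_lipfree by blast
  then show ?thesis
    unfolding preadjoint_def by (rule Abs_lipfree_inverse)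
qed

lemma bounded_linear_preadjoint:
  assumes "\<And>x. molecular (\<lambda>f. apply_lip0 (blinfun_apply E f) x)"
  shows "bounded_linear (preadjoint E)"
    and "norm (preadjoint E \<mu>) \<le> norm E * norm \<mu>"
proof -
  note rep = Rep_preadjoint[OF assms]
  have le: "norm (preadjoint E \<mu>) \<le> norm E * norm \<mu>" for \<mu>
    by (metis norm_lipfree.rep_eq rep norm_blinfun_compose mult.commute)
  show "bounded_linear (preadjoint E)"
  proof (rule bounded_linear_intro[of _ "norm E"])
    show "preadjoint E (\<mu> + \<nu>) = preadjoint E \<mu> + preadjoint E \<nu>" for \<mu> \<nu>
      by (simp add: Rep_lipfree_inject[symmetric] rep plus_lipfree.rep_eq
          bounded_bilinear.add_left[OF bounded_bilinear_blinfun_compose])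
    show "preadjoint E (r *\<^sub>R \<mu>) = r *\<^sub>R preadjoint E \<mu>" for r \<mu>
      by (simp add: Rep_lipfree_inject[symmetric] rep scaleR_lipfree.rep_eq
          bounded_bilinear.scaleR_left[OF bounded_bilinear_blinfun_compose])
    show "norm (preadjoint E \<mu>) \<le> norm \<mu> * norm E" for \<mu>
      using le[of \<mu>] by (simp add: mult.commute)
  qed
  show "norm (preadjoint E \<mu>) \<le> norm E * norm \<mu>" by (rule le)
qed

lemma Rep_preadjoint_preadjoint:
  assumes "\<And>x. molecular (\<lambda>f. apply_lip0 (blinfun_apply E f) x)"
    and "\<And>x. molecular (\<lambda>f. apply_lip0 (blinfun_apply G f) x)"
  shows "blinfun_apply (Rep_lipfree (preadjoint G (preadjoint E \<mu>))) f = Rep_lipfree \<mu> (E (G f))"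
  by (simp add: Rep_preadjoint[OF assms(1)] Rep_preadjoint[OF assms(2)])

lemma blinfun_almost_norming:
  fixes v :: "'b::real_normed_vector \<Rightarrow>\<^sub>L real"
  assumes "0 < \<epsilon>"
  obtains f where "norm f \<le> 1" "norm v - \<epsilon> \<le> blinfun_apply v f"
proof (rule ccontr)
  assume "\<not> thesis"
  with that have less: "blinfun_apply v f < norm v - \<epsilon>" if "norm f \<le> 1" for f
    using \<open>norm f \<le> 1\<close> by force
  have "0 < norm v - \<epsilon>" using less[of 0] by simp
  then have "norm v \<le> norm v - \<epsilon>"
  proof (intro norm_blinfun_bound)
    fix f
    show "norm (blinfun_apply v f) \<le> (norm v - \<epsilon>) * norm f"
    proof (cases "f = 0")
      case False
      have "blinfun_apply v (f /\<^sub>R norm f) \<le> norm v - \<epsilon>"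
        "blinfun_apply v (- (f /\<^sub>R norm f)) \<le> norm v - \<epsilon>"
        using less[of "f /\<^sub>R norm f"] less[of "- (f /\<^sub>R norm f)"] False by auto
      then show ?thesis
        using False by (simp add: blinfun.scaleR_right blinfun.minus_right field_simps abs_le_iff)
    qed simp
  qed simp
  with assms show False by simp
qed

text \<open>Duality between l1-sums and sup-sums: each norm is nearly attained at some
  \<open>f i\<close> in the unit ball, and all of them are tested at once through the single
  function \<open>\<Sum>i\<in>I. G i (f i)\<close>.\<close>

lemma sum_norm_preadjoint_le:
  fixes G :: "'i \<Rightarrow> 'b::pointed_metric_space lip0 \<Rightarrow>\<^sub>L 'a::pointed_metric_space lip0"
  assumes mol: "\<And>i x. molecular (\<lambda>f. apply_lip0 (blinfun_apply (G i) f) x)"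
    and G: "\<And>f. (\<And>i. norm (f i) \<le> 1) \<Longrightarrow> norm (\<Sum>i\<in>I. G i (f i)) \<le> C"
    and "finite I"
  shows "(\<Sum>i\<in>I. norm (preadjoint (G i) \<mu>)) \<le> C * norm \<mu>"
proof (rule field_le_epsilon)
  fix e :: real assume "0 < e"
  \<comment> \<open>The total error is \<open>card I * \<epsilon>\<close>; the 1 in the denominator
    keeps \<open>\<epsilon>\<close> positive for empty \<open>I\<close>.\<close>
  define \<epsilon> where "\<epsilon> = e / (1 + card I)"
  have \<epsilon>: "0 < \<epsilon>" "card I * \<epsilon> \<le> e"
    using \<open>0 < e\<close> by (auto simp: \<epsilon>_def field_simps)
  have "\<exists>f. norm f \<le> 1 \<and> norm (preadjoint (G i) \<mu>) - \<epsilon> \<le> Rep_lipfree \<mu> (G i f)" for i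
    using blinfun_almost_norming[OF \<epsilon>(1), of "Rep_lipfree \<mu> o\<^sub>L G i"]
    by (metis Rep_preadjoint[OF mol] norm_lipfree.rep_eq blinfun_apply_blinfun_compose)
  then obtain f where f: "\<And>i. norm (f i) \<le> 1"
    "\<And>i. norm (preadjoint (G i) \<mu>) - \<epsilon> \<le> Rep_lipfree \<mu> (G i (f i))"
    by metis
  have "(\<Sum>i\<in>I. norm (preadjoint (G i) \<mu>)) - card I * \<epsilon>
      = (\<Sum>i\<in>I. norm (preadjoint (G i) \<mu>) - \<epsilon>)"
    by (simp add: sum_subtractf)
  also have "\<dots> \<le> (\<Sum>i\<in>I. Rep_lipfree \<mu> (G i (f i)))"
    by (intro sum_mono f)
  also have "\<dots> = Rep_lipfree \<mu> (\<Sum>i\<in>I. G i (f i))"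
    by (simp add: blinfun.sum_right)
  also have "\<dots> \<le> norm (Rep_lipfree \<mu>) * norm (\<Sum>i\<in>I. G i (f i))"
    using norm_blinfun[of "Rep_lipfree \<mu>" "\<Sum>i\<in>I. G i (f i)"] by simp
  also have "\<dots> \<le> norm \<mu> * C"
    using G[OF f(1)] by (simp add: norm_lipfree.rep_eq mult_left_mono)
  finally show "(\<Sum>i\<in>I. norm (preadjoint (G i) \<mu>)) \<le> C * norm \<mu> + e"
    using \<epsilon>(2) by (simp add: mult.commute)
qed

text \<open>The projection is \<open>T \<circ> S\<close>, and the bound for \<open>S\<close> is the
  lower bound for \<open>T\<close>.\<close>

lemma retract_complemented:
  fixes T :: "'a::real_normed_vector \<Rightarrow> 'b::real_normed_vector"
  assumes T: "bounded_linear T" and S: "bounded_linear S" and ST: "\<And>x. S (T x) = x"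
  shows "complemented_subspace (range T)" "linear_isomorphism_onto T (range T)"
proof -
  show "complemented_subspace (range T)"
    unfolding complemented_subspace_def
  proof (intro exI conjI)
    show "bounded_linear (T \<circ> S)"
      using bounded_linear_compose[OF T S] by (simp add: comp_def)
    show "(T \<circ> S) \<circ> (T \<circ> S) = T \<circ> S"
      by (simp add: ST fun_eq_iff)
    show "range (T \<circ> S) = range T"
      using ST by (metis comp_apply fun.set_map surjI)
  qed
  obtain B where "\<And>x. norm (S x) \<le> norm x * B"
    using bounded_linear.bounded[OF S] by blast
  then have "norm x \<le> B * norm (T x)" for x
    by (metis ST mult.commute)
  then show "linear_isomorphism_onto T (range T)"
    unfolding linear_isomorphism_onto_def using T ST by (metis injI)
qed

lemma linear_isomorphism_ontoI:
  assumes "bounded_linear T" "bounded_linear S" "\<And>x. S (T x) = x" "\<And>y. T (S y) = y"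
  shows "linear_isomorphism_onto T UNIV"
  using retract_complemented(2)[OF assms(1-3)] assms(4) by (metis surjI)

section \<open>The decomposition method\<close>

text \<open>Encodes a complemented l1-sum of copies of the whole space: \<open>J k\<close> embeds
  the k-th copy and \<open>P k\<close> reads it off. The uniform bound on \<open>J\<close> and the
  summability of \<open>norm (P k x)\<close> are the two halves of the l1-estimate.\<close>

locale ell1_copies =
  fixes J P :: "nat \<Rightarrow> 'x::banach \<Rightarrow> 'x" and C D :: real
  assumes bl_J: "\<And>k. bounded_linear (J k)" and bl_P: "\<And>k. bounded_linear (P k)"
    and J_bound: "\<And>k x. norm (J k x) \<le> C * norm x"
    and P_bound: "\<And>N x. (\<Sum>k<N. norm (P k x)) \<le> D * norm x"
    and PJ: "\<And>j k x. P j (J k x) = (if j = k then x else 0)"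
begin

text \<open>Moves the content of copy \<open>\<tau> k\<close> through \<open>e\<close> into copy
  \<open>\<sigma> k\<close>; the part of \<open>x\<close> outside the copies is dropped.\<close>

definition shift :: "(nat \<Rightarrow> nat) \<Rightarrow> (nat \<Rightarrow> nat) \<Rightarrow> ('x \<Rightarrow> 'x) \<Rightarrow> 'x \<Rightarrow> 'x" where
  "shift \<sigma> \<tau> e x = (\<Sum>k. J (\<sigma> k) (e (P (\<tau> k) x)))"

text \<open>The series converges absolutely: the \<open>J k\<close> are uniformly bounded, and
  injectivity of \<open>\<tau>\<close> makes the norms of \<open>P (\<tau> k) x\<close> a subfamily
  of a summable family.\<close>

lemma shift_props:
  assumes e: "bounded_linear e" and \<tau>: "inj \<tau>"
  shows summable_shift: "summable (\<lambda>k. J (\<sigma> k) (e (P (\<tau> k) x)))"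
    and bounded_linear_shift: "bounded_linear (shift \<sigma> \<tau> e)"
proof -
  obtain B where B: "0 \<le> B" "\<And>x. norm (e x) \<le> norm x * B"
    using bounded_linear.nonneg_bounded[OF e] by blast
  have D: "summable (\<lambda>k. norm (P k x))" "(\<Sum>k. norm (P k x)) \<le> D * norm x" for x
  proof -
    show s: "summable (\<lambda>k. norm (P k x))"
      using P_bound[of x] by (intro summableI_nonneg_bounded) auto
    show "(\<Sum>k. norm (P k x)) \<le> D * norm x"
      by (intro suminf_le_const s P_bound)
  qed
  have D': "summable (\<lambda>k. norm (P (\<tau> k) x))" "(\<Sum>k. norm (P (\<tau> k) x)) \<le> D * norm x" for x
    using summable_reindex[OF D(1) \<tau>, of x] suminf_reindex_mono[OF D(1) \<tau>, of x] D(2)[of x]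
    by (auto simp: comp_def intro: order_trans)
  have tm: "norm (J (\<sigma> k) (e (P (\<tau> k) x))) \<le> \<bar>C\<bar> * B * norm (P (\<tau> k) x)" for k x
  proof -
    have "norm (J (\<sigma> k) (e (P (\<tau> k) x))) \<le> C * norm (e (P (\<tau> k) x))"
      by (rule J_bound)
    also have "\<dots> \<le> \<bar>C\<bar> * norm (e (P (\<tau> k) x))"
      by (simp add: mult_right_mono)
    also have "\<dots> \<le> \<bar>C\<bar> * (norm (P (\<tau> k) x) * B)"
      by (intro mult_left_mono B) auto
    finally show ?thesis by (simp add: ac_simps)
  qed
  have s: "summable (\<lambda>k. norm (J (\<sigma> k) (e (P (\<tau> k) x))))" for x
    by (rule summable_comparison_test'[OF summable_mult[OF D'(1)], of 0 _ "\<bar>C\<bar> * B" x])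
      (use tm in auto)
  show s': "summable (\<lambda>k. J (\<sigma> k) (e (P (\<tau> k) x)))" for x
    by (rule summable_norm_cancel[OF s])
  interpret e: bounded_linear e by (rule e)
  interpret J: bounded_linear "J k" for k by (rule bl_J)
  interpret P: bounded_linear "P k" for k by (rule bl_P)
  show "bounded_linear (shift \<sigma> \<tau> e)"
  proof (rule bounded_linear_intro[of _ "\<bar>C\<bar> * B * D"])
    show "shift \<sigma> \<tau> e (x + y) = shift \<sigma> \<tau> e x + shift \<sigma> \<tau> e y" for x y
      by (simp add: shift_def e.add J.add P.add suminf_add[OF s' s', symmetric])
    show "shift \<sigma> \<tau> e (r *\<^sub>R x) = r *\<^sub>R shift \<sigma> \<tau> e x" for r x
      by (simp add: shift_def e.scaleR J.scaleR P.scaleR suminf_scaleR_right[OF s'])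
    show "norm (shift \<sigma> \<tau> e x) \<le> norm x * (\<bar>C\<bar> * B * D)" for x
    proof -
      have "norm (shift \<sigma> \<tau> e x) \<le> (\<Sum>k. norm (J (\<sigma> k) (e (P (\<tau> k) x))))"
        unfolding shift_def by (rule summable_norm[OF s])
      also have "\<dots> \<le> (\<Sum>k. \<bar>C\<bar> * B * norm (P (\<tau> k) x))"
        by (intro suminf_le tm s summable_mult D')
      also have "\<dots> = \<bar>C\<bar> * B * (\<Sum>k. norm (P (\<tau> k) x))"
        by (rule suminf_mult[OF D'(1)])
      also have "\<dots> \<le> \<bar>C\<bar> * B * (D * norm x)"
        using B by (intro mult_left_mono D') auto
      finally show ?thesis by (simp add: ac_simps)
    qed
  qed
qed

lemma P_shift:
  assumes e: "bounded_linear e" and \<tau>: "inj \<tau>"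
  shows "P j (shift \<sigma> \<tau> e x) = (\<Sum>k. if j = \<sigma> k then e (P (\<tau> k) x) else 0)"
  unfolding shift_def
  by (simp add: bounded_linear.suminf[OF bl_P summable_shift[OF assms]] PJ)

lemma P_shift_id:
  assumes "bounded_linear e" "inj \<tau>"
  shows "P j (shift (\<lambda>k. k) \<tau> e x) = e (P (\<tau> j) x)"
  unfolding P_shift[OF assms] using suminf_finite[of "{j}" "\<lambda>k. if j = k then e (P (\<tau> k) x) else 0"]
  by auto

lemma P_shift_Suc:
  assumes "bounded_linear e" "inj \<tau>"
  shows "P 0 (shift Suc \<tau> e x) = 0" "P (Suc j) (shift Suc \<tau> e x) = e (P (\<tau> j) x)"
  unfolding P_shift[OF assms]
  using suminf_finite[of "{j}" "\<lambda>k. if j = k then e (P (\<tau> k) x) else 0"]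
  by auto

text \<open>Hilbert's hotel: the copies of \<open>Y\<close> in the summands are moved one place up to make room for
  one more copy.\<close>

lemma absorb_retract:
  fixes T :: "'y::real_normed_vector \<Rightarrow> 'x"
  assumes T: "bounded_linear T" and S: "bounded_linear S" and ST: "\<And>y. S (T y) = y"
  obtains A :: "'x \<times> 'y \<Rightarrow> 'x" and A' where "bounded_linear A" "bounded_linear A'"
    "\<And>z. A' (A z) = z" "\<And>x. A (A' x) = x"
proof -
  define e where "e = T \<circ> S"
  have e: "bounded_linear e"
    unfolding e_def by (simp add: bounded_linear_compose[OF T S] comp_def)
  interpret e: bounded_linear e by (rule e)
  interpret T: bounded_linear T by (rule T)
  interpret S: bounded_linear S by (rule S)
  interpret J: bounded_linear "J k" for k by (rule bl_J)
  interpret P: bounded_linear "P k" for k by (rule bl_P)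
  have eT: "e (T y) = T y" and ee: "e (e x) = e x" and Se: "S (e x) = S x" for x y
    by (simp_all add: e_def ST)
  define I0 where "I0 = shift (\<lambda>k. k) (\<lambda>k. k) e"
  define Up where "Up = shift Suc (\<lambda>k. k) e"
  define Dn where "Dn = shift (\<lambda>k. k) Suc e"
  have bl: "bounded_linear I0" "bounded_linear Up" "bounded_linear Dn"
    unfolding I0_def Up_def Dn_def by (auto intro!: bounded_linear_shift[OF e])
  \<comment> \<open>\<open>I0\<close> projects onto the copies of the small space inside all
    summands. \<open>x - I0 x\<close> stays fixed, \<open>Up\<close> moves these copies one index
    up, and the vacated place 0 takes the new vector.\<close>
  define A where "A z = fst z - I0 (fst z) + Up (fst z) + J 0 (T (snd z))" for z
  define A' where "A' x = (x - I0 x + Dn x, S (P 0 x))" for x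
  note bl_intros = bounded_linear_add bounded_linear_sub bounded_linear_Pair bounded_linear_ident
    bounded_linear_fst bounded_linear_snd
    bounded_linear_compose[OF bl(1)] bounded_linear_compose[OF bl(2)] bounded_linear_compose[OF bl(3)]
    bounded_linear_compose[OF bl_J] bounded_linear_compose[OF T] bounded_linear_compose[OF S]
    bl_P bl
  have PI: "P j (I0 x) = e (P j x)" "P j (Dn x) = e (P (Suc j) x)"
    "P 0 (Up x) = 0" "P (Suc j) (Up x) = e (P j x)" for j x
    unfolding I0_def Up_def Dn_def by (simp_all add: P_shift_id[OF e] P_shift_Suc[OF e])
  \<comment> \<open>Place 0 is split off because \<open>Dn\<close> loses it; the remaining sum is
    what moving down and up again reproduces.\<close>
  have head: "I0 x = J 0 (e (P 0 x)) + shift Suc Suc e x" for x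
    unfolding I0_def shift_def
    using suminf_split_head[OF summable_shift[OF e, of "\<lambda>k. k" "\<lambda>k. k" x]] by simp
  have "A' (A z) = z" for z
  proof -
    obtain x y where z: "z = (x, y)" by force
    have PA: "P 0 (A z) = P 0 x - e (P 0 x) + T y"
      "P (Suc j) (A z) = P (Suc j) x - e (P (Suc j) x) + e (P j x)" for j
      by (simp_all add: A_def z P.add P.diff PI PJ)
    have eA: "e (P 0 (A z)) = T y" "e (P (Suc j) (A z)) = e (P j x)" for j
      by (simp_all add: PA e.add e.diff ee eT)
    have "I0 (A z) = J 0 (T y) + Up x"
      unfolding head by (simp add: eA Up_def shift_def)
    moreover have "Dn (A z) = I0 x"
      by (simp add: Dn_def I0_def shift_def eA)
    moreover have "S (P 0 (A z)) = y"
      by (simp add: PA S.add S.diff Se ST)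
    ultimately show ?thesis
      by (simp add: A'_def) (simp add: A_def z)
  qed
  moreover have "A (A' x) = x" for x
  proof -
    define u where "u = x - I0 x + Dn x"
    have eu: "e (P j u) = e (P (Suc j) x)" for j
      by (simp add: u_def P.add P.diff PI e.add e.diff ee)
    have "I0 u = Dn x" "Up u = shift Suc Suc e x"
      by (simp_all add: I0_def Dn_def Up_def shift_def eu)
    then have "A (A' x) = u - Dn x + shift Suc Suc e x + J 0 (e (P 0 x))"
      by (simp add: A_def A'_def u_def[symmetric] e_def)
    also have "\<dots> = x"
      by (simp add: u_def head)
    finally show ?thesis .
  qed
  moreover have "bounded_linear A" "bounded_linear A'"
    unfolding A_def A'_def by (intro bl_intros)+
  ultimately show ?thesis by (rule that[rotated 2])
qed

text \<open>With X and Y for the two spaces, the chain is Y ~ X x ker V ~ X x X x ker V ~ X x Y ~ X: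
  the splitting of Y by the projection \<open>U \<circ> V\<close>, then \<open>A2\<close> for X x X
  ~ X, the splitting again, and \<open>A\<close> for X x Y ~ X.\<close>

theorem pelczynski_decomposition:
  fixes T :: "'y::real_normed_vector \<Rightarrow> 'x" and V :: "'y \<Rightarrow> 'x"
  assumes T: "bounded_linear T" and S: "bounded_linear S" and ST: "\<And>y. S (T y) = y"
    and U: "bounded_linear U" and V: "bounded_linear V" and VU: "\<And>x. V (U x) = x"
  shows "\<exists>T' :: 'y \<Rightarrow> 'x. linear_isomorphism_onto T' UNIV"
proof -
  obtain A :: "'x \<times> 'y \<Rightarrow> 'x" and A' where A: "bounded_linear A" "bounded_linear A'"
    "\<And>z. A' (A z) = z" "\<And>x. A (A' x) = x"
    using absorb_retract[OF T S ST] by blast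
  obtain A2 :: "'x \<times> 'x \<Rightarrow> 'x" and A2' where A2: "bounded_linear A2" "bounded_linear A2'"
    "\<And>z. A2' (A2 z) = z" "\<And>x. A2 (A2' x) = x"
    using absorb_retract[OF bounded_linear_ident bounded_linear_ident] by blast
  interpret U: bounded_linear U by (rule U)
  interpret V: bounded_linear V by (rule V)
  \<comment> \<open>\<open>snd z - U (V (snd z))\<close> is the component in the kernel of
    \<open>V\<close> and is left untouched; the two X-components are merged by
    \<open>A2\<close>.\<close>
  define B where "B z = U (A2 (fst z, V (snd z))) + (snd z - U (V (snd z)))" for z
  define B' where "B' y = (fst (A2' (V y)), U (snd (A2' (V y))) + (y - U (V y)))" for y
  have VB: "V (B z) = A2 (fst z, V (snd z))" for z
    by (simp add: B_def V.add V.diff VU)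
  have "B' (B z) = z" for z
    by (simp add: B'_def VB A2) (simp add: B_def prod_eq_iff)
  moreover have "B (B' y) = y" for y
    by (simp add: B_def B'_def V.add V.diff VU U.add U.diff A2)
  moreover have "bounded_linear B"
  proof -
    have 1: "bounded_linear (\<lambda>z::'x \<times> 'y. V (snd z))"
      by (rule bounded_linear_compose[OF V bounded_linear_snd])
    have "bounded_linear (\<lambda>z::'x \<times> 'y. U (A2 (fst z, V (snd z))))"
      by (intro bounded_linear_compose[OF U] bounded_linear_compose[OF A2(1)]
          bounded_linear_Pair bounded_linear_fst 1)
    then show ?thesis
      unfolding B_def
      by (intro bounded_linear_add bounded_linear_sub bounded_linear_snd
          bounded_linear_compose[OF U 1])
  qed
  moreover have "bounded_linear B'"
  proof -
    have "bounded_linear (\<lambda>y. A2' (V y))"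
      by (rule bounded_linear_compose[OF A2(2) V])
    then have "bounded_linear (\<lambda>y. fst (A2' (V y)))" "bounded_linear (\<lambda>y. U (snd (A2' (V y))))"
      by (auto intro: bounded_linear_compose[OF U] bounded_linear_compose[OF bounded_linear_fst]
          bounded_linear_compose[OF bounded_linear_snd])
    then show ?thesis
      unfolding B'_def
      by (intro bounded_linear_Pair bounded_linear_add bounded_linear_sub bounded_linear_ident
          bounded_linear_compose[OF U V])
  qed
  ultimately show ?thesis
    using A bounded_linear_compose[of A B'] bounded_linear_compose[of B A']
    by (intro exI[of _ "\<lambda>y. A (B' y)"] linear_isomorphism_ontoI[of _ "\<lambda>x. B (A' x)"]) auto
qed

end

section \<open>Linear extension of Lipschitz functions\<close>

text \<open>For one pair of points at most \<open>2 * N\<close> functions contribute, so the bound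
  does not see how many there are in total.\<close>

lemma overlapping_sum_abs_diff:
  fixes u :: "'i \<Rightarrow> 'a::metric_space \<Rightarrow> real"
  assumes lip: "\<And>i x y. \<bar>u i x - u i y\<bar> \<le> L * dist x y"
    and fin: "\<And>x. finite {i. u i x \<noteq> 0}" and card: "\<And>x. card {i. u i x \<noteq> 0} \<le> N"
  shows "(\<Sum>i | u i x \<noteq> 0 \<or> u i y \<noteq> 0. \<bar>u i x - u i y\<bar>) \<le> 2 * real N * L * dist x y"
proof -
  let ?S = "\<lambda>x. {i. u i x \<noteq> 0}"
  have eq: "{i. u i x \<noteq> 0 \<or> u i y \<noteq> 0} = ?S x \<union> ?S y" by auto
  have "card (?S x \<union> ?S y) \<le> 2 * N"
    using card_Un_le[of "?S x" "?S y"] card[of x] card[of y] by linarith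
  moreover have "0 \<le> L * dist x y"
    using lip[of undefined x y] by linarith
  ultimately have "real (card (?S x \<union> ?S y)) * (L * dist x y) \<le> real (2 * N) * (L * dist x y)"
    by (intro mult_right_mono) (simp_all only: of_nat_le_iff)
  moreover have "(\<Sum>i\<in>?S x \<union> ?S y. \<bar>u i x - u i y\<bar>) \<le> real (card (?S x \<union> ?S y)) * (L * dist x y)"
    by (intro sum_bounded_above lip)
  ultimately show ?thesis
    unfolding eq by (simp add: mult.assoc)
qed

lemma overlapping_sum_lipschitz:
  fixes u :: "'i \<Rightarrow> 'a::metric_space \<Rightarrow> real"
  assumes lip: "\<And>i x y. \<bar>u i x - u i y\<bar> \<le> L * dist x y"
    and fin: "\<And>x. finite {i. u i x \<noteq> 0}" and card: "\<And>x. card {i. u i x \<noteq> 0} \<le> N"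
  shows "\<bar>(\<Sum>i | u i x \<noteq> 0. u i x) - (\<Sum>i | u i y \<noteq> 0. u i y)\<bar> \<le> 2 * real N * L * dist x y"
proof -
  let ?S = "{i. u i x \<noteq> 0 \<or> u i y \<noteq> 0}"
  have S: "finite ?S"
    using fin[of x] fin[of y] unfolding Collect_disj_eq by simp
  have "(\<Sum>i | u i x \<noteq> 0. u i x) = (\<Sum>i\<in>?S. u i x)" "(\<Sum>i | u i y \<noteq> 0. u i y) = (\<Sum>i\<in>?S. u i y)"
    by (rule sum.mono_neutral_left[OF S]; auto)+
  then have "\<bar>(\<Sum>i | u i x \<noteq> 0. u i x) - (\<Sum>i | u i y \<noteq> 0. u i y)\<bar> = \<bar>\<Sum>i\<in>?S. u i x - u i y\<bar>"
    by (simp add: sum_subtractf)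
  also have "\<dots> \<le> (\<Sum>i\<in>?S. \<bar>u i x - u i y\<bar>)"
    by (rule sum_abs)
  also have "\<dots> \<le> 2 * real N * L * dist x y"
    by (rule overlapping_sum_abs_diff[OF lip fin card])
  finally show ?thesis .
qed

text \<open>Volume comparison: the balls of radius \<open>a / 2\<close> around the points are
  disjoint and fit into one ball of radius \<open>R + a / 2\<close>.\<close>

lemma card_separated_le:
  fixes F :: "'e::euclidean_space set"
  assumes "finite F" "0 < a" "0 \<le> R" "F \<subseteq> cball p R"
    and sep: "\<And>x y. x \<in> F \<Longrightarrow> y \<in> F \<Longrightarrow> x \<noteq> y \<Longrightarrow> a \<le> dist x y"
  shows "real (card F) \<le> ((2 * R + a) / a) ^ DIM('e)"
proof -
  let ?n = "DIM('e)" and ?v = "unit_ball_vol (DIM('e))"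
  have disj: "disjoint_family_on (\<lambda>x. ball x (a / 2)) F"
    unfolding disjoint_family_on_def
  proof (intro ballI impI, rule ccontr)
    fix x y assume xy: "x \<in> F" "y \<in> F" "x \<noteq> y" "ball x (a / 2) \<inter> ball y (a / 2) \<noteq> {}"
    then obtain z where "dist x z < a / 2" "dist y z < a / 2" by auto
    then have "dist x y < a" by (smt (verit) dist_commute dist_triangle field_sum_of_halves)
    with sep[OF xy(1-3)] show False by simp
  qed
  have "(\<Sum>x\<in>F. measure lborel (ball x (a / 2))) = measure lborel (\<Union>x\<in>F. ball x (a / 2))"
    using disj assms(1) emeasure_lborel_ball_finite
    by (intro measure_finite_Union[symmetric]) (auto simp: less_top)
  also have "\<dots> \<le> measure lborel (ball p (R + a / 2))"
  proof (rule measure_mono_fmeasurable)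
    show "(\<Union>x\<in>F. ball x (a / 2)) \<subseteq> ball p (R + a / 2)"
    proof
      fix z assume "z \<in> (\<Union>x\<in>F. ball x (a / 2))"
      then obtain x where "x \<in> F" "dist x z < a / 2" by auto
      with \<open>F \<subseteq> cball p R\<close> have "dist p x \<le> R" "dist x z < a / 2" by auto
      then show "z \<in> ball p (R + a / 2)"
        using dist_triangle[of p z x] by simp
    qed
    show "ball p (R + a / 2) \<in> fmeasurable lborel"
      using emeasure_lborel_ball_finite[of p "R + a / 2"] by (simp add: fmeasurable_def)
  qed (use assms(1) in \<open>auto intro!: sets.finite_UN\<close>)
  finally have "real (card F) * (?v * (a / 2) ^ ?n) \<le> ?v * (R + a / 2) ^ ?n"
    using assms by (simp add: content_ball)
  then have "real (card F) * (a / 2) ^ ?n \<le> (R + a / 2) ^ ?n"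
    by (simp add: mult.left_commute)
  then have "real (card F) \<le> (R + a / 2) ^ ?n / (a / 2) ^ ?n"
    using assms by (simp add: pos_le_divide_eq)
  also have "\<dots> = ((R + a / 2) / (a / 2)) ^ ?n"
    by (rule power_divide[symmetric])
  also have "(R + a / 2) / (a / 2) = (2 * R + a) / a"
    using assms by (simp add: field_simps)
  finally show ?thesis .
qed

text \<open>A separated set of largest cardinality is automatically a net, since a point far from it
  could be added. Cardinalities are bounded because a ball of radius \<open>s / 2\<close> contains
  at most one point of an \<open>s\<close>-separated set.\<close>

lemma maximal_separated_set:
  fixes K :: "'a::metric_space set"
  assumes "compact K" "0 < s"
  obtains F where "finite F" "F \<subseteq> K" "\<And>x y. x \<in> F \<Longrightarrow> y \<in> F \<Longrightarrow> x \<noteq> y \<Longrightarrow> s \<le> dist x y"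
    "\<And>q. q \<in> K \<Longrightarrow> \<exists>z\<in>F. dist q z < s"
proof -
  obtain k where k: "finite k" "K \<subseteq> (\<Union>x\<in>k. ball x (s / 2))"
    using compactE_image[OF assms(1), of K "\<lambda>x. ball x (s / 2)"] assms(2)
    by (metis UN_I centre_in_ball half_gt_zero open_ball subsetI)
  define sep where "sep F \<longleftrightarrow> F \<subseteq> K \<and> finite F \<and> (\<forall>x\<in>F. \<forall>y\<in>F. x \<noteq> y \<longrightarrow> s \<le> dist x y)" for F
  have bound: "card F \<le> card k" if "sep F" for F
  proof -
    have "\<forall>z\<in>F. \<exists>x\<in>k. dist x z < s / 2"
      using that k(2) unfolding sep_def by (auto simp: subset_iff)
    then obtain c where c: "\<And>z. z \<in> F \<Longrightarrow> c z \<in> k" "\<And>z. z \<in> F \<Longrightarrow> dist (c z) z < s / 2"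
      by metis
    have "inj_on c F"
    proof (rule inj_onI, rule ccontr)
      fix x y assume xy: "x \<in> F" "y \<in> F" "c x = c y" "x \<noteq> y"
      have "dist x y < s"
        using c(2)[OF xy(1)] c(2)[OF xy(2)] xy(3) dist_triangle3[of x y "c x"] by simp
      with that xy show False unfolding sep_def by force
    qed
    then show ?thesis
      using c(1) k(1) by (intro card_inj_on_le) auto
  qed
  have "sep {}" by (simp add: sep_def)
  then obtain F where F: "sep F" "\<And>F'. sep F' \<Longrightarrow> card F' \<le> card F"
    using ex_has_greatest_nat[of sep "{}" card "Suc (card k)"] bound by (metis le_imp_less_Suc)
  show ?thesis
  proof (rule that[of F])
    show "\<exists>z\<in>F. dist q z < s" if "q \<in> K" for q
    proof (rule ccontr)
      assume *: "\<not> (\<exists>z\<in>F. dist q z < s)"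
      then have "sep (insert q F)"
        using F(1) that unfolding sep_def by (auto simp: dist_commute not_less)
      moreover have "q \<notin> F" using * assms(2) by auto
      ultimately show False
        using F(2)[of "insert q F"] F(1) unfolding sep_def by auto
    qed
  qed (use F(1) in \<open>auto simp: sep_def\<close>)
qed

section \<open>Whitney-type extension from a compact set\<close>

lemma dyadic_floor:
  assumes "0 < (d::real)"
  obtains k :: int where "2 powi k \<le> d" "d < 2 powi (k + 1)"
proof (rule that[of "\<lfloor>log 2 d\<rfloor>"])
  have "2 powr of_int \<lfloor>log 2 d\<rfloor> \<le> 2 powr (log 2 d)"
    by simp
  then show "2 powi \<lfloor>log 2 d\<rfloor> \<le> d"
    using assms by (simp add: powr_real_of_int')
  have "2 powr (log 2 d) < 2 powr of_int (\<lfloor>log 2 d\<rfloor> + 1)"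
    by (intro powr_less_mono) linarith+
  then show "d < 2 powi (\<lfloor>log 2 d\<rfloor> + 1)"
    using assms powr_real_of_int'[of 2 "\<lfloor>log 2 d\<rfloor> + 1"] by simp
qed


lemma compact_infdist_attained:
  fixes K :: "'a::metric_space set"
  assumes "compact K" "K \<noteq> {}"
  obtains q where "q \<in> K" "infdist y K = dist y q"
proof -
  obtain q where q: "q \<in> K" "\<And>p. p \<in> K \<Longrightarrow> dist y q \<le> dist y p"
    using continuous_attains_inf[OF assms, of "dist y"] continuous_on_dist[OF continuous_on_const continuous_on_id]
    by metis
  have "infdist y K = dist y q"
    using infdist_le[OF q(1), of y] q(2) assms(2)
    by (intro antisym) (auto simp: infdist_def intro!: cINF_greatest)
  with q(1) show ?thesis by (rule that)
qed

text \<open>Partition of unity subordinate to a Whitney-type cover of the complement of \<open>K\<close>: at distance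
  \<open>d\<close> from \<open>K\<close> the weights live on the maximal \<open>2\<^sup>k\<close>-separated subsets of \<open>K\<close> with
  \<open>2\<^sup>k < d < 8 \<cdot> 2\<^sup>k\<close>. Every weight is 1-Lipschitz, a bounded number of them is nonzero at each
  point and their sum is at least \<open>d / 2\<close>.\<close>

theorem lipschitz_extension_operator:
  fixes K :: "'a::metric_space set" and \<psi> :: "'a \<Rightarrow> 'e::euclidean_space"
  assumes K: "compact K" "K \<noteq> {}" and \<psi>: "bilipschitz_on K \<psi>"
  shows "\<exists>C (S :: 'a \<Rightarrow> 'a set) (w :: 'a \<Rightarrow> 'a \<Rightarrow> real). 0 \<le> C \<and>
    (\<forall>y. finite (S y) \<and> S y \<subseteq> K) \<and>
    (\<forall>f. \<forall>y\<in>K. (\<Sum>z\<in>S y. w y z * f z) = f y) \<and>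
    (\<forall>f L. 0 \<le> L \<longrightarrow> (\<forall>p\<in>K. \<forall>q\<in>K. \<bar>f p - f q\<bar> \<le> L * dist p q) \<longrightarrow>
       (\<forall>x y. \<bar>(\<Sum>z\<in>S x. w x z * f z) - (\<Sum>z\<in>S y. w y z * f z)\<bar> \<le> C * L * dist x y))"
proof -
  define s :: "int \<Rightarrow> real" where "s k = 2 powi k" for k
  have s_pos: "0 < s k" for k by (simp add: s_def)
  have s_Suc: "s (k + 1) = 2 * s k" for k
    by (simp add: s_def power_int_add_1)
  have "\<exists>F. finite F \<and> F \<subseteq> K \<and> (\<forall>x\<in>F. \<forall>y\<in>F. x \<noteq> y \<longrightarrow> s k \<le> dist x y) \<and>
      (\<forall>q\<in>K. \<exists>z\<in>F. dist q z < s k)" for k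
    using maximal_separated_set[OF K(1) s_pos[of k]] by metis
  then obtain N where N: "\<And>k. finite (N k)" "\<And>k. N k \<subseteq> K"
    "\<And>k x y. x \<in> N k \<Longrightarrow> y \<in> N k \<Longrightarrow> x \<noteq> y \<Longrightarrow> s k \<le> dist x y"
    "\<And>k q. q \<in> K \<Longrightarrow> \<exists>z\<in>N k. dist q z < s k"
    by metis
  define d where "d y = infdist y K" for y
  have d_lip: "\<bar>d x - d y\<bar> \<le> dist x y" for x y
    unfolding d_def by (rule infdist_triangle_abs)
  have d_le: "d y \<le> dist y q" if "q \<in> K" for y q
    unfolding d_def by (rule infdist_le[OF that])
  have d_pos: "0 < d y \<longleftrightarrow> y \<notin> K" for y
    using in_closed_iff_infdist_zero[OF compact_imp_closed[OF K(1)] K(2), of y]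
      infdist_nonneg[of y K] by (auto simp: d_def)
  \<comment> \<open>Indexed by pairs (scale, point). The factor 8 is 2^3: it restricts each
    \<open>y\<close> to three dyadic scales and still leaves room for the lower estimate
    \<open>t_lower\<close>.\<close>
  define u where "u i y = (if snd i \<in> N (fst i)
      then max 0 (min (d y - s (fst i)) (8 * s (fst i) - dist y (snd i))) else 0)" for i y
  define A where "A y = {i. u i y \<noteq> 0}" for y
  have u_nonneg: "0 \<le> u i y" for i y by (simp add: u_def)
  have u_lip: "\<bar>u i x - u i y\<bar> \<le> 1 * dist x y" for i x y
    using d_lip[of x y] dist_triangle[of x "snd i" y] dist_triangle[of y "snd i" x]
    by (auto simp: u_def dist_commute)
  have A_iff: "i \<in> A y \<longleftrightarrow> snd i \<in> N (fst i) \<and> s (fst i) < d y \<and> dist y (snd i) < 8 * s (fst i)" for i y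
    by (auto simp: A_def u_def)
  have A_K: "snd i \<in> K" if "i \<in> A y" for i y
    using that N(2) by (auto simp: A_iff)
  have A_dist: "dist y (snd i) < 8 * d y" if "i \<in> A y" for i y
    using that by (auto simp: A_iff)

  obtain c c' where c: "0 < c" "\<And>x y. x \<in> K \<Longrightarrow> y \<in> K \<Longrightarrow> c * dist x y \<le> dist (\<psi> x) (\<psi> y)"
    "\<And>x y. x \<in> K \<Longrightarrow> y \<in> K \<Longrightarrow> dist (\<psi> x) (\<psi> y) \<le> c' * dist x y"
    using \<psi> unfolding bilipschitz_on_def by metis
  \<comment> \<open>Net points within \<open>8 * s k\<close> of \<open>y\<close> are at most
    \<open>16 * s k\<close> apart; their images are \<open>c * s k\<close>-separated in a ball of
    radius \<open>16 * \<bar>c'\<bar> * s k\<close>, and the scale cancels in the packing bound. The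
    Euclidean embedding enters the extension through this count alone.\<close>
  define D where "D = nat \<lceil>((32 * \<bar>c'\<bar> + c) / c) ^ DIM('e)\<rceil>"
  have card_ball: "card {z\<in>N k. dist y z < 8 * s k} \<le> D" (is "card ?F \<le> D") for k y
  proof (cases "?F = {}")
    case False
    then obtain p where p: "p \<in> ?F" by blast
    have F: "?F \<subseteq> K" "finite ?F" using N(1,2)[of k] by auto
    have "inj_on \<psi> ?F"
    proof (rule inj_onI, rule ccontr)
      fix x y assume "x \<in> ?F" "y \<in> ?F" "\<psi> x = \<psi> y" "x \<noteq> y"
      with c(2)[of x y] F(1) have "c * dist x y \<le> 0" by auto
      with c(1) \<open>x \<noteq> y\<close> show False by (simp add: mult_le_0_iff)
    qed
    then have "real (card ?F) = real (card (\<psi> ` ?F))"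
      by (simp add: card_image)
    also have "\<dots> \<le> ((2 * (16 * \<bar>c'\<bar> * s k) + c * s k) / (c * s k)) ^ DIM('e)"
    proof (rule card_separated_le)
      show "\<psi> ` ?F \<subseteq> cball (\<psi> p) (16 * \<bar>c'\<bar> * s k)"
      proof clarify
        fix z assume z: "z \<in> N k" "dist y z < 8 * s k"
        have "dist (\<psi> p) (\<psi> z) \<le> c' * dist p z"
          using c(3) p z N(2) by auto
        also have "\<dots> \<le> \<bar>c'\<bar> * dist p z"
          by (simp add: mult_right_mono)
        also have "\<dots> \<le> \<bar>c'\<bar> * (16 * s k)"
          using p z dist_triangle3[of p z y] by (intro mult_left_mono) auto
        finally show "\<psi> z \<in> cball (\<psi> p) (16 * \<bar>c'\<bar> * s k)" by (simp add: ac_simps)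
      qed
      fix x y assume "x \<in> \<psi> ` ?F" "y \<in> \<psi> ` ?F" "x \<noteq> y"
      then obtain x' y' where xy: "x' \<in> ?F" "y' \<in> ?F" "x' \<noteq> y'" "x = \<psi> x'" "y = \<psi> y'" by blast
      have "c * s k \<le> c * dist x' y'"
        using xy c(1) by (intro mult_left_mono N(3)) auto
      also have "\<dots> \<le> dist x y"
        unfolding xy using xy F(1) by (intro c(2)) auto
      finally show "c * s k \<le> dist x y" .
    qed (use F c(1) s_pos[of k] in auto)
    also have "(2 * (16 * \<bar>c'\<bar> * s k) + c * s k) / (c * s k) = (32 * \<bar>c'\<bar> + c) / c"
      using c(1) s_pos[of k] by (simp add: field_simps)
    finally show ?thesis
      unfolding D_def by linarith
  next
    case True
    then show ?thesis by (simp only: card.empty)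
  qed

  have A_card: "finite (A y) \<and> card (A y) \<le> 3 * D" for y
  proof (cases "0 < d y")
    case True
    then obtain k where k: "s k \<le> d y" "d y < s (k + 1)"
      unfolding s_def by (rule dyadic_floor)
    \<comment> \<open>From \<open>s k \<le> d y < 2 * s k\<close> and
      \<open>s j < d y < 8 * s j\<close> follows \<open>k - 2 \<le> j \<le> k\<close>.\<close>
    let ?T = "Sigma {k-2..k} (\<lambda>k. {z\<in>N k. dist y z < 8 * s k})"
    have "A y \<subseteq> ?T"
    proof
      fix i assume i: "i \<in> A y"
      define j where "j = fst i"
      have "s j < d y" "d y < 8 * s j"
        using i d_le[OF A_K[OF i], of y] by (auto simp: A_iff j_def)
      moreover have "s (j + 1 + 1 + 1) = 8 * s j"
        by (simp only: s_Suc)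
      ultimately have "s j < s (k + 1) \<and> s k < s (j + 1 + 1 + 1)"
        using k by argo
      moreover have "m < n" if "s m < s n" for m n
      proof (rule ccontr)
        assume "\<not> m < n"
        then have "s n \<le> s m" unfolding s_def by (intro power_int_increasing) auto
        with that show False by simp
      qed
      ultimately have "j < k + 1" "k < j + 1 + 1 + 1" by blast+
      then show "i \<in> ?T"
        using i by (cases i) (auto simp: A_iff j_def)
    qed
    moreover have "card ?T \<le> 3 * D"
    proof -
      have "card ?T = (\<Sum>k\<in>{k-2..k}. card {z\<in>N k. dist y z < 8 * s k})"
        using N(1) by (intro card_SigmaI) auto
      also have "\<dots> \<le> (\<Sum>k\<in>{k-2..k}. D)"
        by (intro sum_mono card_ball)
      finally show ?thesis by simp
    qed
    moreover have "finite ?T" using N(1) by auto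
    ultimately show ?thesis
      using card_mono[of ?T "A y"] finite_subset[of "A y" ?T] by linarith
  next
    case False
    have "A y = {}"
    proof (rule ccontr)
      assume "A y \<noteq> {}"
      then obtain i where "i \<in> A y" by blast
      then have "s (fst i) < d y" by (simp add: A_iff)
      with s_pos[of "fst i"] False show False by linarith
    qed
    then show ?thesis by simp
  qed
  define t where "t y = (\<Sum>i\<in>A y. u i y)" for y
  have t_lower: "d y / 2 \<le> t y" if "y \<notin> K" for y
  proof -
    have "0 < d y" using that d_pos by simp
    then obtain k where k: "s k \<le> d y" "d y < s (k + 1)"
      unfolding s_def by (rule dyadic_floor)
    \<comment> \<open>One step below the dyadic scale of \<open>d y\<close>: then
      \<open>d y - s j\<close> is at least \<open>d y / 2\<close>. A net point within
      \<open>s j\<close> of the nearest point of \<open>K\<close> is closer than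
      \<open>5 * s j\<close> to \<open>y\<close>, which leaves \<open>8 * s j - dist y z\<close>
      above \<open>d y / 2\<close> too.\<close>
    define j where "j = k - 1"
    have j: "2 * s j \<le> d y" "d y < 4 * s j"
      using k s_Suc[of j] s_Suc[of k] by (simp_all add: j_def)
    obtain q where q: "q \<in> K" "d y = dist y q"
      unfolding d_def by (rule compact_infdist_attained[OF K])
    obtain z where z: "z \<in> N j" "dist q z < s j"
      using N(4)[OF q(1)] by blast
    have "dist y z < d y + s j"
      using dist_triangle[of y z q] z(2) q(2) by simp
    then have *: "d y / 2 \<le> u (j, z) y"
      using j z(1) by (simp add: u_def)
    then have "(j, z) \<in> A y"
      using \<open>0 < d y\<close> by (auto simp: A_def)
    then have "u (j, z) y \<le> t y"
      unfolding t_def using A_card[of y] u_nonneg by (intro member_le_sum) auto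
    with * show ?thesis by simp
  qed
  have diff: "(\<Sum>i\<in>A x \<union> A y. \<bar>u i x - u i y\<bar>) \<le> 6 * real D * dist x y" for x y
  proof -
    have "A x \<union> A y = {i. u i x \<noteq> 0 \<or> u i y \<noteq> 0}" by (auto simp: A_def)
    then show ?thesis
      using overlapping_sum_abs_diff[of u 1 "3 * D" x y, OF u_lip] A_card by (simp add: A_def)
  qed
  define X where "X f y = (if y \<in> K then f y else (\<Sum>i\<in>A y. u i y * f (snd i)) / t y)"
    for f :: "'a \<Rightarrow> real" and y
  have X_diff: "X f y - a = (\<Sum>i\<in>A y. u i y * (f (snd i) - a)) / t y" if "y \<notin> K" for f y a
  proof -
    have "0 < t y" using t_lower[OF that] d_pos[of y] that by simp
    moreover have "(\<Sum>i\<in>A y. u i y * (f (snd i) - a)) = (\<Sum>i\<in>A y. u i y * f (snd i)) - t y * a"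
      by (simp add: t_def right_diff_distrib sum_subtractf sum_distrib_right)
    ultimately show ?thesis
      using that by (simp add: X_def diff_divide_distrib)
  qed
  \<comment> \<open>Active net points lie within \<open>8 * d y \<le> 8 * dist y q\<close> of
    \<open>y\<close>, hence within \<open>9 * dist y q\<close> of \<open>q\<close>.\<close>
  have X_near: "\<bar>X f y - f q\<bar> \<le> 9 * L * dist y q"
    if L: "0 \<le> L" "\<And>p q. p \<in> K \<Longrightarrow> q \<in> K \<Longrightarrow> \<bar>f p - f q\<bar> \<le> L * dist p q"
      and q: "q \<in> K" for f L y q
  proof (cases "y \<in> K")
    case True
    then show ?thesis
      using L(2)[OF True q] mult_nonneg_nonneg[OF L(1), of "dist y q"] by (simp add: X_def)
  next
    case False
    have "0 < t y" using t_lower[OF False] d_pos[of y] False by simp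
    have "\<bar>\<Sum>i\<in>A y. u i y * (f (snd i) - f q)\<bar> \<le> (\<Sum>i\<in>A y. u i y * (9 * L * dist y q))"
    proof (rule order_trans[OF sum_abs sum_mono])
      fix i assume i: "i \<in> A y"
      have "\<bar>f (snd i) - f q\<bar> \<le> L * dist (snd i) q"
        by (rule L(2)[OF A_K[OF i] q])
      also have "\<dots> \<le> L * (9 * dist y q)"
        using A_dist[OF i] d_le[OF q, of y] dist_triangle3[of "snd i" q y]
        by (intro mult_left_mono L(1)) linarith
      finally show "\<bar>u i y * (f (snd i) - f q)\<bar> \<le> u i y * (9 * L * dist y q)"
        using u_nonneg[of i y] by (simp add: abs_mult mult_left_mono)
    qed
    also have "\<dots> = t y * (9 * L * dist y q)"
      by (simp add: t_def sum_distrib_right)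
    finally show ?thesis
      using \<open>0 < t y\<close> by (simp add: X_diff[OF False] abs_divide field_simps)
  qed
  \<comment> \<open>81 = 9 * 4 + 9 * 5 comes from comparing both values with \<open>f q\<close> when
    the points are close to \<open>K\<close> relative to their mutual distance; 288 = 12 * 6 * 2 * 2
    comes from the quotient rule when they are far from it.\<close>
  have X_lip_le: "\<bar>X f x - X f y\<bar> \<le> (81 + 288 * real D) * L * dist x y"
    if L: "0 \<le> L" "\<And>p q. p \<in> K \<Longrightarrow> q \<in> K \<Longrightarrow> \<bar>f p - f q\<bar> \<le> L * dist p q"
      and le: "d y \<le> d x" for f L x y
  proof -
    let ?\<delta> = "dist x y"
    have D0: "0 \<le> 288 * real D * L * ?\<delta>" "0 \<le> L * ?\<delta>" using L(1) by simp_all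
    obtain q where q: "q \<in> K" "d x = dist x q"
      unfolding d_def by (rule compact_infdist_attained[OF K])
    consider "y \<in> K" | "y \<notin> K" "d x \<le> 4 * ?\<delta>" | "y \<notin> K" "4 * ?\<delta> < d x"
      by linarith
    then show ?thesis
    proof cases
      case 1
      with X_near[OF L 1, of x] D0 show ?thesis by (simp add: X_def algebra_simps)
    next
      case 2
      have "\<bar>X f x - f q\<bar> \<le> 9 * L * (4 * ?\<delta>)"
        using X_near[OF L q(1), of x] mult_left_mono[OF 2(2), of "9 * L"] L(1) q(2) by simp
      moreover have "\<bar>X f y - f q\<bar> \<le> 9 * L * (5 * ?\<delta>)"
      proof -
        have "dist y q \<le> 5 * ?\<delta>"
          using dist_triangle3[of y q x] 2(2) q(2) by simp
        then show ?thesis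
          using X_near[OF L q(1), of y] mult_left_mono[of "dist y q" "5 * ?\<delta>" "9 * L"] L(1) by simp
      qed
      ultimately show ?thesis
        using D0 by (simp add: algebra_simps)
    next
      case 3
      then have x: "x \<notin> K" and dx: "0 < d x" using d_pos[of x] d_pos[of y] le by auto
      have t: "0 < t x" "0 < t y" "d x / 2 \<le> t x"
        using t_lower[OF x] t_lower[OF 3(1)] d_pos[of x] d_pos[of y] x 3(1) by auto
      \<comment> \<open>Relative to \<open>f q\<close> the values at active points are of size
        \<open>L * d x\<close>, which cancels the factor \<open>1 / t x\<close> of the
        normalisation.\<close>
      define F where "F i = f (snd i) - f q" for i :: "int \<times> 'a"
      let ?B = "A x \<union> A y"
      have finB: "finite ?B" using A_card by simp
      \<comment> \<open>8 from the range of the weights and at most 1/4 for passing from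
        \<open>y\<close> to \<open>x\<close>, generously rounded up to 11; one more for
        \<open>q\<close>.\<close>
      have F: "\<bar>F i\<bar> \<le> 12 * L * d x" if "i \<in> ?B" for i
      proof -
        have "dist x (snd i) < 11 * d x"
        proof (cases "i \<in> A x")
          case True
          with A_dist[OF True] dx show ?thesis by linarith
        next
          case False
          then have "dist y (snd i) < 8 * d y" using that A_dist[of i y] by blast
          then show ?thesis
            using le 3 dx dist_triangle[of x "snd i" y] by linarith
        qed
        then have "dist (snd i) q \<le> 12 * d x"
          using q(2) dist_triangle3[of "snd i" q x] by linarith
        moreover have "\<bar>F i\<bar> \<le> L * dist (snd i) q"
          unfolding F_def using that A_K[of i] q(1) by (intro L(2)) blast+
        ultimately show ?thesis
          using mult_left_mono[of "dist (snd i) q" "12 * d x" L] L(1) by simp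
      qed
      have ext: "(\<Sum>i\<in>A z. u i z * g i) = (\<Sum>i\<in>?B. u i z * g i)" if "z = x \<or> z = y" for z g
        using that by (intro sum.mono_neutral_left[OF finB]) (auto simp: A_def)
      have t_eq: "t z = (\<Sum>i\<in>?B. u i z)" if "z = x \<or> z = y" for z
        using ext[OF that, of "\<lambda>_. 1"] by (simp add: t_def)
      define a where "a z = (\<Sum>i\<in>?B. u i z * F i)" for z
      have X: "X f x - f q = a x / t x" "X f y - f q = a y / t y"
        using ext by (simp_all add: X_diff x 3(1) a_def F_def)
      have a_diff: "\<bar>a x - a y\<bar> \<le> 12 * L * d x * (6 * real D * ?\<delta>)"
      proof -
        have "\<bar>a x - a y\<bar> = \<bar>\<Sum>i\<in>?B. (u i x - u i y) * F i\<bar>"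
          by (simp add: a_def sum_subtractf left_diff_distrib)
        also have "\<dots> \<le> (\<Sum>i\<in>?B. \<bar>u i x - u i y\<bar> * (12 * L * d x))"
          by (rule order_trans[OF sum_abs sum_mono]) (simp add: abs_mult mult_left_mono F)
        also have "\<dots> = 12 * L * d x * (\<Sum>i\<in>?B. \<bar>u i x - u i y\<bar>)"
          by (simp add: sum_distrib_left mult.commute)
        also have "\<dots> \<le> 12 * L * d x * (6 * real D * ?\<delta>)"
          using L(1) dx by (intro mult_left_mono diff) auto
        finally show ?thesis .
      qed
      have a_y: "\<bar>a y\<bar> \<le> 12 * L * d x * t y"
      proof -
        have "\<bar>a y\<bar> \<le> (\<Sum>i\<in>?B. u i y * (12 * L * d x))"
          unfolding a_def
          by (rule order_trans[OF sum_abs sum_mono]) (simp add: abs_mult mult_left_mono F u_nonneg)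
        also have "\<dots> = 12 * L * d x * t y"
          by (simp add: t_eq sum_distrib_left mult.commute)
        finally show ?thesis .
      qed
      have t_diff: "\<bar>t y - t x\<bar> \<le> 6 * real D * ?\<delta>"
      proof -
        have "\<bar>t y - t x\<bar> = \<bar>\<Sum>i\<in>?B. u i x - u i y\<bar>"
          by (simp add: t_eq sum_subtractf abs_minus_commute)
        also have "\<dots> \<le> (\<Sum>i\<in>?B. \<bar>u i x - u i y\<bar>)" by (rule sum_abs)
        also have "\<dots> \<le> 6 * real D * ?\<delta>" by (rule diff)
        finally show ?thesis .
      qed
      \<comment> \<open>Quotient rule, arranged so that only \<open>t x\<close> has to be bounded
        below by a multiple of \<open>d x\<close>; \<open>a y / t y\<close> is a weighted average
        and bounded as such.\<close>
      have "X f x - X f y = (a x - a y) / t x + a y / t y * ((t y - t x) / t x)"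
      proof -
        have "X f x - X f y = a x / t x - a y / t y"
          using X by linarith
        also have "\<dots> = (a x - a y) / t x + a y / t y * ((t y - t x) / t x)"
          using t(1,2) by (simp add: field_simps)
        finally show ?thesis .
      qed
      then have "\<bar>X f x - X f y\<bar> \<le> \<bar>a x - a y\<bar> / t x + \<bar>a y\<bar> / t y * (\<bar>t y - t x\<bar> / t x)"
        using t abs_triangle_ineq[of "(a x - a y) / t x" "a y / t y * ((t y - t x) / t x)"]
        by (simp add: abs_mult)
      also have "\<dots> \<le> 12 * L * d x * (6 * real D * ?\<delta>) / t x
          + 12 * L * d x * (6 * real D * ?\<delta> / t x)"
        using t L(1) dx a_y
        by (intro add_mono mult_mono divide_right_mono a_diff t_diff)
          (auto simp: pos_divide_le_eq)
      also have "\<dots> = 144 * L * real D * ?\<delta> * (d x / t x)"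
        by (simp add: field_simps)
      also have "\<dots> \<le> 144 * L * real D * ?\<delta> * 2"
        using t L(1) by (intro mult_left_mono) (auto simp: pos_divide_le_eq)
      finally show ?thesis
        using D0 by (simp add: algebra_simps)
    qed
  qed
  have X_lip: "\<bar>X f x - X f y\<bar> \<le> (81 + 288 * real D) * L * dist x y"
    if "0 \<le> L" "\<And>p q. p \<in> K \<Longrightarrow> q \<in> K \<Longrightarrow> \<bar>f p - f q\<bar> \<le> L * dist p q" for f L x y
    using X_lip_le[OF that, of x y] X_lip_le[OF that, of y x]
    by (cases "d y \<le> d x") (auto simp: abs_minus_commute dist_commute)
  define S where "S y = (if y \<in> K then {y} else snd ` A y)" for y
  \<comment> \<open>The same point may belong to the nets of several scales, so its weights are
    added up.\<close>
  define w where "w y z = (if y \<in> K then 1 else (\<Sum>i | i \<in> A y \<and> snd i = z. u i y) / t y)" for y z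
  have Xw: "(\<Sum>z\<in>S y. w y z * f z) = X f y" for f y
  proof (cases "y \<in> K")
    case False
    have "(\<Sum>i\<in>A y. u i y * f (snd i)) = (\<Sum>z\<in>snd ` A y. \<Sum>i | i \<in> A y \<and> snd i = z. u i y * f (snd i))"
      using A_card by (intro sum.image_gen) auto
    also have "\<dots> = (\<Sum>z\<in>snd ` A y. (\<Sum>i | i \<in> A y \<and> snd i = z. u i y) * f z)"
      by (intro sum.cong refl) (simp add: sum_distrib_right)
    finally show ?thesis
      using False by (simp add: S_def w_def X_def sum_divide_distrib[of _ "snd ` A y"])
  qed (simp add: S_def w_def X_def)
  show ?thesis
  proof (intro exI[of _ "81 + 288 * real D"] exI[of _ S] exI[of _ w] conjI allI impI ballI)
    show "finite (S y)" "S y \<subseteq> K" for y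
      using A_card[of y] A_K by (auto simp: S_def)
    show "(\<Sum>z\<in>S y. w y z * f z) = f y" if "y \<in> K" for f y
      unfolding Xw using that by (simp add: X_def)
    show "\<bar>(\<Sum>z\<in>S x. w x z * f z) - (\<Sum>z\<in>S y. w y z * f z)\<bar>
        \<le> (81 + 288 * real D) * L * dist x y"
      if "0 \<le> L" "\<forall>p\<in>K. \<forall>q\<in>K. \<bar>f p - f q\<bar> \<le> L * dist p q" for f L x y
      unfolding Xw using that by (intro X_lip) auto
  qed simp
qed

text \<open>Product rule, expanded at a point where \<open>g\<close> does not vanish. As
  \<open>f\<close> is controlled only where \<open>g\<close> is nonzero, the two points are swapped
  if necessary.\<close>

lemma cutoff_mult_lipschitz:
  fixes g f :: "'a::metric_space \<Rightarrow> real"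
  assumes g: "\<And>x y. \<bar>g x - g y\<bar> \<le> a * dist x y" "\<And>x. \<bar>g x\<bar> \<le> 1"
    and f: "\<And>x. g x \<noteq> 0 \<Longrightarrow> \<bar>f x\<bar> \<le> b"
      "\<And>x y. g x \<noteq> 0 \<Longrightarrow> g y \<noteq> 0 \<Longrightarrow> \<bar>f x - f y\<bar> \<le> L * dist x y"
    and "0 \<le> b" "0 \<le> L"
  shows "\<bar>g x * f x - g y * f y\<bar> \<le> (a * b + L) * dist x y"
proof -
  have a0: "0 \<le> a * dist x y" using g(1)[of x y] by linarith
  have one: "\<bar>g x * f x - g y * f y\<bar> \<le> (a * b + L) * dist x y" if "g x \<noteq> 0" "a * dist x y \<ge> 0" for x y
  proof -
    have "\<bar>(g x - g y) * f x\<bar> \<le> a * dist x y * b"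
      using g(1)[of x y] f(1)[OF that(1)] that(2) unfolding abs_mult by (intro mult_mono) auto
    moreover have "\<bar>g y * (f x - f y)\<bar> \<le> L * dist x y"
    proof (cases "g y = 0")
      case False
      have "\<bar>g y\<bar> * \<bar>f x - f y\<bar> \<le> 1 * (L * dist x y)"
        using g(2)[of y] f(2)[OF that(1) False] by (intro mult_mono) auto
      then show ?thesis by (simp add: abs_mult)
    qed (simp add: \<open>0 \<le> L\<close>)
    moreover have "g x * f x - g y * f y = (g x - g y) * f x + g y * (f x - f y)"
      by (simp add: algebra_simps)
    ultimately show ?thesis
      using abs_triangle_ineq[of "(g x - g y) * f x" "g y * (f x - f y)"] by (simp add: algebra_simps)
  qed
  consider "g x \<noteq> 0" | "g y \<noteq> 0" | "g x = 0" "g y = 0" by blast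
  then show ?thesis
  proof cases
    case 1
    then show ?thesis using one a0 by blast
  next
    case 2
    then show ?thesis
      using one[of y x] a0 by (simp add: dist_commute abs_minus_commute)
  next
    case 3
    have "0 \<le> a * dist x y * b + L * dist x y" using a0 assms(5,6) by simp
    with 3 show ?thesis by (simp add: algebra_simps)
  qed
qed

section \<open>Spreading functions over disjoint balls\<close>

definition plateau :: "nat \<Rightarrow> 'v::real_normed_vector \<Rightarrow> real" where
  "plateau k x = max 0 (min 1 (2 - norm x / 2 ^ k))"

text \<open>The differences telescope to \<open>plateau n\<close>, which is 1 at \<open>x\<close>
  for large \<open>n\<close>. Index 0 keeps the whole inner ball, so that the pieces sum to 1 at the
  origin too.\<close>

definition annular :: "nat \<Rightarrow> 'v::real_normed_vector \<Rightarrow> real" where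
  "annular k x = plateau k x - (if k = 0 then 0 else plateau (k - 1) x)"

lemma plateau_bounds: "0 \<le> plateau k x" "plateau k x \<le> 1"
  by (auto simp: plateau_def)

lemma plateau_eq_1: "norm x \<le> 2 ^ k \<Longrightarrow> plateau k x = 1"
  by (simp add: plateau_def divide_simps)

lemma plateau_nonzeroD:
  assumes "plateau k x \<noteq> 0"
  shows "norm x < 2 ^ Suc k"
proof (rule ccontr)
  assume "\<not> norm x < 2 ^ Suc k"
  then have "2 \<le> norm x / 2 ^ k" by (simp add: pos_le_divide_eq)
  with assms show False by (simp add: plateau_def)
qed

lemma plateau_lipschitz: "\<bar>plateau k x - plateau k y\<bar> \<le> 1 / 2 ^ k * dist x y"
proof -
  have "\<bar>plateau k x - plateau k y\<bar> \<le> \<bar>norm x / 2 ^ k - norm y / 2 ^ k\<bar>"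
    by (auto simp: plateau_def)
  also have "\<dots> = \<bar>norm x - norm y\<bar> / 2 ^ k"
    by (simp add: diff_divide_distrib[symmetric])
  also have "\<dots> \<le> norm (x - y) / 2 ^ k"
    by (intro divide_right_mono norm_triangle_ineq3) simp
  finally show ?thesis by (simp add: dist_norm)
qed

lemma annular_lipschitz: "\<bar>annular k x - annular k y\<bar> \<le> 3 / 2 ^ k * dist x y"
proof (cases k)
  case 0
  have "1 * dist x y \<le> 3 * dist x y" by (intro mult_right_mono) auto
  then show ?thesis
    using plateau_lipschitz[of 0 x y] 0 by (simp add: annular_def)
next
  case (Suc j)
  then show ?thesis
  proof -
    have "\<bar>annular k x - annular k y\<bar> \<le> \<bar>plateau k x - plateau k y\<bar> + \<bar>plateau j x - plateau j y\<bar>"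
      using Suc by (simp add: annular_def)
    also have "\<dots> \<le> 1 / 2 ^ k * dist x y + 1 / 2 ^ j * dist x y"
      by (intro add_mono plateau_lipschitz)
    also have "\<dots> = 3 / 2 ^ k * dist x y"
      using Suc by (simp add: field_simps)
    finally show ?thesis .
  qed
qed

lemma annular_bound: "\<bar>annular k x\<bar> \<le> 1"
  using plateau_bounds[of k x] plateau_bounds[of "k - 1" x] by (auto simp: annular_def)

lemma annular_nonzeroD:
  assumes "annular k x \<noteq> 0"
  shows "norm x < 2 ^ Suc k" "k = 0 \<or> 2 ^ (k - 1) < norm x"
proof -
  show "norm x < 2 ^ Suc k"
  proof (rule ccontr)
    assume *: "\<not> norm x < 2 ^ Suc k"
    then have "plateau k x = 0" using plateau_nonzeroD by blast
    moreover have "plateau (k - 1) x = 0" if "k \<noteq> 0"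
    proof (rule ccontr)
      assume "plateau (k - 1) x \<noteq> 0"
      then have "norm x < 2 ^ k" using plateau_nonzeroD[of "k - 1" x] that by simp
      moreover have "(2::real) ^ k \<le> 2 ^ Suc k" by simp
      ultimately show False using * by linarith
    qed
    ultimately show False using assms by (auto simp: annular_def split: if_splits)
  qed
  show "k = 0 \<or> 2 ^ (k - 1) < norm x"
  proof (rule ccontr)
    assume "\<not> (k = 0 \<or> 2 ^ (k - 1) < norm x)"
    then have k: "k \<noteq> 0" "norm x \<le> 2 ^ (k - 1)" by auto
    moreover have "2 ^ (k - 1) \<le> (2::real) ^ k"
      by (rule power_increasing) auto
    ultimately have "norm x \<le> 2 ^ k" by linarith
    with k assms show False by (simp add: annular_def plateau_eq_1)
  qed
qed

text \<open>A nonzero \<open>annular k x\<close> places the norm between \<open>2 ^ (k - 1)\<close>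
  and \<open>2 ^ Suc k\<close> (only the upper bound for \<open>k = 0\<close>), so two active
  indices differ by at most 1.\<close>

lemma card_annular: "finite {k. annular k x \<noteq> 0}" "card {k. annular k x \<noteq> 0} \<le> 2"
proof -
  let ?A = "{k. annular k x \<noteq> 0}"
  have step: "l \<le> Suc k" if "k \<in> ?A" "l \<in> ?A" for k l
  proof (rule ccontr)
    assume "\<not> l \<le> Suc k"
    then have "l \<noteq> 0" "Suc k \<le> l - 1" by auto
    then have "2 ^ Suc k < norm x"
      using annular_nonzeroD(2)[of l x] that(2) power_increasing[of "Suc k" "l - 1" "2::real"] by simp
    with annular_nonzeroD(1)[of k x] that(1) show False by simp
  qed
  have "\<exists>m. ?A \<subseteq> {m, Suc m}"
  proof (cases "?A = {}")
    case False
    define m where "m = (LEAST k. k \<in> ?A)"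
    have "m \<in> ?A" using False unfolding m_def by (metis LeastI ex_in_conv)
    moreover have "m \<le> k" if "k \<in> ?A" for k
      using that unfolding m_def by (rule Least_le)
    ultimately show ?thesis
      using step by (intro exI[of _ m] subsetI) (metis insert_iff le_Suc_eq le_antisym)
  qed auto
  then obtain m where m: "?A \<subseteq> {m, Suc m}" by blast
  then show "finite ?A" by (rule finite_subset) simp
  show "card ?A \<le> 2" using card_mono[OF _ m] by simp
qed

lemma sum_annular: "(\<Sum>k | annular k x \<noteq> 0. annular k x) = 1"
proof -
  obtain n where n: "norm x < 2 ^ n"
    using real_arch_pow[of 2 "norm x"] by auto
  have sub: "{k. annular k x \<noteq> 0} \<subseteq> {..n}"
  proof
    fix k assume "k \<in> {k. annular k x \<noteq> 0}"
    then have "k = 0 \<or> 2 ^ (k - 1) < (2::real) ^ n"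
      using annular_nonzeroD(2)[of k x] n order_less_trans by blast
    then show "k \<in> {..n}"
      by (cases k) auto
  qed
  have "(\<Sum>k | annular k x \<noteq> 0. annular k x) = (\<Sum>k\<le>n. annular k x)"
    using sub by (intro sum.mono_neutral_left) auto
  also have "\<dots> = plateau n x"
    by (induction n) (simp_all add: annular_def)
  also have "\<dots> = 1" using n by (simp add: plateau_eq_1)
  finally show ?thesis .
qed

text \<open>Disjoint balls in the unit ball, indexed by pairs \<open>(m, k)\<close>. The ball \<open>(m, k)\<close> hosts a copy,
  scaled by \<open>scl (m, k)\<close>, of the restriction of a function to the ball of radius \<open>2\<^bsup>k + 2\<^esup>\<close>.\<close>

definition ctr :: "nat \<times> nat \<Rightarrow> 'v::euclidean_space" where
  "ctr i = (1 / 2) ^ (prod_encode i + 1) *\<^sub>R (SOME b. b \<in> Basis)"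

definition rad :: "nat \<times> nat \<Rightarrow> real" where
  "rad i = (1 / 2) ^ (prod_encode i + 4)"

definition scl :: "nat \<times> nat \<Rightarrow> real" where
  "scl i = rad i / 2 ^ (snd i + 2)"

lemma rad_pos: "0 < rad i" and scl_pos: "0 < scl i"
  by (simp_all add: rad_def scl_def)

text \<open>The centres lie on one ray and each radius is an eighth of the norm of its centre, so
  the ball stays in the shell between 7/16 and 9/16 of \<open>(1 / 2) ^ prod_encode i\<close>. Since
  9/32 < 7/16, the norm alone tells the balls apart.\<close>

lemma norm_in_ball:
  fixes z :: "'v::euclidean_space"
  assumes "dist z (ctr i) < rad i"
  shows "(1 / 2) ^ prod_encode i * (7 / 16) < norm z" "norm z < (1 / 2) ^ prod_encode i * (9 / 16)"
proof -
  have "(SOME b. b \<in> Basis) \<in> (Basis :: 'v set)"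
    by (simp add: some_in_eq)
  then have "norm (ctr i :: 'v) = (1 / 2) ^ (prod_encode i + 1)"
    by (simp add: ctr_def)
  moreover have "\<bar>norm z - norm (ctr i :: 'v)\<bar> < rad i"
    using assms norm_triangle_ineq3[of z "ctr i"] by (simp add: dist_norm)
  moreover have "rad i = (1 / 2) ^ prod_encode i * (1 / 16)"
    "(1 / 2 :: real) ^ (prod_encode i + 1) = (1 / 2) ^ prod_encode i * (1 / 2)"
    by (simp_all add: rad_def power_add power4_eq_xxxx)
  ultimately show "(1 / 2) ^ prod_encode i * (7 / 16) < norm z"
    "norm z < (1 / 2) ^ prod_encode i * (9 / 16)"
    by linarith+
qed

lemma balls_disjoint:
  fixes z :: "'v::euclidean_space"
  assumes "dist z (ctr i) < rad i" "dist z (ctr j) < rad j"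
  shows "i = j"
proof -
  have le: "\<not> p < q" if "(1 / 2) ^ p * (7 / 16) < r" "r < (1 / 2) ^ q * (9 / 16)" for p q and r :: real
  proof
    assume "p < q"
    then have "(1 / 2 :: real) ^ q \<le> (1 / 2) ^ Suc p"
      by (intro power_decreasing) auto
    moreover have "0 < (1 / 2 :: real) ^ p" by simp
    ultimately show False using that by simp
  qed
  have "prod_encode i = prod_encode j"
    using le[OF norm_in_ball(1)[OF assms(1)] norm_in_ball(2)[OF assms(2)]]
      le[OF norm_in_ball(1)[OF assms(2)] norm_in_ball(2)[OF assms(1)]] by linarith
  then show ?thesis by simp
qed

lemma ball_in_cball:
  fixes z :: "'v::euclidean_space"
  assumes "dist z (ctr i) < rad i"
  shows "z \<in> cball 0 1" "z \<noteq> 0"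
proof -
  have "(1 / 2 :: real) ^ prod_encode i \<le> 1" "0 < (1 / 2 :: real) ^ prod_encode i"
    by (simp_all add: power_le_one)
  then show "z \<in> cball 0 1" "z \<noteq> 0"
    using norm_in_ball[OF assms] by auto
qed

text \<open>The factor \<open>scl i\<close> in front undoes the effect of the dilation on Lipschitz
  constants. The cutoff has index \<open>snd i + 1\<close>, one more than the annulus it serves, so
  that it equals 1 wherever \<open>annular (snd i)\<close> is nonzero.\<close>

definition bump :: "nat \<times> nat \<Rightarrow> ('v::euclidean_space \<Rightarrow> real) \<Rightarrow> 'v \<Rightarrow> real" where
  "bump i f z = (let y = (z - ctr i) /\<^sub>R scl i in scl i * (plateau (snd i + 1) y * f y))"

definition spread :: "(nat \<Rightarrow> 'v::euclidean_space \<Rightarrow> real) \<Rightarrow> 'v \<Rightarrow> real" where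
  "spread F z = (\<Sum>i | bump i (F (fst i)) z \<noteq> 0. bump i (F (fst i)) z)"

text \<open>Left inverse of \<open>spread\<close> in slot \<open>m\<close>: the pieces are scaled
  back and reassembled with the weights \<open>annular k\<close>. Subtracting the value at the
  centre makes each piece vanish at 0 and makes the result blind to additive constants.\<close>

definition collect :: "nat \<Rightarrow> ('v::euclidean_space \<Rightarrow> real) \<Rightarrow> 'v \<Rightarrow> real" where
  "collect m g x = (\<Sum>k | annular k x \<noteq> 0.
     annular k x * ((g (ctr (m, k) + scl (m, k) *\<^sub>R x) - g (ctr (m, k))) / scl (m, k)))"

lemma bump_nonzeroD:
  assumes "bump i f z \<noteq> 0"
  shows "dist z (ctr i) < rad i"
proof -
  have "plateau (snd i + 1) ((z - ctr i) /\<^sub>R scl i) \<noteq> 0"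
    using assms by (auto simp: bump_def Let_def)
  then have "norm ((z - ctr i) /\<^sub>R scl i) < 2 ^ (snd i + 2)"
    using plateau_nonzeroD by fastforce
  then show ?thesis
    using scl_pos[of i] by (simp add: dist_norm scl_def divide_simps mult.commute)
qed

text \<open>Where the cutoff of slope \<open>1 / 2 ^ k\<close> acts, \<open>f 0 = 0\<close> bounds
  \<open>f\<close> by \<open>L * 2 ^ Suc k\<close>; this contributes 2, the function itself
  1.\<close>

lemma bump_lipschitz:
  fixes f :: "'v::euclidean_space \<Rightarrow> real"
  assumes "0 \<le> L" "\<And>x y. \<bar>f x - f y\<bar> \<le> L * dist x y" "f 0 = 0"
  shows "\<bar>bump i f x - bump i f y\<bar> \<le> 3 * L * dist x y"
proof -
  define k where "k = snd i + 1"
  have "\<bar>plateau k x * f x - plateau k y * f y\<bar> \<le> (1 / 2 ^ k * (L * 2 ^ Suc k) + L) * dist x y" for x y :: 'v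
  proof (rule cutoff_mult_lipschitz[OF plateau_lipschitz _ _ assms(2)])
    show "\<bar>plateau k z\<bar> \<le> 1" for z :: 'v using plateau_bounds[of k z] by simp
    show "\<bar>f z\<bar> \<le> L * 2 ^ Suc k" if "plateau k z \<noteq> 0" for z
    proof -
      have "\<bar>f z\<bar> \<le> L * norm z" using assms(2)[of z 0] assms(3) by simp
      also have "\<dots> \<le> L * 2 ^ Suc k"
        using plateau_nonzeroD[OF that] assms(1) by (intro mult_left_mono) auto
      finally show ?thesis .
    qed
  qed (use assms(1) in auto)
  then have *: "\<bar>plateau k x * f x - plateau k y * f y\<bar> \<le> 3 * L * dist x y" for x y :: 'v
    by (simp add: algebra_simps)
  let ?s = "\<lambda>z. (z - ctr i) /\<^sub>R scl i :: 'v"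
  have "\<bar>bump i f x - bump i f y\<bar> = scl i * \<bar>plateau k (?s x) * f (?s x) - plateau k (?s y) * f (?s y)\<bar>"
    using scl_pos[of i] by (simp add: bump_def Let_def k_def abs_mult flip: right_diff_distrib)
  also have "\<dots> \<le> scl i * (3 * L * dist (?s x) (?s y))"
    using scl_pos[of i] by (intro mult_left_mono *) auto
  also have "dist (?s x) (?s y) = dist x y / scl i"
    using scl_pos[of i] by (simp add: dist_norm divide_inverse_commute flip: scaleR_diff_right)
  finally show ?thesis using scl_pos[of i] by simp
qed

text \<open>The constant does not grow with the number of nonzero \<open>F m\<close>; dualised, this
  is the l1-bound on the coordinate maps.\<close>

lemma spread_lipschitz:
  fixes F :: "nat \<Rightarrow> 'v::euclidean_space \<Rightarrow> real"
  assumes "0 \<le> L" "\<And>m x y. \<bar>F m x - F m y\<bar> \<le> L * dist x y" "\<And>m. F m 0 = 0"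
  shows "\<bar>spread F x - spread F y\<bar> \<le> 6 * L * dist x y"
proof -
  have sub: "\<exists>j. {i. bump i (F (fst i)) z \<noteq> 0} \<subseteq> {j}" for z
    using balls_disjoint[OF bump_nonzeroD bump_nonzeroD] by blast
  have "\<bar>spread F x - spread F y\<bar> \<le> 2 * real 1 * (3 * L) * dist x y"
    unfolding spread_def
  proof (rule overlapping_sum_lipschitz)
    show "\<bar>bump i (F (fst i)) x - bump i (F (fst i)) y\<bar> \<le> 3 * L * dist x y" for i x y
      by (rule bump_lipschitz[OF assms])
    show "finite {i. bump i (F (fst i)) z \<noteq> 0}" for z
      using sub[of z] finite_subset by blast
    show "card {i. bump i (F (fst i)) z \<noteq> 0} \<le> 1" for z
      using sub[of z] card_mono[of "{j}" "{i. bump i (F (fst i)) z \<noteq> 0}" for j] by force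
  qed
  then show ?thesis by simp
qed

lemma spread_in_ball:
  assumes "dist z (ctr i) < rad i"
  shows "spread F z = bump i (F (fst i)) z"
proof -
  have "{j. bump j (F (fst j)) z \<noteq> 0} \<subseteq> {i}"
    using balls_disjoint[OF _ assms] bump_nonzeroD by blast
  then have "spread F z = (\<Sum>j\<in>{i}. bump j (F (fst j)) z)"
    unfolding spread_def by (intro sum.mono_neutral_left) auto
  then show ?thesis by simp
qed

lemma spread_outside:
  assumes "\<And>i. \<not> dist z (ctr i) < rad i"
  shows "spread F z = 0"
proof -
  have "{j. bump j (F (fst j)) z \<noteq> 0} = {}"
    using assms bump_nonzeroD by blast
  then show ?thesis unfolding spread_def by (simp only: sum.empty)
qed

lemma spread_zero: "spread F 0 = 0"
  using ball_in_cball(2) by (intro spread_outside) blast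

lemma collect_point_in_ball:
  assumes "annular k x \<noteq> 0"
  shows "dist (ctr (m, k) + scl (m, k) *\<^sub>R x) (ctr (m, k)) < rad (m, k)"
proof -
  have "norm x < 2 ^ (k + 2)"
    by (rule less_trans[OF annular_nonzeroD(1)[OF assms]]) (simp add: power_strict_increasing)
  then have "scl (m, k) * norm x < scl (m, k) * 2 ^ (k + 2)"
    using scl_pos by (intro mult_strict_left_mono)
  then show ?thesis
    using scl_pos[of "(m, k)"] rad_pos[of "(m, k)"] by (simp add: dist_norm scl_def)
qed

text \<open>28 = 2 * 2 * 7: at most two annuli are active at each of the two points, and a weighted
  piece has constant 3 * 2 + 1 = 7 because the pieces vanish at 0.\<close>

lemma collect_lipschitz:
  fixes g :: "'v::euclidean_space \<Rightarrow> real"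
  assumes "0 \<le> L" "\<And>x y. \<bar>g x - g y\<bar> \<le> L * dist x y"
  shows "\<bar>collect m g x - collect m g y\<bar> \<le> 28 * L * dist x y"
proof -
  define a where "a k x = (g (ctr (m, k) + scl (m, k) *\<^sub>R x) - g (ctr (m, k))) / scl (m, k)" for k x
  define w where "w k x = annular k x * a k x" for k x
  have a_lip: "\<bar>a k x - a k y\<bar> \<le> L * dist x y" for k x y
  proof -
    let ?c = "scl (m, k)"
    have "\<bar>a k x - a k y\<bar> = \<bar>g (ctr (m, k) + ?c *\<^sub>R x) - g (ctr (m, k) + ?c *\<^sub>R y)\<bar> / ?c"
      using scl_pos[of "(m, k)"] by (simp add: a_def flip: diff_divide_distrib)
    also have "\<dots> \<le> L * dist (ctr (m, k) + ?c *\<^sub>R x) (ctr (m, k) + ?c *\<^sub>R y) / ?c"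
      using scl_pos[of "(m, k)"] by (intro divide_right_mono assms) auto
    also have "dist (ctr (m, k) + ?c *\<^sub>R x) (ctr (m, k) + ?c *\<^sub>R y) = ?c * dist x y"
      using scl_pos[of "(m, k)"] by (simp add: dist_norm flip: scaleR_diff_right)
    finally show ?thesis using scl_pos[of "(m, k)"] by simp
  qed
  have a0: "a k 0 = 0" for k by (simp add: a_def)
  have w_lip: "\<bar>w k x - w k y\<bar> \<le> 7 * L * dist x y" for k x y
  proof -
    have "\<bar>w k x - w k y\<bar> \<le> (3 / 2 ^ k * (L * 2 ^ Suc k) + L) * dist x y"
      unfolding w_def
    proof (rule cutoff_mult_lipschitz[OF annular_lipschitz annular_bound _ a_lip])
      show "\<bar>a k z\<bar> \<le> L * 2 ^ Suc k" if "annular k z \<noteq> 0" for z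
      proof -
        have "\<bar>a k z\<bar> \<le> L * norm z" using a_lip[of k z 0] a0 by simp
        also have "\<dots> \<le> L * 2 ^ Suc k"
          using annular_nonzeroD(1)[OF that] assms(1) by (intro mult_left_mono) auto
        finally show ?thesis .
      qed
    qed (use assms(1) in auto)
    then show ?thesis by (simp add: algebra_simps)
  qed
  have sub: "{k. w k x \<noteq> 0} \<subseteq> {k. annular k x \<noteq> 0}" for x by (auto simp: w_def)
  have eq: "collect m g x = (\<Sum>k | w k x \<noteq> 0. w k x)" for x
    unfolding collect_def using sub card_annular(1)[of x]
    by (intro sum.mono_neutral_cong_right) (auto simp: w_def a_def)
  have "\<bar>collect m g x - collect m g y\<bar> \<le> 2 * real 2 * (7 * L) * dist x y"
    unfolding eq
  proof (rule overlapping_sum_lipschitz[OF w_lip])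
    show "finite {k. w k x \<noteq> 0}" for x
      by (rule finite_subset[OF sub card_annular(1)])
    show "card {k. w k x \<noteq> 0} \<le> 2" for x
      using card_mono[OF card_annular(1) sub, of x] card_annular(2)[of x] by linarith
  qed
  then show ?thesis by simp
qed

text \<open>\<open>collect\<close> evaluates its argument only inside the small balls. This is what
  allows a space that contains just a copy of the unit ball, with a base point anywhere.\<close>

lemma collect_cong:
  fixes g g' :: "'v::euclidean_space \<Rightarrow> real"
  assumes "\<And>z. z \<in> cball 0 1 \<Longrightarrow> g z = g' z + a"
  shows "collect m g x = collect m g' x"
proof -
  have "ctr (m, k) \<in> cball (0::'v) 1" for k
    using rad_pos by (intro ball_in_cball(1)[of _ "(m, k)"]) auto
  moreover have "ctr (m, k) + scl (m, k) *\<^sub>R x \<in> cball 0 1" if "annular k x \<noteq> 0" for k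
    by (rule ball_in_cball(1)[OF collect_point_in_ball[OF that]])
  ultimately show ?thesis
    unfolding collect_def using assms by (intro sum.cong refl) simp
qed

lemma collect_zero: "collect m g 0 = 0"
  by (simp add: collect_def)

text \<open>Where \<open>annular k\<close> is nonzero the cutoff in ball \<open>(m, k)\<close> is 1,
  so the scaled copy is exact there, and the weights sum to 1.\<close>

lemma collect_spread:
  fixes F :: "nat \<Rightarrow> 'v::euclidean_space \<Rightarrow> real"
  assumes "F m 0 = 0"
  shows "collect m (spread F) x = F m x"
proof -
  have "annular k x * ((spread F (ctr (m, k) + scl (m, k) *\<^sub>R x) - spread F (ctr (m, k))) / scl (m, k))
      = annular k x * F m x" if "annular k x \<noteq> 0" for k
  proof -
    have "plateau (k + 1) x = 1"
      using annular_nonzeroD(1)[OF that] by (intro plateau_eq_1) simp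
    then have "spread F (ctr (m, k) + scl (m, k) *\<^sub>R x) = scl (m, k) * F m x"
      using scl_pos[of "(m, k)"]
      by (simp add: spread_in_ball[OF collect_point_in_ball[OF that]] bump_def)
    moreover have "spread F (ctr (m, k)) = 0"
      using spread_in_ball[of "ctr (m, k)" "(m, k)" F] rad_pos[of "(m, k)"] assms by (simp add: bump_def)
    ultimately show ?thesis using scl_pos[of "(m, k)"] by simp
  qed
  then have "collect m (spread F) x = (\<Sum>k | annular k x \<noteq> 0. annular k x * F m x)"
    unfolding collect_def by (intro sum.cong) auto
  also have "\<dots> = F m x"
    by (simp add: sum_annular flip: sum_distrib_right)
  finally show ?thesis .
qed


section \<open>The l1-structure of the free space over Euclidean space\<close>

lemma apply_lip0_sum: "apply_lip0 (\<Sum>i\<in>I. f i) x = (\<Sum>i\<in>I. apply_lip0 (f i) x)"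
  by (induction I rule: infinite_finite_induct) (simp_all add: zero_lip0.rep_eq plus_lip0.rep_eq)

lemma molecular_collect:
  assumes "\<And>z. molecular (\<lambda>f. \<Lambda> f z)"
  shows "molecular (\<lambda>f. collect m (\<Lambda> f) x)"
proof -
  have "molecular (\<lambda>f. \<Sum>k | annular k x \<noteq> 0. annular k x * (1 / scl (m, k) *
      (\<Lambda> f (ctr (m, k) + scl (m, k) *\<^sub>R x) - \<Lambda> f (ctr (m, k)))))"
    by (intro molecular_sum molecular_scale molecular_diff assms)
  then show ?thesis by (simp add: collect_def)
qed

definition single :: "nat \<Rightarrow> ('v \<Rightarrow> real) \<Rightarrow> nat \<Rightarrow> 'v \<Rightarrow> real" where
  "single m f j = (if j = m then f else (\<lambda>_. 0))"

text \<open>As the balls are disjoint, the value at \<open>z\<close> is 0 or a multiple of a single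
  evaluation.\<close>

lemma molecular_spread:
  fixes z :: "real ^ 'n"
  shows "molecular (\<lambda>f. spread (single m (apply_lip0 f)) z)"
proof (cases "\<exists>i. dist z (ctr i) < rad i")
  case True
  then obtain i where i: "dist z (ctr i) < rad i" by blast
  let ?y = "(z - ctr i) /\<^sub>R scl i"
  have "molecular (\<lambda>f. if fst i = m then scl i * (plateau (snd i + 1) ?y * apply_lip0 f ?y) else 0)"
    by (cases "fst i = m") (simp_all add: molecular_scale molecular_eval molecular_zero)
  moreover have "spread (single m f) z = (if fst i = m then scl i * (plateau (snd i + 1) ?y * f ?y) else 0)"
    for f by (simp add: spread_in_ball[OF i] bump_def Let_def single_def)
  ultimately show ?thesis by simp
next
  case False
  then have "spread (single m f) z = 0" for f by (intro spread_outside) blast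
  then show ?thesis by auto
qed

text \<open>Turns a sum of operators into one \<open>spread\<close>, whose Lipschitz bound is
  independent of \<open>N\<close>.\<close>

lemma sum_spread_single:
  fixes z :: "'v::euclidean_space"
  shows "(\<Sum>j<N. spread (single j (f j)) z) = spread (\<lambda>j. if j < N then f j else (\<lambda>_. 0)) z"
proof (cases "\<exists>i. dist z (ctr i) < rad i")
  case True
  then obtain i where i: "dist z (ctr i) < rad i" by blast
  have [simp]: "bump i (\<lambda>_. 0) z = 0" by (simp add: bump_def)
  have "(\<Sum>j<N. bump i (single j (f j) (fst i)) z) = (\<Sum>j<N. if fst i = j then bump i (f j) z else 0)"
    by (intro sum.cong) (auto simp: single_def)
  then show ?thesis
    by (simp add: spread_in_ball[OF i])
next
  case False
  then have "spread F z = 0" for F by (intro spread_outside) blast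
  then show ?thesis by simp
qed

lemma lip0_spread_operator:
  "\<exists>G :: nat \<Rightarrow> (real ^ 'n) lip0 \<Rightarrow>\<^sub>L (real ^ 'n) lip0.
     (\<forall>m f x. apply_lip0 (G m f) x = spread (single m (apply_lip0 f)) x) \<and>
     (\<forall>m x. molecular (\<lambda>f. apply_lip0 (G m f) x))"
proof -
  have "\<exists>G :: (real ^ 'n) lip0 \<Rightarrow>\<^sub>L (real ^ 'n) lip0.
      (\<forall>f x. apply_lip0 (blinfun_apply G f) x = spread (single m (apply_lip0 f)) x
         - spread (single m (apply_lip0 f)) basepoint) \<and>
      (\<forall>x. molecular (\<lambda>f. apply_lip0 (blinfun_apply G f) x)) \<and> norm G \<le> 6" for m
  proof (rule lip0_operator)
    fix f :: "(real ^ 'n) lip0" and x y :: "real ^ 'n"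
    have "single m (apply_lip0 f) j 0 = 0" for j
      using apply_lip0_basepoint[of f] by (simp add: single_def basepoint_vec_def)
    then show "\<bar>spread (single m (apply_lip0 f)) x - spread (single m (apply_lip0 f)) y\<bar>
        \<le> 6 * norm f * dist x y"
      by (intro spread_lipschitz) (auto simp: single_def lip0_diff_le_norm)
  qed (auto intro: molecular_spread)
  moreover have "spread F (basepoint :: real ^ 'n) = 0" for F
    by (simp add: spread_zero basepoint_vec_def)
  ultimately have "\<forall>m. \<exists>G :: (real ^ 'n) lip0 \<Rightarrow>\<^sub>L (real ^ 'n) lip0.
      (\<forall>f x. apply_lip0 (blinfun_apply G f) x = spread (single m (apply_lip0 f)) x) \<and>
      (\<forall>x. molecular (\<lambda>f. apply_lip0 (blinfun_apply G f) x))"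
    by (metis diff_zero)
  then show ?thesis by metis
qed

lemma collect_spread_single:
  assumes "f 0 = 0"
  shows "collect k (spread (single j f)) x = (if j = k then f x else 0)"
  using assms by (subst collect_spread) (auto simp: single_def)

text \<open>Preadjoints reverse arrows: collecting, the left inverse on functions, becomes the
  embedding \<open>J\<close>, and spreading becomes the coordinate map \<open>P\<close>.\<close>

theorem lipfree_ell1_copies:
  obtains J P :: "nat \<Rightarrow> (real ^ 'n) lipfree \<Rightarrow> (real ^ 'n) lipfree" and C D
  where "ell1_copies J P C D"
proof -
  obtain G :: "nat \<Rightarrow> (real ^ 'n) lip0 \<Rightarrow>\<^sub>L (real ^ 'n) lip0"
    where G': "\<And>m f x. apply_lip0 (G m f) x = spread (single m (apply_lip0 f)) x"
    and G_mol: "\<And>m x. molecular (\<lambda>f. apply_lip0 (G m f) x)"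
    using lip0_spread_operator by metis
  have G: "apply_lip0 (G m f) = spread (single m (apply_lip0 f))" for m f
    using G' by blast
  have "\<exists>E :: (real ^ 'n) lip0 \<Rightarrow>\<^sub>L (real ^ 'n) lip0.
      (\<forall>f x. apply_lip0 (blinfun_apply E f) x = collect m (apply_lip0 f) x
         - collect m (apply_lip0 f) basepoint) \<and>
      (\<forall>x. molecular (\<lambda>f. apply_lip0 (blinfun_apply E f) x)) \<and> norm E \<le> 28" for m
  proof (rule lip0_operator)
    show "\<bar>collect m (apply_lip0 f) x - collect m (apply_lip0 f) y\<bar> \<le> 28 * norm f * dist x y"
      for f and x y :: "real ^ 'n"
      by (rule collect_lipschitz) (auto simp: lip0_diff_le_norm)
  qed (auto intro: molecular_collect)
  moreover have "collect m g (basepoint :: real ^ 'n) = 0" for m g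
    by (simp add: collect_zero basepoint_vec_def)
  ultimately have "\<forall>m. \<exists>E :: (real ^ 'n) lip0 \<Rightarrow>\<^sub>L (real ^ 'n) lip0.
      (\<forall>f x. apply_lip0 (blinfun_apply E f) x = collect m (apply_lip0 f) x) \<and>
      (\<forall>x. molecular (\<lambda>f. apply_lip0 (blinfun_apply E f) x)) \<and> norm E \<le> 28"
    by (metis diff_zero)
  then obtain E :: "nat \<Rightarrow> (real ^ 'n) lip0 \<Rightarrow>\<^sub>L (real ^ 'n) lip0" where
    E: "\<And>m f x. apply_lip0 (E m f) x = collect m (apply_lip0 f) x"
    and E_mol: "\<And>m x. molecular (\<lambda>f. apply_lip0 (E m f) x)" and E_norm: "\<And>m. norm (E m) \<le> 28"
    by metis
  have EG: "E k (G j f) = (if j = k then f else 0)" for j k f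
    using apply_lip0_basepoint[of f]
    by (intro lip0_eqI) (auto simp: E G collect_spread_single zero_lip0.rep_eq basepoint_vec_def)
  have "ell1_copies (\<lambda>k. preadjoint (E k)) (\<lambda>k. preadjoint (G k)) 28 6"
  proof (rule ell1_copies.intro)
    show "bounded_linear (preadjoint (E k))" for k
      by (intro bounded_linear_preadjoint E_mol)
    show "bounded_linear (preadjoint (G k))" for k
      by (intro bounded_linear_preadjoint G_mol)
    show "norm (preadjoint (E k) \<mu>) \<le> 28 * norm \<mu>" for k \<mu>
      using bounded_linear_preadjoint(2)[OF E_mol, of k \<mu>] mult_right_mono[OF E_norm[of k], of "norm \<mu>"]
      by simp
    show "(\<Sum>k<N. norm (preadjoint (G k) \<mu>)) \<le> 6 * norm \<mu>" for N \<mu>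
    proof (rule sum_norm_preadjoint_le[OF G_mol])
      fix f :: "nat \<Rightarrow> (real ^ 'n) lip0"
      assume f: "\<And>i. norm (f i) \<le> 1"
      have "\<bar>apply_lip0 (f i) x - apply_lip0 (f i) y\<bar> \<le> 1 * dist x y" for i x y
        using lip0_diff_le_norm[of "f i" x y] mult_right_mono[OF f[of i], of "dist x y"] by simp
      moreover have "apply_lip0 (f i) 0 = 0" for i
        using apply_lip0_basepoint[of "f i"] by (simp add: basepoint_vec_def)
      ultimately show "norm (\<Sum>i<N. G i (f i)) \<le> 6"
        using spread_lipschitz[of 1 "\<lambda>j. if j < N then apply_lip0 (f j) else (\<lambda>_. 0)"]
        by (intro lip0_norm_le) (auto simp: apply_lip0_sum G sum_spread_single)
    qed simp
    show "preadjoint (G j) (preadjoint (E k) \<mu>) = (if j = k then \<mu> else 0)" for j k \<mu>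
      by (rule Rep_lipfree_inject[THEN iffD1], rule blinfun_eqI)
        (auto simp: Rep_preadjoint_preadjoint[OF E_mol G_mol] EG zero_lipfree.rep_eq)
  qed
  then show thesis by (rule that)
qed

text \<open>Slot 0 of the spreading construction turns a function on Euclidean space into one living
  in the unit ball. It is carried to the copy of the ball and extended linearly to the whole space;
  restricting to the copy and collecting recovers the function.\<close>

theorem lipfree_retract_of_ball_copy:
  fixes \<phi> :: "real ^ 'n \<Rightarrow> 'a::pointed_metric_space"
  assumes "bilipschitz_on (cball 0 1) \<phi>"
  shows "\<exists>(U :: (real ^ 'n) lipfree \<Rightarrow> 'a lipfree) V.
    bounded_linear U \<and> bounded_linear V \<and> (\<forall>\<mu>. V (U \<mu>) = \<mu>)"
proof -
  let ?B = "cball (0 :: real ^ 'n) 1"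
  obtain c c' where c: "0 < c" "\<And>x y. x \<in> ?B \<Longrightarrow> y \<in> ?B \<Longrightarrow> c * dist x y \<le> dist (\<phi> x) (\<phi> y)"
    "\<And>x y. x \<in> ?B \<Longrightarrow> y \<in> ?B \<Longrightarrow> dist (\<phi> x) (\<phi> y) \<le> c' * dist x y"
    using assms unfolding bilipschitz_on_def by metis
  have c'_lip: "dist (\<phi> x) (\<phi> y) \<le> \<bar>c'\<bar> * dist x y" if "x \<in> ?B" "y \<in> ?B" for x y
    using c(3)[OF that] mult_right_mono[OF abs_ge_self[of c'], of "dist x y"] by simp
  define K where "K = \<phi> ` ?B"
  define \<psi> where "\<psi> = inv_into ?B \<phi>"
  have "inj_on \<phi> ?B"
  proof (rule inj_onI)
    fix x y assume "x \<in> ?B" "y \<in> ?B" "\<phi> x = \<phi> y"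
    with c(2)[of x y] have "c * dist x y \<le> 0" by simp
    with c(1) show "x = y" by (simp add: mult_le_0_iff)
  qed
  then have \<psi>\<phi>: "\<psi> (\<phi> x) = x" if "x \<in> ?B" for x
    using that by (simp add: \<psi>_def)
  have \<psi>_lip: "dist (\<psi> p) (\<psi> q) \<le> dist p q / c" if "p \<in> K" "q \<in> K" for p q
    using that c by (auto simp: K_def \<psi>\<phi> field_simps)
  have "bilipschitz_on K \<psi>"
    unfolding bilipschitz_on_def
  proof (intro exI conjI ballI)
    show "0 < 1 / (\<bar>c'\<bar> + 1)" by simp
    fix p q assume pq: "p \<in> K" "q \<in> K"
    then show "dist (\<psi> p) (\<psi> q) \<le> 1 / c * dist p q" using \<psi>_lip by simp
    from pq obtain x y where "x \<in> ?B" "y \<in> ?B" "p = \<phi> x" "q = \<phi> y" by (auto simp: K_def)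
    then show "1 / (\<bar>c'\<bar> + 1) * dist p q \<le> dist (\<psi> p) (\<psi> q)"
      using c'_lip[of x y] by (simp add: \<psi>\<phi> field_simps add_increasing)
  qed
  moreover have "compact K"
  proof -
    have "\<bar>c'\<bar>-lipschitz_on ?B \<phi>"
      using c'_lip by (intro lipschitz_onI) auto
    then show ?thesis
      unfolding K_def by (intro compact_continuous_image lipschitz_on_continuous_on compact_cball)
  qed
  moreover have "K \<noteq> {}" by (simp add: K_def)
  ultimately obtain C and S :: "'a \<Rightarrow> 'a set" and w where ext: "0 \<le> C"
    "\<forall>f. \<forall>y\<in>K. (\<Sum>z\<in>S y. w y z * f z) = f y"
    "\<forall>f L. 0 \<le> L \<longrightarrow> (\<forall>p\<in>K. \<forall>q\<in>K. \<bar>f p - f q\<bar> \<le> L * dist p q) \<longrightarrow>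
       (\<forall>x y. \<bar>(\<Sum>z\<in>S x. w x z * f z) - (\<Sum>z\<in>S y. w y z * f z)\<bar> \<le> C * L * dist x y)"
    using lipschitz_extension_operator[of K \<psi>] by blast
  obtain G :: "nat \<Rightarrow> (real ^ 'n) lip0 \<Rightarrow>\<^sub>L (real ^ 'n) lip0"
    where G': "\<And>m f x. apply_lip0 (G m f) x = spread (single m (apply_lip0 f)) x"
    and G_mol: "\<And>m x. molecular (\<lambda>f. apply_lip0 (G m f) x)"
    using lip0_spread_operator by metis
  have G: "apply_lip0 (G m f) = spread (single m (apply_lip0 f))" for m f
    using G' by blast
  define Ext where "Ext f y = (\<Sum>z\<in>S y. w y z * apply_lip0 (G 0 f) (\<psi> z))" for f y
  define GM_norm where "GM_norm = C * (norm (G 0) / c)"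
  have "\<exists>GM :: (real ^ 'n) lip0 \<Rightarrow>\<^sub>L 'a lip0.
      (\<forall>f x. apply_lip0 (blinfun_apply GM f) x = Ext f x - Ext f basepoint) \<and>
      (\<forall>x. molecular (\<lambda>f. apply_lip0 (blinfun_apply GM f) x)) \<and> norm GM \<le> GM_norm"
  proof (rule lip0_operator)
    show "0 \<le> GM_norm" using ext(1) c(1) by (simp add: GM_norm_def)
    show "molecular (\<lambda>f. Ext f x)" for x
      unfolding Ext_def by (intro molecular_sum molecular_scale G_mol)
    show "\<bar>Ext f x - Ext f y\<bar> \<le> GM_norm * norm f * dist x y" for f x y
    proof -
      let ?L = "norm (G 0) * norm f / c"
      have "\<bar>Ext f x - Ext f y\<bar> \<le> C * ?L * dist x y"
        unfolding Ext_def
      proof (rule ext(3)[rule_format])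
        fix p q assume pq: "p \<in> K" "q \<in> K"
        have "\<bar>apply_lip0 (G 0 f) (\<psi> p) - apply_lip0 (G 0 f) (\<psi> q)\<bar> \<le> norm (G 0 f) * dist (\<psi> p) (\<psi> q)"
          by (rule lip0_diff_le_norm)
        also have "\<dots> \<le> (norm (G 0) * norm f) * (dist p q / c)"
          by (intro mult_mono norm_blinfun \<psi>_lip pq) auto
        finally show "\<bar>apply_lip0 (G 0 f) (\<psi> p) - apply_lip0 (G 0 f) (\<psi> q)\<bar> \<le> ?L * dist p q"
          by simp
      qed (use c(1) in simp)
      then show ?thesis by (simp add: GM_norm_def)
    qed
  qed
  then obtain GM :: "(real ^ 'n) lip0 \<Rightarrow>\<^sub>L 'a lip0" where
    GM: "\<And>f x. apply_lip0 (GM f) x = Ext f x - Ext f basepoint"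
    and GM_mol: "\<And>x. molecular (\<lambda>f. apply_lip0 (GM f) x)"
    by metis
  \<comment> \<open>\<open>g \<circ> \<phi>\<close> is controlled only on the ball; composing with
    the nearest-point map gives a Lipschitz function on all of R^n that agrees with it on the
    ball.\<close>
  define clip where "clip x = closest_point ?B x" for x
  have clip_B: "clip x \<in> ?B" for x
    unfolding clip_def by (rule closest_point_in_set) auto
  have clip_id: "clip x = x" if "x \<in> ?B" for x
    unfolding clip_def using that by (rule closest_point_self)
  have clip_lip: "dist (clip x) (clip y) \<le> dist x y" for x y
    unfolding clip_def by (rule closest_point_lipschitz) auto
  define Coll where "Coll g = collect 0 (\<lambda>z. apply_lip0 g (\<phi> (clip z)))" for g
  have "\<exists>EM :: 'a lip0 \<Rightarrow>\<^sub>L (real ^ 'n) lip0.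
      (\<forall>g x. apply_lip0 (blinfun_apply EM g) x = Coll g x - Coll g basepoint) \<and>
      (\<forall>x. molecular (\<lambda>g. apply_lip0 (blinfun_apply EM g) x)) \<and> norm EM \<le> 28 * \<bar>c'\<bar>"
  proof (rule lip0_operator)
    fix g :: "'a lip0" and x y :: "real ^ 'n"
    have "\<bar>apply_lip0 g (\<phi> (clip p)) - apply_lip0 g (\<phi> (clip q))\<bar> \<le> norm g * \<bar>c'\<bar> * dist p q" for p q
    proof -
      have "dist (\<phi> (clip p)) (\<phi> (clip q)) \<le> \<bar>c'\<bar> * dist p q"
        by (rule order_trans[OF c'_lip[OF clip_B clip_B]]) (simp add: mult_left_mono clip_lip)
      then show ?thesis
        using lip0_diff_le_norm[of g "\<phi> (clip p)" "\<phi> (clip q)"]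
          mult_left_mono[of "dist (\<phi> (clip p)) (\<phi> (clip q))" _ "norm g"] by (fastforce simp: mult.assoc)
    qed
    then have "\<bar>Coll g x - Coll g y\<bar> \<le> 28 * (norm g * \<bar>c'\<bar>) * dist x y"
      unfolding Coll_def by (intro collect_lipschitz) auto
    then show "\<bar>Coll g x - Coll g y\<bar> \<le> 28 * \<bar>c'\<bar> * norm g * dist x y"
      by (simp add: ac_simps)
  qed (auto intro: molecular_collect simp: Coll_def)
  moreover have "Coll g basepoint = 0" for g
    by (simp add: Coll_def collect_zero basepoint_vec_def)
  ultimately obtain EM :: "'a lip0 \<Rightarrow>\<^sub>L (real ^ 'n) lip0" where
    EM: "\<And>g x. apply_lip0 (EM g) x = Coll g x"
    and EM_mol: "\<And>x. molecular (\<lambda>g. apply_lip0 (EM g) x)"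
    by (metis diff_zero)
  have "EM (GM f) = f" for f
  proof (rule lip0_eqI)
    fix x
    have f0: "apply_lip0 f 0 = 0"
      using apply_lip0_basepoint[of f] by (simp add: basepoint_vec_def)
    have "apply_lip0 (EM (GM f)) x = collect 0 (\<lambda>z. apply_lip0 (GM f) (\<phi> (clip z))) x"
      by (simp add: EM Coll_def)
    also have "\<dots> = collect 0 (apply_lip0 (G 0 f)) x"
    proof (rule collect_cong)
      fix z assume z: "z \<in> ?B"
      then have "\<phi> z \<in> K" by (simp add: K_def)
      then have "Ext f (\<phi> z) = apply_lip0 (G 0 f) z"
        unfolding Ext_def using ext(2)[rule_format, of "\<phi> z" "\<lambda>z. apply_lip0 (G 0 f) (\<psi> z)"] z by (simp add: \<psi>\<phi>)
      \<comment> \<open>Normalising at the base point shifts \<open>GM f\<close> by the constant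
        \<open>Ext f basepoint\<close>, which \<open>collect\<close> does not see.\<close>
      then show "apply_lip0 (GM f) (\<phi> (clip z)) = apply_lip0 (G 0 f) z + (- Ext f basepoint)"
        by (simp add: GM clip_id[OF z])
    qed
    also have "\<dots> = apply_lip0 f x"
      using f0 by (simp add: G collect_spread_single)
    finally show "apply_lip0 (EM (GM f)) x = apply_lip0 f x" .
  qed
  then have "preadjoint GM (preadjoint EM \<mu>) = \<mu>" for \<mu>
    by (intro Rep_lipfree_inject[THEN iffD1] blinfun_eqI)
      (simp add: Rep_preadjoint_preadjoint[OF EM_mol GM_mol])
  then show ?thesis
    using bounded_linear_preadjoint(1)[OF EM_mol] bounded_linear_preadjoint(1)[OF GM_mol] by blast
qed

section \<open>Locally embeddable compact spaces\<close>

text \<open>Putting the \<open>T i\<close> into different slots replaces a finite power of the space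
  by the space itself.\<close>

lemma (in ell1_copies) glue_retracts:
  fixes T :: "nat \<Rightarrow> 'y::real_normed_vector \<Rightarrow> 'x"
  assumes T: "\<And>i. i < N \<Longrightarrow> bounded_linear (T i)" and S: "\<And>i. i < N \<Longrightarrow> bounded_linear (S i)"
    and ST: "\<And>y. (\<Sum>i<N. S i (T i y)) = y"
  shows "\<exists>(T' :: 'y \<Rightarrow> 'x) S'. bounded_linear T' \<and> bounded_linear S' \<and> (\<forall>y. S' (T' y) = y)"
proof (intro exI conjI allI)
  show "bounded_linear (\<lambda>y. \<Sum>i<N. J i (T i y))" "bounded_linear (\<lambda>x. \<Sum>i<N. S i (P i x))"
    using T S by (auto intro!: bounded_linear_sum bounded_linear_compose[OF bl_J]
        intro: bounded_linear_compose[OF _ bl_P])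
  show "(\<Sum>i<N. S i (P i (\<Sum>j<N. J j (T j y)))) = y" for y
  proof -
    have "P i (\<Sum>j<N. J j (T j y)) = T i y" if "i < N" for i
    proof -
      have "P i (\<Sum>j<N. J j (T j y)) = (\<Sum>j<N. P i (J j (T j y)))"
        by (rule linear_sum[OF bounded_linear.linear[OF bl_P]])
      also have "\<dots> = (\<Sum>j<N. if i = j then T j y else 0)"
        by (intro sum.cong) (auto simp: PJ)
      also have "\<dots> = T i y" using that by simp
      finally show ?thesis .
    qed
    then show ?thesis using ST[of y] by simp
  qed
qed

section \<open>Charts and a Lipschitz partition of unity\<close>

lemma bilipschitz_on_compact_image:
  assumes "bilipschitz_on Q \<psi>" "compact Q"
  shows "compact (\<psi> ` Q)"
proof -
  obtain C where C: "\<And>x y. x \<in> Q \<Longrightarrow> y \<in> Q \<Longrightarrow> dist (\<psi> x) (\<psi> y) \<le> C * dist x y"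
    using assms(1) unfolding bilipschitz_on_def by metis
  have "\<bar>C\<bar>-lipschitz_on Q \<psi>"
    using C mult_right_mono[OF abs_ge_self[of C] zero_le_dist]
    by (intro lipschitz_onI) (blast intro: order_trans, simp)
  then show ?thesis
    using assms(2) by (intro compact_continuous_image lipschitz_on_continuous_on)
qed

text \<open>The assumption \<open>1 \<le> norm (\<psi> y)\<close> lets functions on \<open>Q\<close> be transported so that they vanish at
  the origin, the base point of \<open>real ^ 'n\<close>.\<close>

lemma chart_operators:
  fixes \<psi> :: "'a::pointed_metric_space \<Rightarrow> real ^ 'n" and w :: "'a \<Rightarrow> real"
  assumes Q: "compact Q" and \<psi>: "bilipschitz_on Q \<psi>" "\<And>y. y \<in> Q \<Longrightarrow> 1 \<le> norm (\<psi> y)"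
    and w: "\<And>x y. \<bar>w x - w y\<bar> \<le> a * dist x y" "\<And>y. \<bar>w y\<bar> \<le> 1" "\<And>y. w y \<noteq> 0 \<Longrightarrow> y \<in> Q"
    and "0 \<le> a"
  shows "\<exists>(E :: (real ^ 'n) lip0 \<Rightarrow>\<^sub>L 'a lip0) (G :: 'a lip0 \<Rightarrow>\<^sub>L (real ^ 'n) lip0).
    (\<forall>x. molecular (\<lambda>h. apply_lip0 (blinfun_apply E h) x)) \<and>
    (\<forall>x. molecular (\<lambda>f. apply_lip0 (blinfun_apply G f) x)) \<and>
    (\<forall>f y. apply_lip0 (blinfun_apply E (blinfun_apply G f)) y =
       w y * apply_lip0 f y - w basepoint * apply_lip0 f basepoint)"
proof -
  obtain c c' where c: "0 < c" "\<And>x y. x \<in> Q \<Longrightarrow> y \<in> Q \<Longrightarrow> c * dist x y \<le> dist (\<psi> x) (\<psi> y)"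
    "\<And>x y. x \<in> Q \<Longrightarrow> y \<in> Q \<Longrightarrow> dist (\<psi> x) (\<psi> y) \<le> c' * dist x y"
    using \<psi>(1) unfolding bilipschitz_on_def by metis
  have cK: "compact (\<psi> ` Q)"
    by (rule bilipschitz_on_compact_image[OF \<psi>(1) Q])
  then obtain B where B: "\<And>y. y \<in> Q \<Longrightarrow> norm (\<psi> y) \<le> B" "0 < B"
    using compact_imp_bounded bounded_pos[of "\<psi> ` Q"] by auto
  obtain R where R: "\<And>y. y \<in> Q \<Longrightarrow> dist y basepoint \<le> R" "0 \<le> R"
  proof -
    obtain R where "\<And>y. y \<in> Q \<Longrightarrow> dist basepoint y \<le> R"
      using compact_imp_bounded[OF Q] unfolding bounded_any_center[of Q basepoint] by auto
    then show thesis by (intro that[of "max 0 R"]) (auto simp: dist_commute le_max_iff_disj)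
  qed
  have "inj_on \<psi> Q"
  proof (rule inj_onI)
    fix x y assume "x \<in> Q" "y \<in> Q" "\<psi> x = \<psi> y"
    with c(2)[of x y] have "c * dist x y \<le> 0" by simp
    with c(1) show "x = y" by (simp add: mult_le_0_iff)
  qed
  define \<theta> where "\<theta> = inv_into Q \<psi>"
  have \<theta>: "\<theta> (\<psi> y) = y" if "y \<in> Q" for y
    using that \<open>inj_on \<psi> Q\<close> by (simp add: \<theta>_def)

  \<comment> \<open>With the origin in \<open>K\<close> and the value 0 prescribed there, the
    extension vanishes at the base point of the Euclidean side.\<close>
  define K where "K = insert 0 (\<psi> ` Q)"
  have "compact K" "K \<noteq> {}" "bilipschitz_on K (\<lambda>x. x)"
    using cK by (auto simp: K_def bilipschitz_on_def intro!: exI[of _ 1])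
  then obtain C and W :: "real ^ 'n \<Rightarrow> (real ^ 'n) set" and v where ext: "0 \<le> C"
    "\<forall>f. \<forall>y\<in>K. (\<Sum>z\<in>W y. v y z * f z) = f y"
    "\<forall>f L. 0 \<le> L \<longrightarrow> (\<forall>p\<in>K. \<forall>q\<in>K. \<bar>f p - f q\<bar> \<le> L * dist p q) \<longrightarrow>
       (\<forall>x y. \<bar>(\<Sum>z\<in>W x. v x z * f z) - (\<Sum>z\<in>W y. v y z * f z)\<bar> \<le> C * L * dist x y)"
    using lipschitz_extension_operator[of K "\<lambda>x. x"] by blast
  define tr where "tr f p = (if p = 0 then 0 else apply_lip0 f (\<theta> p))" for f and p :: "real ^ 'n"
  have tr_\<psi>: "tr f (\<psi> y) = apply_lip0 f y" if "y \<in> Q" for f y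
    using \<psi>(2)[OF that] that by (auto simp: tr_def \<theta>)
  have tr_0: "tr f 0 = 0" for f by (simp add: tr_def)
  have tr_lip: "\<bar>tr f p - tr f q\<bar> \<le> norm f * (1 / c + R) * dist p q" if "p \<in> K" "q \<in> K" for f p q
  proof -
    have A: "\<bar>tr f (\<psi> y) - tr f (\<psi> z)\<bar> \<le> norm f * (1 / c + R) * dist (\<psi> y) (\<psi> z)"
      if "y \<in> Q" "z \<in> Q" for y z
    proof -
      have "\<bar>tr f (\<psi> y) - tr f (\<psi> z)\<bar> \<le> norm f * dist y z"
        using that by (simp add: tr_\<psi> lip0_diff_le_norm)
      also have "\<dots> \<le> norm f * (1 / c * dist (\<psi> y) (\<psi> z))"
        using c(1) c(2)[OF that] by (intro mult_left_mono) (auto simp: field_simps)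
      also have "\<dots> \<le> norm f * ((1 / c + R) * dist (\<psi> y) (\<psi> z))"
        using R(2) by (intro mult_left_mono mult_right_mono) auto
      finally show ?thesis by (simp add: mult.assoc)
    qed
    \<comment> \<open>\<open>dist y basepoint \<le> R\<close> gives only a constant bound;
      \<open>1 \<le> norm (\<psi> y)\<close> turns it into a multiple of the distance to the
      origin.\<close>
    have Z: "\<bar>tr f (\<psi> y)\<bar> \<le> norm f * (1 / c + R) * norm (\<psi> y)" if "y \<in> Q" for y
    proof -
      have "\<bar>tr f (\<psi> y)\<bar> \<le> norm f * dist y basepoint"
        using lip0_diff_le_norm[of f y basepoint] that by (simp add: tr_\<psi>)
      also have "\<dots> \<le> norm f * ((1 / c + R) * 1)"
        using R(1)[OF that] c(1) by (intro mult_left_mono) (auto intro: add_increasing)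
      also have "\<dots> \<le> norm f * ((1 / c + R) * norm (\<psi> y))"
        using \<psi>(2)[OF that] c(1) R(2) by (intro mult_left_mono) auto
      finally show ?thesis by (simp add: mult.assoc)
    qed
    show ?thesis
      using that A Z by (auto simp: K_def tr_0 dist_norm)
  qed
  have mol_tr: "molecular (\<lambda>f. tr f p)" for p
    by (cases "p = 0") (simp_all add: tr_def molecular_zero molecular_eval)
  define Ext where "Ext f y = (\<Sum>z\<in>W y. v y z * tr f z)" for f y
  have Ext_K: "Ext f y = tr f y" if "y \<in> K" for f y
    unfolding Ext_def using ext(2) that by blast
  have "\<exists>G :: 'a lip0 \<Rightarrow>\<^sub>L (real ^ 'n) lip0.
      (\<forall>f x. apply_lip0 (blinfun_apply G f) x = Ext f x - Ext f basepoint) \<and>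
      (\<forall>x. molecular (\<lambda>f. apply_lip0 (blinfun_apply G f) x)) \<and> norm G \<le> C * (1 / c + R)"
  proof (rule lip0_operator)
    show "0 \<le> C * (1 / c + R)" using ext(1) c(1) R(2) by simp
    show "molecular (\<lambda>f. Ext f x)" for x
      unfolding Ext_def by (intro molecular_sum molecular_scale mol_tr)
    show "\<bar>Ext f x - Ext f y\<bar> \<le> C * (1 / c + R) * norm f * dist x y" for f x y
    proof -
      have "\<bar>Ext f x - Ext f y\<bar> \<le> C * (norm f * (1 / c + R)) * dist x y"
        unfolding Ext_def using c(1) R(2) tr_lip by (intro ext(3)[rule_format]) auto
      then show ?thesis by (simp add: ac_simps)
    qed
  qed
  moreover have "Ext f basepoint = 0" for f
    using Ext_K[of 0 f] by (simp add: K_def tr_0 basepoint_vec_def)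
  ultimately obtain G :: "'a lip0 \<Rightarrow>\<^sub>L (real ^ 'n) lip0" where
    G: "\<And>f x. apply_lip0 (G f) x = Ext f x"
    and G_mol: "\<And>x. molecular (\<lambda>f. apply_lip0 (G f) x)"
    by (metis diff_zero)
  \<comment> \<open>Outside \<open>Q\<close> the chart is uncontrolled, but there the weight
    \<open>w\<close> is 0.\<close>
  define M where "M h y = w y * apply_lip0 h (\<psi> y)" for h y
  have "\<exists>E :: (real ^ 'n) lip0 \<Rightarrow>\<^sub>L 'a lip0.
      (\<forall>h x. apply_lip0 (blinfun_apply E h) x = M h x - M h basepoint) \<and>
      (\<forall>x. molecular (\<lambda>h. apply_lip0 (blinfun_apply E h) x)) \<and> norm E \<le> a * B + \<bar>c'\<bar>"
  proof (rule lip0_operator)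
    show "0 \<le> a * B + \<bar>c'\<bar>" using \<open>0 \<le> a\<close> B(2) by simp
    show "molecular (\<lambda>h. M h x)" for x
      unfolding M_def by (intro molecular_scale molecular_eval)
    show "\<bar>M h x - M h y\<bar> \<le> (a * B + \<bar>c'\<bar>) * norm h * dist x y" for h x y
    proof -
      have "\<bar>M h x - M h y\<bar> \<le> (a * (norm h * B) + norm h * \<bar>c'\<bar>) * dist x y"
        unfolding M_def
      proof (rule cutoff_mult_lipschitz[OF w(1,2)])
        fix y assume "w y \<noteq> 0"
        then have y: "y \<in> Q" by (rule w(3))
        have "\<bar>apply_lip0 h (\<psi> y)\<bar> \<le> norm h * norm (\<psi> y)"
          using lip0_diff_le_norm[of h "\<psi> y" basepoint]
          by (simp add: basepoint_vec_def) (metis apply_lip0_basepoint basepoint_vec_def diff_zero)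
        also have "\<dots> \<le> norm h * B" using B(1)[OF y] by (intro mult_left_mono) auto
        finally show "\<bar>apply_lip0 h (\<psi> y)\<bar> \<le> norm h * B" .
      next
        fix x y assume "w x \<noteq> 0" "w y \<noteq> 0"
        then have xy: "x \<in> Q" "y \<in> Q" using w(3) by auto
        have "\<bar>apply_lip0 h (\<psi> x) - apply_lip0 h (\<psi> y)\<bar> \<le> norm h * dist (\<psi> x) (\<psi> y)"
          by (rule lip0_diff_le_norm)
        also have "\<dots> \<le> norm h * (\<bar>c'\<bar> * dist x y)"
          using c(3)[OF xy] mult_right_mono[OF abs_ge_self[of c'] zero_le_dist[of x y]]
          by (intro mult_left_mono) auto
        finally show "\<bar>apply_lip0 h (\<psi> x) - apply_lip0 h (\<psi> y)\<bar> \<le> norm h * \<bar>c'\<bar> * dist x y"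
          by (simp add: mult.assoc)
      qed (use B(2) in auto)
      then show ?thesis by (simp add: algebra_simps)
    qed
  qed
  then obtain E :: "(real ^ 'n) lip0 \<Rightarrow>\<^sub>L 'a lip0" where
    E: "\<And>h x. apply_lip0 (E h) x = M h x - M h basepoint"
    and E_mol: "\<And>x. molecular (\<lambda>h. apply_lip0 (E h) x)"
    by metis
  have "M (G f) y = w y * apply_lip0 f y" for f y
  proof (cases "w y = 0")
    case False
    then have "y \<in> Q" by (rule w(3))
    then show ?thesis by (simp add: M_def G Ext_K K_def tr_\<psi>)
  qed (simp add: M_def)
  then have "apply_lip0 (E (G f)) y = w y * apply_lip0 f y - w basepoint * apply_lip0 f basepoint" for f y
    by (simp add: E)
  with E_mol G_mol show ?thesis by blast
qed

lemma local_chart: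
  fixes x :: "'a::metric_space"
  assumes "x \<in> interior U" "bilipschitz_embeddable U (UNIV :: (real ^ 'n) set)"
  shows "\<exists>r>0. \<exists>\<psi> :: 'a \<Rightarrow> real ^ 'n. bilipschitz_on (cball x r) \<psi> \<and> (\<forall>y\<in>cball x r. 1 \<le> norm (\<psi> y))"
proof -
  obtain \<phi> :: "'a \<Rightarrow> real ^ 'n" where "bilipschitz_on U \<phi>"
    using assms(2) unfolding bilipschitz_embeddable_def by blast
  then obtain c C where c: "0 < c" "\<And>y z. y \<in> U \<Longrightarrow> z \<in> U \<Longrightarrow>
      c * dist y z \<le> dist (\<phi> y) (\<phi> z) \<and> dist (\<phi> y) (\<phi> z) \<le> C * dist y z"
    unfolding bilipschitz_on_def by metis
  obtain r where r: "0 < r" "cball x r \<subseteq> U"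
    using assms(1) by (meson mem_interior_cball)
  \<comment> \<open>The image of the ball lies within \<open>\<bar>C\<bar> * r\<close> of
    \<open>\<phi> x\<close>. Moving \<open>\<phi> x\<close> to a vector of length
    \<open>\<bar>C\<bar> * r + 1\<close> in an arbitrary coordinate direction leaves norm at least
    1.\<close>
  define b where "b = \<phi> x - (\<bar>C\<bar> * r + 1) *\<^sub>R axis undefined 1"
  have "1 \<le> norm (\<phi> y - b)" if "y \<in> cball x r" for y
  proof -
    have "norm (\<phi> y - \<phi> x) \<le> \<bar>C\<bar> * r"
    proof -
      have "norm (\<phi> y - \<phi> x) \<le> C * dist y x"
        using c(2)[of y x] r that by (auto simp: dist_norm[of "\<phi> y"] subset_iff)
      also have "\<dots> \<le> \<bar>C\<bar> * r"
        using that by (intro mult_mono) (auto simp: dist_commute)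
      finally show ?thesis .
    qed
    moreover have "norm ((\<bar>C\<bar> * r + 1) *\<^sub>R axis undefined (1::real) :: real ^ 'n) = \<bar>C\<bar> * r + 1"
      using r(1) by (simp add: norm_axis_1)
    ultimately show ?thesis
      using norm_diff_ineq[of "(\<bar>C\<bar> * r + 1) *\<^sub>R axis undefined (1::real)" "\<phi> y - \<phi> x"]
      by (simp add: b_def algebra_simps)
  qed
  moreover have "bilipschitz_on (cball x r) (\<lambda>y. \<phi> y - b)"
    unfolding bilipschitz_on_def
  proof (intro exI conjI ballI)
    fix y z assume "y \<in> cball x r" "z \<in> cball x r"
    with r(2) have "y \<in> U" "z \<in> U" by auto
    with c(2) show "c * dist y z \<le> dist (\<phi> y - b) (\<phi> z - b)" "dist (\<phi> y - b) (\<phi> z - b) \<le> C * dist y z"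
      by (auto simp: dist_norm[of "\<phi> y - b" for y] dist_norm[of "\<phi> y" for y])
  qed (rule c(1))
  ultimately show ?thesis using r(1) by blast
qed

lemma Rep_lipfree_sum: "Rep_lipfree (\<Sum>i\<in>I. \<mu> i) = (\<Sum>i\<in>I. Rep_lipfree (\<mu> i))"
  by (induction I rule: infinite_finite_induct) (simp_all add: zero_lipfree.rep_eq plus_lipfree.rep_eq)

text \<open>Compactness gives finitely many charts and a positive lower bound for \<open>t\<close>,
  hence Lipschitz weights \<open>w i\<close>. The chart operators factor multiplication by
  \<open>w i\<close> through functions on Euclidean space, and these multiplications add up to the
  identity.\<close>

theorem lipfree_retract_of_locally_embeddable:
  assumes cpt: "compact (UNIV :: 'a::pointed_metric_space set)"
    and loc: "\<And>x::'a. \<exists>U. x \<in> interior U \<and> bilipschitz_embeddable U (UNIV :: (real ^ 'n) set)"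
  shows "\<exists>(T :: 'a lipfree \<Rightarrow> (real ^ 'n) lipfree) S.
    bounded_linear T \<and> bounded_linear S \<and> (\<forall>\<mu>. S (T \<mu>) = \<mu>)"
proof -
  have "\<exists>r>0. \<exists>\<psi> :: 'a \<Rightarrow> real ^ 'n. bilipschitz_on (cball x r) \<psi> \<and> (\<forall>y\<in>cball x r. 1 \<le> norm (\<psi> y))" for x
    using loc[of x] local_chart by blast
  then obtain r and \<psi> :: "'a \<Rightarrow> 'a \<Rightarrow> real ^ 'n" where r: "\<And>x. 0 < r x"
    and \<psi>: "\<And>x. bilipschitz_on (cball x (r x)) (\<psi> x)" "\<And>x y. y \<in> cball x (r x) \<Longrightarrow> 1 \<le> norm (\<psi> x y)"
    by metis
  obtain D where D: "finite D" "UNIV \<subseteq> (\<Union>x\<in>D. ball x (r x))"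
  proof (rule compactE_image[OF cpt, of UNIV "\<lambda>x. ball x (r x)"])
    show "UNIV \<subseteq> (\<Union>x. ball x (r x))"
    proof
      fix x show "x \<in> (\<Union>x. ball x (r x))" using r[of x] by (intro UN_I[of x]) auto
    qed
  qed auto
  then obtain N and p :: "nat \<Rightarrow> 'a" where p: "D = p ` {..<N}"
    using finite_imp_nat_seg_image_inj_on[OF D(1)] by (metis lessThan_def)
  define u where "u i y = max 0 (r (p i) - dist y (p i))" for i y
  define t where "t y = (\<Sum>i<N. u i y)" for y
  have u_lip: "\<bar>u i y - u i z\<bar> \<le> dist y z" for i y z
    using dist_triangle[of y "p i" z] dist_triangle[of z "p i" y] by (auto simp: u_def dist_commute)
  have u_nonneg: "0 \<le> u i y" for i y by (simp add: u_def)
  have u_le_t: "u i y \<le> t y" if "i < N" for i y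
    unfolding t_def using that u_nonneg by (intro member_le_sum) auto
  have t_pos: "0 < t y" for y
  proof -
    have "y \<in> (\<Union>x\<in>D. ball x (r x))" using D(2) by blast
    then obtain i where i: "i < N" "dist y (p i) < r (p i)"
      using p by (auto simp: dist_commute)
    then have "0 < u i y" by (simp add: u_def)
    with u_le_t[OF i(1), of y] show ?thesis by linarith
  qed
  have t_lip: "\<bar>t y - t z\<bar> \<le> real N * dist y z" for y z
  proof -
    have "\<bar>t y - t z\<bar> \<le> (\<Sum>i<N. \<bar>u i y - u i z\<bar>)"
      by (simp add: t_def sum_abs flip: sum_subtractf)
    also have "\<dots> \<le> (\<Sum>i<N. dist y z)" by (intro sum_mono u_lip)
    finally show ?thesis by simp
  qed
  have "continuous_on UNIV t"
    unfolding t_def u_def by (intro continuous_intros)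
  then obtain y0 where y0: "\<And>y. t y0 \<le> t y"
    using continuous_attains_inf[OF cpt] by blast
  define \<delta> where "\<delta> = t y0"
  have \<delta>: "0 < \<delta>" "\<And>y. \<delta> \<le> t y" using y0 t_pos by (simp_all add: \<delta>_def)
  define w where "w i y = u i y / t y" for i y
  have w_bound: "\<bar>w i y\<bar> \<le> 1" if "i < N" for i y
    using u_le_t[OF that, of y] u_nonneg[of i y] t_pos[of y] by (simp add: w_def)
  have w_lip: "\<bar>w i y - w i z\<bar> \<le> (1 + real N) / \<delta> * dist y z" if "i < N" for i y z
  proof -
    have "w i y - w i z = (u i y - u i z) / t y + w i z * ((t z - t y) / t y)"
      using t_pos[of y] t_pos[of z] by (simp add: w_def field_simps)
    also have "\<bar>\<dots>\<bar> \<le> \<bar>u i y - u i z\<bar> / t y + \<bar>w i z\<bar> * (\<bar>t z - t y\<bar> / t y)"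
      using abs_triangle_ineq[of "(u i y - u i z) / t y" "w i z * ((t z - t y) / t y)"] t_pos[of y]
      by (simp add: abs_mult)
    also have "\<dots> \<le> dist y z / \<delta> + 1 * (real N * dist y z / \<delta>)"
      using \<delta> t_pos[of y] u_lip[of i y z] t_lip[of z y] w_bound[OF that, of z]
      by (intro add_mono mult_mono frac_le) (auto simp: dist_commute)
    also have "\<dots> = (1 + real N) / \<delta> * dist y z"
      by (simp add: add_divide_distrib distrib_right)
    finally show ?thesis .
  qed
  have w_supp: "y \<in> cball (p i) (r (p i))" if "w i y \<noteq> 0" for i y
    using that by (auto simp: w_def u_def dist_commute max_def split: if_splits)
  have w_sum: "(\<Sum>i<N. w i y) = 1" for y
    using t_pos[of y] by (simp add: w_def t_def flip: sum_divide_distrib)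
  have "\<exists>(E :: (real ^ 'n) lip0 \<Rightarrow>\<^sub>L 'a lip0) (G :: 'a lip0 \<Rightarrow>\<^sub>L (real ^ 'n) lip0).
    (\<forall>x. molecular (\<lambda>h. apply_lip0 (blinfun_apply E h) x)) \<and>
    (\<forall>x. molecular (\<lambda>f. apply_lip0 (blinfun_apply G f) x)) \<and>
    (\<forall>f y. apply_lip0 (blinfun_apply E (blinfun_apply G f)) y =
       w i y * apply_lip0 f y - w i basepoint * apply_lip0 f basepoint)" if i: "i < N" for i
  proof (rule chart_operators[OF _ \<psi> w_lip[OF i] w_bound[OF i] w_supp])
    show "compact (cball (p i) (r (p i)))"
      using compact_Int_closed[OF cpt, of "cball (p i) (r (p i))"] by simp
    show "0 \<le> (1 + real N) / \<delta>" using \<delta>(1) by simp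
  qed
  then obtain E :: "nat \<Rightarrow> (real ^ 'n) lip0 \<Rightarrow>\<^sub>L 'a lip0" and G where
    mol: "\<And>i x. i < N \<Longrightarrow> molecular (\<lambda>h. apply_lip0 (blinfun_apply (E i) h) x)"
      "\<And>i x. i < N \<Longrightarrow> molecular (\<lambda>f. apply_lip0 (blinfun_apply (G i) f) x)"
    and EG: "\<And>i f y. i < N \<Longrightarrow> apply_lip0 (blinfun_apply (E i) (blinfun_apply (G i) f)) y =
       w i y * apply_lip0 f y - w i basepoint * apply_lip0 f basepoint"
    by metis
  have sum_EG: "(\<Sum>i<N. E i (G i f)) = f" for f
    by (rule lip0_eqI) (simp add: apply_lip0_sum EG w_sum flip: sum_distrib_right)
  obtain J P :: "nat \<Rightarrow> (real ^ 'n) lipfree \<Rightarrow> (real ^ 'n) lipfree" and C1 C2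
    where "ell1_copies J P C1 C2"
    by (rule lipfree_ell1_copies)
  then show ?thesis
  proof (rule ell1_copies.glue_retracts[of _ _ _ _ N "\<lambda>i. preadjoint (E i)" "\<lambda>i. preadjoint (G i)"])
    show "bounded_linear (preadjoint (E i))" "bounded_linear (preadjoint (G i))" if "i < N" for i
      using mol[OF that] by (auto intro: bounded_linear_preadjoint)
    show "(\<Sum>i<N. preadjoint (G i) (preadjoint (E i) \<mu>)) = \<mu>" for \<mu>
    proof (rule Rep_lipfree_inject[THEN iffD1], rule blinfun_eqI)
      fix f
      have "blinfun_apply (Rep_lipfree (\<Sum>i<N. preadjoint (G i) (preadjoint (E i) \<mu>))) f
          = (\<Sum>i<N. Rep_lipfree \<mu> (E i (G i f)))"
        by (simp add: Rep_lipfree_sum blinfun.sum_left Rep_preadjoint_preadjoint[OF mol])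
      also have "\<dots> = Rep_lipfree \<mu> f"
        by (simp add: sum_EG flip: blinfun.sum_right)
      finally show "blinfun_apply (Rep_lipfree (\<Sum>i<N. preadjoint (G i) (preadjoint (E i) \<mu>))) f
          = Rep_lipfree \<mu> f" .
    qed
  qed
qed

theorem lipfree_complemented_in_Euclidean:
  assumes "compact (UNIV :: 'a::pointed_metric_space set)"
    and "\<And>x::'a. \<exists>U. x \<in> interior U \<and> bilipschitz_embeddable U (UNIV :: (real ^ 'n) set)"
  shows "\<exists>(Y :: (real ^ 'n) lipfree set) (T :: 'a lipfree \<Rightarrow> (real ^ 'n) lipfree).
    complemented_subspace Y \<and> linear_isomorphism_onto T Y"
  using lipfree_retract_of_locally_embeddable[OF assms] retract_complemented by metis

theorem lipfree_isomorphic_Euclidean: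
  assumes "compact (UNIV :: 'a::pointed_metric_space set)"
    and "\<And>x::'a. \<exists>U. x \<in> interior U \<and> bilipschitz_embeddable U (UNIV :: (real ^ 'n) set)"
    and "bilipschitz_embeddable (cball (0 :: real ^ 'n) 1) (UNIV :: 'a set)"
  shows "\<exists>T :: 'a lipfree \<Rightarrow> (real ^ 'n) lipfree. linear_isomorphism_onto T UNIV"
proof -
  obtain T :: "'a lipfree \<Rightarrow> (real ^ 'n) lipfree" and S where
    TS: "bounded_linear T" "bounded_linear S" "\<And>\<mu>. S (T \<mu>) = \<mu>"
    using lipfree_retract_of_locally_embeddable[OF assms(1,2)] by metis
  obtain \<phi> :: "real ^ 'n \<Rightarrow> 'a" where "bilipschitz_on (cball 0 1) \<phi>"
    using assms(3) unfolding bilipschitz_embeddable_def by blast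
  then obtain U :: "(real ^ 'n) lipfree \<Rightarrow> 'a lipfree" and V where
    UV: "bounded_linear U" "bounded_linear V" "\<And>\<mu>. V (U \<mu>) = \<mu>"
    using lipfree_retract_of_ball_copy[of \<phi>] by blast
  obtain J P :: "nat \<Rightarrow> (real ^ 'n) lipfree \<Rightarrow> (real ^ 'n) lipfree" and C1 C2
    where "ell1_copies J P C1 C2"
    by (rule lipfree_ell1_copies)
  then show ?thesis
    using TS UV by (rule ell1_copies.pelczynski_decomposition)
qed

section \<open>The geodesic distance\<close>

text \<open>The topology \<open>X\<close> and the metric of the type are separate data, linked only
  through \<open>dist_eq\<close>; a relation between their open sets has to be derived.\<close>

locale geodesic_space =
  fixes X :: "'m::metric_space topology" and A :: "('m, 'n::finite) chart set"
    and g :: "('m, 'n) chart \<Rightarrow> 'm \<Rightarrow> real ^ 'n \<Rightarrow> real ^ 'n \<Rightarrow> real"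
  assumes riem: "riemannian_manifold X A g" and top: "topspace X = UNIV"
    and dist_eq: "dist p q = geodesic_dist X A g p q"
begin

section \<open>Charts, transition maps and the metric tensor\<close>

lemma chart_exists: "\<exists>c\<in>A. p \<in> fst c"
proof -
  have "p \<in> (\<Union>c\<in>A. fst c)"
    using riem top unfolding riemannian_manifold_def smooth_manifold_def by auto
  then show ?thesis by blast
qed

lemma Hausdorff: "Hausdorff_space X"
  using riem unfolding riemannian_manifold_def smooth_manifold_def by blast

lemma chart:
  assumes "c \<in> A"
  shows openin_chart: "openin X (fst c)" and open_chart_image: "open (snd c ` fst c)"
    and homeomorphic_chart: "homeomorphic_map (subtopology X (fst c)) (top_of_set (snd c ` fst c)) (snd c)"
  using riem assms unfolding riemannian_manifold_def smooth_manifold_def by auto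

lemma inv_chart:
  assumes "c \<in> A" "p \<in> fst c"
  shows "inv_into (fst c) (snd c) (snd c p) = p"
proof -
  have "inj_on (snd c) (fst c)"
    using homeomorphic_imp_injective_map[OF homeomorphic_chart[OF assms(1)]] top by simp
  then show ?thesis using assms(2) by simp
qed

lemma continuous_chart:
  assumes "c \<in> A"
  shows "continuous_map (subtopology X (fst c)) euclidean (snd c)"
  using homeomorphic_imp_continuous_map[OF homeomorphic_chart[OF assms]]
  by (simp add: continuous_map_in_subtopology)

lemma continuous_inv_chart:
  assumes "c \<in> A"
  shows "continuous_map (top_of_set (snd c ` fst c)) X (inv_into (fst c) (snd c))"
proof -
  obtain \<psi> where \<psi>: "homeomorphic_maps (subtopology X (fst c)) (top_of_set (snd c ` fst c)) (snd c) \<psi>"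
    using homeomorphic_chart[OF assms] homeomorphic_map_maps by blast
  then have "continuous_map (top_of_set (snd c ` fst c)) X \<psi>"
    by (simp add: homeomorphic_maps_def continuous_map_in_subtopology)
  moreover have "\<psi> x = inv_into (fst c) (snd c) x" if "x \<in> topspace (top_of_set (snd c ` fst c))" for x
    using that \<psi> inv_chart[OF assms] top by (auto simp: homeomorphic_maps_def)
  ultimately show ?thesis by (rule continuous_map_eq)
qed

lemma openin_chart_preimage:
  assumes "c \<in> A" "open S"
  shows "openin X {q \<in> fst c. snd c q \<in> S}"
proof -
  have "openin (subtopology X (fst c)) {q \<in> topspace (subtopology X (fst c)). snd c q \<in> S}"
    using assms by (intro openin_continuous_map_preimage[OF continuous_chart]) auto
  then show ?thesis
    using openin_chart[OF assms(1)] top by (simp add: openin_open_subtopology)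
qed

text \<open>A set closed within the chart may fail to be closed in \<open>X\<close>. For compact
  \<open>K\<close> the inverse chart produces a compact set, which is closed because
  \<open>X\<close> is Hausdorff.\<close>

lemma closedin_chart_preimage:
  assumes "c \<in> A" "compact K" "K \<subseteq> snd c ` fst c"
  shows "closedin X {q \<in> fst c. snd c q \<in> K}"
proof -
  have eq: "{q \<in> fst c. snd c q \<in> K} = inv_into (fst c) (snd c) ` K"
  proof (intro equalityI subsetI)
    fix q assume q: "q \<in> {q \<in> fst c. snd c q \<in> K}"
    then have "q = inv_into (fst c) (snd c) (snd c q)"
      using inv_chart[OF assms(1)] by simp
    with q show "q \<in> inv_into (fst c) (snd c) ` K" by blast
  next
    fix q assume "q \<in> inv_into (fst c) (snd c) ` K"
    then obtain x where x: "x \<in> K" "q = inv_into (fst c) (snd c) x" by blast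
    then show "q \<in> {q \<in> fst c. snd c q \<in> K}"
      using assms(3) f_inv_into_f[of x "snd c" "fst c"] inv_into_into[of x "snd c" "fst c"] by auto
  qed
  have "compactin (top_of_set (snd c ` fst c)) K"
    using assms(2,3) by (simp add: compactin_subtopology)
  then have "compactin X (inv_into (fst c) (snd c) ` K)"
    by (rule image_compactin[OF _ continuous_inv_chart[OF assms(1)]])
  then show ?thesis
    unfolding eq by (rule compactin_imp_closedin[OF Hausdorff])
qed

lemma transition_derivative:
  assumes "c \<in> A" "c' \<in> A" "p \<in> fst c" "p \<in> fst c'"
  shows "(transition c c' has_derivative frechet_derivative (transition c c') (at (snd c p))) (at (snd c p))"
proof -
  have "smooth_on (snd c ` (fst c \<inter> fst c')) (transition c c')"
    using riem assms unfolding riemannian_manifold_def smooth_manifold_def by blast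
  then have "Ck_on (Suc 0) (snd c ` (fst c \<inter> fst c')) (transition c c')"
    unfolding smooth_on_def by blast
  then show ?thesis
    using assms by (auto simp: frechet_derivative_works)
qed

lemma transition_derivative_continuous:
  assumes "c \<in> A" "c' \<in> A"
  shows "continuous_on (snd c ` (fst c \<inter> fst c')) (\<lambda>x. frechet_derivative (transition c c') (at x) v)"
proof -
  have "smooth_on (snd c ` (fst c \<inter> fst c')) (transition c c')"
    using riem assms unfolding riemannian_manifold_def smooth_manifold_def by blast
  then have "Ck_on (Suc 0) (snd c ` (fst c \<inter> fst c')) (transition c c')"
    unfolding smooth_on_def by blast
  then show ?thesis by simp
qed

lemma metric:
  assumes "c \<in> A" "p \<in> fst c"
  shows bilinear_metric: "bilinear (g c p)" and metric_pos: "v \<noteq> 0 \<Longrightarrow> 0 < g c p v v"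
  using riem assms unfolding riemannian_manifold_def riemannian_metric_def by blast+

lemma metric_nonneg: "c \<in> A \<Longrightarrow> p \<in> fst c \<Longrightarrow> 0 \<le> g c p v v"
  using metric_pos[of c p v] bilinear_lzero[OF bilinear_metric[of c p], of v]
  by (cases "v = 0") auto

lemma metric_continuous:
  assumes "c \<in> A"
  shows "continuous_on (snd c ` fst c) (\<lambda>x. g c (inv_into (fst c) (snd c) x) v w)"
proof -
  have "smooth_on (snd c ` fst c) (\<lambda>x. g c (inv_into (fst c) (snd c) x) v w)"
    using riem assms unfolding riemannian_manifold_def riemannian_metric_def by blast
  then have "Ck_on 0 (snd c ` fst c) (\<lambda>x. g c (inv_into (fst c) (snd c) x) v w)"
    unfolding smooth_on_def by blast
  then show ?thesis by simp
qed

lemma metric_transform: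
  assumes "c \<in> A" "c' \<in> A" "p \<in> fst c" "p \<in> fst c'"
  shows "g c p v v = g c' p (frechet_derivative (transition c c') (at (snd c p)) v)
    (frechet_derivative (transition c c') (at (snd c p)) v)"
proof -
  have "p \<in> fst c \<inter> fst c'" using assms by blast
  then show ?thesis
    using riem assms(1,2) unfolding riemannian_manifold_def riemannian_metric_def by blast
qed

text \<open>Over the compact set \<open>K \<times> sphere 0 1\<close> the quadratic form is
  continuous and positive, and homogeneity extends its extremal values to all vectors. Smoothness is
  given for fixed \<open>v\<close> and \<open>w\<close> only, so joint continuity comes from
  expanding in the basis.\<close>

lemma metric_bounds:
  assumes "c \<in> A" "compact K" "K \<noteq> {}" "K \<subseteq> snd c ` fst c"
  shows "\<exists>m M. 0 < m \<and> 0 < M \<and> (\<forall>q v. q \<in> fst c \<longrightarrow> snd c q \<in> K \<longrightarrow>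
      m * norm v \<le> sqrt (g c q v v) \<and> sqrt (g c q v v) \<le> M * norm v)"
proof -
  define h where "h x v w = g c (inv_into (fst c) (snd c) x) v w" for x v w
  have bil: "bilinear (h x)" if "x \<in> K" for x
    unfolding h_def using assms(1,4) that by (intro bilinear_metric inv_into_into) auto
  have pos: "0 < h x v v" if "x \<in> K" "v \<noteq> 0" for x v
    unfolding h_def using assms(1,4) that by (intro metric_pos inv_into_into) auto
  define S where "S = K \<times> sphere (0 :: real ^ 'n) 1"
  define H where "H z = (\<Sum>(i, j)\<in>Basis \<times> Basis. (snd z \<bullet> i) * (snd z \<bullet> j) * h (fst z) i j)"
    for z :: "(real ^ 'n) \<times> (real ^ 'n)"
  have H_eq: "H (x, v) = h x v v" if "x \<in> K" for x v
  proof -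
    have "h x v v = h x (\<Sum>i\<in>Basis. (v \<bullet> i) *\<^sub>R i) (\<Sum>j\<in>Basis. (v \<bullet> j) *\<^sub>R j)"
      by (simp only: euclidean_representation)
    also have "\<dots> = H (x, v)"
      unfolding bilinear_sum[OF bil[OF that]] H_def
      by (intro sum.cong) (auto simp: bilinear_lmul[OF bil[OF that]] bilinear_rmul[OF bil[OF that]])
    finally show ?thesis by simp
  qed
  have "continuous_on S (\<lambda>z. h (fst z) i j)" for i j
  proof (rule continuous_on_compose2[of "snd c ` fst c" "\<lambda>x. h x i j"])
    show "continuous_on (snd c ` fst c) (\<lambda>x. h x i j)"
      unfolding h_def by (rule metric_continuous[OF assms(1)])
    show "continuous_on S fst" by (intro continuous_intros)
    show "fst ` S \<subseteq> snd c ` fst c" using assms(4) by (auto simp: S_def)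
  qed
  then have cont: "continuous_on S H"
    unfolding H_def split_def by (intro continuous_intros)
  have S: "compact S" "S \<noteq> {}"
    using assms(2,3) norm_axis_1 by (auto simp: S_def intro!: compact_Times) 
  obtain z0 where z0: "z0 \<in> S" "\<And>z. z \<in> S \<Longrightarrow> H z0 \<le> H z"
    using continuous_attains_inf[OF S cont] by blast
  obtain z1 where z1: "z1 \<in> S" "\<And>z. z \<in> S \<Longrightarrow> H z \<le> H z1"
    using continuous_attains_sup[OF S cont] by blast
  have "0 < H z0"
  proof -
    obtain x v where xv: "z0 = (x, v)" by force
    with z0(1) have "x \<in> K" "v \<noteq> 0" by (auto simp: S_def)
    then show ?thesis using pos H_eq xv by simp
  qed
  moreover from this have "0 < H z1" using z1(2)[OF z0(1)] by linarith
  moreover have "sqrt (H z0) * norm v \<le> sqrt (g c q v v) \<and> sqrt (g c q v v) \<le> sqrt (H z1) * norm v"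
    if q: "q \<in> fst c" "snd c q \<in> K" for q v
  proof (cases "v = 0")
    case True
    then show ?thesis by (simp add: bilinear_lzero[OF bilinear_metric[OF assms(1) q(1)]])
  next
    case False
    define e where "e = v /\<^sub>R norm v"
    have v: "v = norm v *\<^sub>R e" using False by (simp add: e_def)
    have "(snd c q, e) \<in> S" using q False by (simp add: S_def e_def)
    then have "H z0 \<le> h (snd c q) e e" "h (snd c q) e e \<le> H z1"
      using z0(2) z1(2) H_eq[OF q(2)] by metis+
    moreover have "h (snd c q) e e = g c q e e"
      by (simp add: h_def inv_chart[OF assms(1) q(1)])
    moreover have "g c q v v = (norm v)\<^sup>2 * g c q e e"
      by (subst (1 2) v) (simp add: bilinear_lmul[OF bilinear_metric[OF assms(1) q(1)]]
          bilinear_rmul[OF bilinear_metric[OF assms(1) q(1)]] power2_eq_square)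
    ultimately show ?thesis
      by (simp add: real_sqrt_mult mult.commute[of "norm v"] mult_right_mono)
  qed
  ultimately show ?thesis by (intro exI[of _ "sqrt (H z0)"] exI[of _ "sqrt (H z1)"]) auto
qed

text \<open>\<open>curve_speed\<close> uses a chart picked by \<open>SOME\<close>. The chain rule
  for the transition map and the transformation law of \<open>g\<close> give the same value in any
  chart around \<open>\<gamma> t\<close>.\<close>

lemma speed_eq:
  assumes c: "c \<in> A" and ev: "\<forall>\<^sub>F s in nhds t. \<gamma> s \<in> fst c"
    and D: "((\<lambda>s. snd c (\<gamma> s)) has_vector_derivative D) (at t)"
  shows "curve_speed A g \<gamma> t = sqrt (g c (\<gamma> t) D D)"
proof -
  have t: "\<gamma> t \<in> fst c" using ev by (rule eventually_nhds_x_imp_x)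
  define c' where "c' = (SOME c. c \<in> A \<and> \<gamma> t \<in> fst c)"
  have c': "c' \<in> A" "\<gamma> t \<in> fst c'"
    using someI[of "\<lambda>c. c \<in> A \<and> \<gamma> t \<in> fst c" c] c t unfolding c'_def by auto
  let ?F = "frechet_derivative (transition c c') (at (snd c (\<gamma> t)))"
  have F: "(transition c c' has_derivative ?F) (at (snd c (\<gamma> t)))"
    by (rule transition_derivative[OF c c'(1) t c'(2)])
  have tr: "transition c c' (snd c (\<gamma> s)) = snd c' (\<gamma> s)" if "\<gamma> s \<in> fst c" for s
    by (simp add: transition_def inv_chart[OF c that])
  have "((\<lambda>s. transition c c' (snd c (\<gamma> s))) has_derivative (\<lambda>x. ?F (x *\<^sub>R D))) (at t)"
    by (rule has_derivative_compose[OF D[unfolded has_vector_derivative_def] F])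
  moreover have "\<forall>\<^sub>F s in at t. transition c c' (snd c (\<gamma> s)) = snd c' (\<gamma> s)"
    using ev tr by (auto simp: eventually_at_filter elim: eventually_mono)
  ultimately have "((\<lambda>s. snd c' (\<gamma> s)) has_derivative (\<lambda>x. ?F (x *\<^sub>R D))) (at t)"
    using tr[OF t] by (rule has_derivative_transform_eventually) auto
  moreover have "?F (x *\<^sub>R D) = x *\<^sub>R ?F D" for x
    by (rule linear_scale[OF has_derivative_linear[OF F]])
  ultimately have "((\<lambda>s. snd c' (\<gamma> s)) has_vector_derivative ?F D) (at t)"
    by (simp add: has_vector_derivative_def)
  then have "vector_derivative (\<lambda>s. snd c' (\<gamma> s)) (at t) = ?F D"
    by (rule vector_derivative_at)
  then show ?thesis
    unfolding curve_speed_def c'_def[symmetric] Let_def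
    by (simp add: metric_transform[OF c c'(1) t c'(2)])
qed

lemma speed_nonneg: "0 \<le> curve_speed A g \<gamma> t"
proof -
  define c' where "c' = (SOME c. c \<in> A \<and> \<gamma> t \<in> fst c)"
  have "c' \<in> A \<and> \<gamma> t \<in> fst c'"
    unfolding c'_def using chart_exists[of "\<gamma> t"] by (metis (mono_tags, lifting) someI_ex)
  then show ?thesis
    unfolding curve_speed_def c'_def[symmetric] Let_def by (simp add: metric_nonneg)
qed

text \<open>A speed that is not integrable has integral 0 by convention, so the bound covers that
  case as well.\<close>

lemma length_nonneg: "0 \<le> curve_length A g \<gamma>"
  unfolding curve_length_def
  by (cases "curve_speed A g \<gamma> integrable_on {0..1}")
    (auto intro: integral_nonneg simp: speed_nonneg not_integrable_integral)

section \<open>Lower bounds for the length of a curve\<close>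

lemma curve_breakpoints:
  assumes "piecewise_C1_curve X A \<gamma>"
  obtains k and s :: "nat \<Rightarrow> real" where "s 0 = 0" "s k = 1"
    "\<And>i. i < k \<Longrightarrow> s i < s (Suc i)" "\<And>i. i < k \<Longrightarrow> C1_curve_on X A (s i) (s (Suc i)) \<gamma>"
  using assms unfolding piecewise_C1_curve_def by metis

text \<open>Continuity of \<open>\<gamma>\<close> is given on the closed pieces; preimages of closed
  sets are glued by induction over the breakpoints.\<close>

lemma curve_closed_preimage:
  assumes "piecewise_C1_curve X A \<gamma>" "closedin X C"
  shows "closed {t\<in>{0..1}. \<gamma> t \<in> C}"
proof -
  obtain k and s :: "nat \<Rightarrow> real" where s: "s 0 = 0" "s k = 1"
    "\<And>i. i < k \<Longrightarrow> s i < s (Suc i)" "\<And>i. i < k \<Longrightarrow> C1_curve_on X A (s i) (s (Suc i)) \<gamma>"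
    using curve_breakpoints[OF assms(1)] by metis
  have "0 \<le> s j \<and> closed {t\<in>{0..s j}. \<gamma> t \<in> C}" if "j \<le> k" for j
    using that
  proof (induction j)
    case 0
    have "finite {t\<in>{0..s 0}. \<gamma> t \<in> C}"
      by (rule finite_subset[of _ "{0}"]) (auto simp: s(1))
    then show ?case using s(1) by (simp add: finite_imp_closed)
  next
    case (Suc j)
    then have IH: "0 \<le> s j" "closed {t\<in>{0..s j}. \<gamma> t \<in> C}" and j: "j < k" by auto
    have "continuous_map (top_of_set {s j..s (Suc j)}) X \<gamma>"
      using s(4)[OF j] unfolding C1_curve_on_def by blast
    from closedin_continuous_map_preimage[OF this assms(2)]
    have "closedin (top_of_set {s j..s (Suc j)}) {t\<in>{s j..s (Suc j)}. \<gamma> t \<in> C}" by simp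
    then have "closed {t\<in>{s j..s (Suc j)}. \<gamma> t \<in> C}"
      using closed_real_atLeastAtMost closedin_closed_trans by blast
    moreover have "{t\<in>{0..s (Suc j)}. \<gamma> t \<in> C} =
        {t\<in>{0..s j}. \<gamma> t \<in> C} \<union> {t\<in>{s j..s (Suc j)}. \<gamma> t \<in> C}"
      using IH(1) s(3)[OF j] by auto
    ultimately show ?case using IH s(3)[OF j] by auto
  qed
  from this[of k] show ?thesis using s(2) by simp
qed

lemma curve_differentiable:
  assumes "piecewise_C1_curve X A \<gamma>"
  obtains B where "finite B" "0 \<in> B" "1 \<in> B"
    "\<And>t c. t \<in> {0..1} - B \<Longrightarrow> c \<in> A \<Longrightarrow> \<gamma> t \<in> fst c \<Longrightarrow>
      \<exists>D. ((\<lambda>s. snd c (\<gamma> s)) has_vector_derivative D) (at t)"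
proof -
  obtain k and s :: "nat \<Rightarrow> real" where s: "s 0 = 0" "s k = 1"
    "\<And>i. i < k \<Longrightarrow> s i < s (Suc i)" "\<And>i. i < k \<Longrightarrow> C1_curve_on X A (s i) (s (Suc i)) \<gamma>"
    using curve_breakpoints[OF assms] by metis
  show thesis
  proof (rule that[of "s ` {..k}"])
    show "0 \<in> s ` {..k}" "1 \<in> s ` {..k}"
      using s(1,2) by (metis atMost_iff image_eqI le0 order_refl)+
    fix t c assume t: "t \<in> {0..1} - s ` {..k}" and c: "c \<in> A" "\<gamma> t \<in> fst c"
    have ne: "t \<noteq> s i" if "i \<le> k" for i using t that by auto
    have "\<exists>i<j. s i < t \<and> t < s (Suc i)" if "j \<le> k" "t < s j" for j
      using that
    proof (induction j)
      case 0
      then show ?case using s(1) t by auto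
    next
      case (Suc j)
      then show ?case
        using ne[of j] by (cases "t < s j") (auto intro: less_SucI)
    qed
    from this[of k] obtain i where i: "i < k" "s i < t" "t < s (Suc i)"
      using s(2) t ne[of k] by auto
    obtain U \<phi> where U: "c = (U, \<phi>)" by force
    obtain D where "\<forall>t\<in>{s i..s (Suc i)}. \<gamma> t \<in> U \<longrightarrow>
        ((\<lambda>s. \<phi> (\<gamma> s)) has_vector_derivative D t) (at t within {s i..s (Suc i)})"
      using s(4)[OF i(1)] c(1) unfolding C1_curve_on_def U by blast
    then have "((\<lambda>s. snd c (\<gamma> s)) has_vector_derivative D t) (at t within {s i..s (Suc i)})"
      using i c(2) U by auto
    then show "\<exists>D. ((\<lambda>s. snd c (\<gamma> s)) has_vector_derivative D) (at t)"
      using i(2,3) at_within_Icc_at by metis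
  qed simp
qed

text \<open>Projecting the coordinate curve onto the direction \<open>e\<close> of its displacement
  reduces the claim to the scalar fundamental theorem of calculus: \<open>m\<close> times the
  derivative of the projection is at most the speed.\<close>

lemma length_lower:
  assumes c: "c \<in> A" and \<gamma>: "piecewise_C1_curve X A \<gamma>" and \<tau>: "\<tau> \<in> {0..1}" and "0 < m"
    and U: "\<And>s. s \<in> {0..\<tau>} \<Longrightarrow> \<gamma> s \<in> fst c"
    and m: "\<And>s v. s \<in> {0..\<tau>} \<Longrightarrow> m * norm v \<le> sqrt (g c (\<gamma> s) v v)"
    and int: "curve_speed A g \<gamma> integrable_on {0..1}"
  shows "m * norm (snd c (\<gamma> \<tau>) - snd c (\<gamma> 0)) \<le> curve_length A g \<gamma>"
proof -
  let ?F = "\<lambda>s. snd c (\<gamma> s)" and ?v = "curve_speed A g \<gamma>"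
  obtain B where B: "finite B" "0 \<in> B" "1 \<in> B" "\<And>t c. t \<in> {0..1} - B \<Longrightarrow> c \<in> A \<Longrightarrow> \<gamma> t \<in> fst c \<Longrightarrow>
      \<exists>D. ((\<lambda>s. snd c (\<gamma> s)) has_vector_derivative D) (at t)"
    using curve_differentiable[OF \<gamma>] by metis
  define e where "e = sgn (?F \<tau> - ?F 0)"
  have e: "norm e \<le> 1" by (simp add: e_def norm_sgn)
  have deriv: "(?F has_vector_derivative vector_derivative ?F (at t)) (at t)"
      "m * norm (vector_derivative ?F (at t)) \<le> ?v t" if t: "t \<in> {0<..<\<tau>} - B" for t
  proof -
    have "t \<in> {0..1} - B" "\<gamma> t \<in> fst c" using t \<tau> U by auto
    then obtain D where D: "(?F has_vector_derivative D) (at t)"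
      using B(4) c by blast
    have "\<forall>\<^sub>F s in nhds t. s \<in> {0<..<\<tau>}"
      using t by (intro eventually_nhds_in_open) auto
    then have "\<forall>\<^sub>F s in nhds t. \<gamma> s \<in> fst c"
      by (rule eventually_mono) (use U in auto)
    then have "?v t = sqrt (g c (\<gamma> t) D D)"
      by (rule speed_eq[OF c _ D])
    moreover have "vector_derivative ?F (at t) = D"
      by (rule vector_derivative_at[OF D])
    ultimately show "(?F has_vector_derivative vector_derivative ?F (at t)) (at t)"
      "m * norm (vector_derivative ?F (at t)) \<le> ?v t"
      using D m[of t D] t by auto
  qed
  \<comment> \<open>Continuity through closed sets: inside the chart the preimage of
    \<open>E\<close> is the trace of a set \<open>C\<close> closed in \<open>X\<close>, to which
    \<open>curve_closed_preimage\<close> applies.\<close>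
  have "continuous_on {0..\<tau>} ?F"
    unfolding continuous_on_closed_vimage[OF closed_real_atLeastAtMost]
  proof (intro allI impI)
    fix E :: "(real ^ 'n) set" assume "closed E"
    then have "closedin (subtopology X (fst c)) {q \<in> topspace (subtopology X (fst c)). snd c q \<in> E}"
      by (intro closedin_continuous_map_preimage[OF continuous_chart[OF c]]) auto
    then obtain C where C: "closedin X C" "{q \<in> fst c. snd c q \<in> E} = C \<inter> fst c"
      using top by (auto simp: closedin_subtopology)
    have "?F -` E \<inter> {0..\<tau>} = {t\<in>{0..1}. \<gamma> t \<in> C} \<inter> {0..\<tau>}"
      using C(2) U \<tau> by auto
    then show "closed (?F -` E \<inter> {0..\<tau>})"
      using curve_closed_preimage[OF \<gamma> C(1)] by (simp add: closed_Int)
  qed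
  then have cont: "continuous_on {0..\<tau>} (\<lambda>t. e \<bullet> ?F t)"
    by (intro continuous_intros)
  \<comment> \<open>The value 0 at exceptional times keeps \<open>m * f' t\<close> below the speed
    everywhere.\<close>
  define f' where "f' t = (if t \<in> {0<..<\<tau>} - B then e \<bullet> vector_derivative ?F (at t) else 0)" for t
  have "(f' has_integral (e \<bullet> ?F \<tau> - e \<bullet> ?F 0)) {0..\<tau>}"
  proof (rule fundamental_theorem_of_calculus_interior_strong[OF B(1) _ _ cont])
    show "((\<lambda>t. e \<bullet> ?F t) has_vector_derivative f' t) (at t)" if "t \<in> {0<..<\<tau>} - B" for t
      using bounded_linear.has_vector_derivative[OF bounded_linear_inner_right deriv(1)[OF that], of e] that
      by (simp add: f'_def)
  qed (use \<tau> in auto)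
  then have "((\<lambda>t. m * f' t) has_integral m * (e \<bullet> ?F \<tau> - e \<bullet> ?F 0)) {0..\<tau>}"
    by (rule has_integral_mult_right)
  moreover have "(?v has_integral (integral {0..\<tau>} ?v)) {0..\<tau>}"
    using integrable_on_subinterval[OF int, of 0 \<tau>] \<tau> by auto
  moreover have "m * f' t \<le> ?v t" for t
  proof (cases "t \<in> {0<..<\<tau>} - B")
    case True
    have "e \<bullet> vector_derivative ?F (at t) \<le> norm e * norm (vector_derivative ?F (at t))"
      by (rule norm_cauchy_schwarz)
    also have "\<dots> \<le> 1 * norm (vector_derivative ?F (at t))"
      by (intro mult_right_mono e) auto
    finally have "m * f' t \<le> m * norm (vector_derivative ?F (at t))"
      using True \<open>0 < m\<close> by (simp add: f'_def)
    with deriv(2)[OF True] show ?thesis by linarith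
  next
    case False
    then have "f' t = 0" unfolding f'_def by (rule if_not_P)
    then show ?thesis by (simp add: speed_nonneg)
  qed
  ultimately have "m * (e \<bullet> ?F \<tau> - e \<bullet> ?F 0) \<le> integral {0..\<tau>} ?v"
    by (rule has_integral_le)
  also have "\<dots> \<le> integral {0..1} ?v"
    using \<tau> by (intro integral_subset_le integrable_on_subinterval[OF int] int) (auto simp: speed_nonneg)
  also have "e \<bullet> ?F \<tau> - e \<bullet> ?F 0 = norm (?F \<tau> - ?F 0)"
  proof -
    have "e \<bullet> ?F \<tau> - e \<bullet> ?F 0 = e \<bullet> (?F \<tau> - ?F 0)"
      by (rule inner_diff_right[symmetric])
    also have "\<dots> = norm (?F \<tau> - ?F 0)"
      by (simp only: e_def sgn_div_norm inner_scaleR_left dot_square_norm)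
        (auto simp: power2_eq_square field_simps)
    finally show ?thesis .
  qed
  finally show ?thesis by (simp add: curve_length_def)
qed

text \<open>Take the first time \<open>\<tau>\<close> outside \<open>V\<close>. Up to and including
  \<open>\<tau>\<close> the curve is in the closed set \<open>C\<close>, hence still in the chart,
  and \<open>length_lower\<close> makes its displacement less than r / 3. Together with the starting
  distance this is less than 2 * r / 3, so the curve is in \<open>V\<close> at time
  \<open>\<tau>\<close>, a contradiction.\<close>

lemma short_curve_stays:
  assumes c: "c \<in> A" and r: "cball x0 r \<subseteq> snd c ` fst c" "0 < r" and "0 < m"
    and m: "\<And>q v. q \<in> fst c \<Longrightarrow> snd c q \<in> cball x0 r \<Longrightarrow> m * norm v \<le> sqrt (g c q v v)"
    and \<gamma>: "piecewise_C1_curve X A \<gamma>" and int: "curve_speed A g \<gamma> integrable_on {0..1}"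
    and start: "\<gamma> 0 \<in> fst c" "snd c (\<gamma> 0) \<in> ball x0 (r / 3)"
    and short: "curve_length A g \<gamma> < m * (r / 3)" and t: "t \<in> {0..1}"
  shows "\<gamma> t \<in> fst c \<and> snd c (\<gamma> t) \<in> ball x0 (2 * r / 3)"
proof (rule ccontr)
  assume neg: "\<not> ?thesis"
  define V where "V = {q \<in> fst c. snd c q \<in> ball x0 (2 * r / 3)}"
  define C where "C = {q \<in> fst c. snd c q \<in> cball x0 (2 * r / 3)}"
  define W where "W = {t\<in>{0..1}. \<gamma> t \<in> - V}"
  have "openin X V"
    unfolding V_def by (rule openin_chart_preimage[OF c]) simp
  then have "closedin X (- V)"
    using top by (simp add: closedin_def Compl_eq_Diff_UNIV[symmetric])
  then have "closed W"
    unfolding W_def by (rule curve_closed_preimage[OF \<gamma>])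
  moreover have "W = {0..1} \<inter> W" by (auto simp: W_def)
  ultimately have "compact W" by (metis compact_Icc compact_Int_closed)
  have "t \<in> W" using neg t by (auto simp: W_def V_def)
  then obtain \<tau> where \<tau>: "\<tau> \<in> W" "\<And>s. s \<in> W \<Longrightarrow> \<tau> \<le> s"
    using compact_attains_inf[OF \<open>compact W\<close>] by blast
  have \<tau>01: "\<tau> \<in> {0..1}" "\<gamma> \<tau> \<notin> V" using \<tau>(1) by (auto simp: W_def)
  have "\<gamma> 0 \<in> V" using start r(2) by (auto simp: V_def)
  then have "\<tau> \<noteq> 0" using \<tau>01(2) by metis
  then have "0 < \<tau>" using \<tau>01(1) by simp
  have before: "\<gamma> s \<in> C" if "s \<in> {0..<\<tau>}" for s
  proof -
    have "s \<notin> W" using \<tau>(2)[of s] that by auto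
    then have "\<gamma> s \<in> V" using that \<tau>01(1) by (auto simp: W_def)
    then show ?thesis by (auto simp: V_def C_def)
  qed
  have "closed {t\<in>{0..1}. \<gamma> t \<in> C}"
  proof (rule curve_closed_preimage[OF \<gamma>])
    have "cball x0 (2 * r / 3) \<subseteq> cball x0 r" using r(2) by (intro subset_cball) auto
    then show "closedin X C"
      unfolding C_def using r(1) by (intro closedin_chart_preimage[OF c]) auto
  qed
  then have "closure {0..<\<tau>} \<subseteq> {t\<in>{0..1}. \<gamma> t \<in> C}"
    using before \<tau>01(1) by (intro closure_minimal) auto
  then have C: "\<gamma> s \<in> C" if "s \<in> {0..\<tau>}" for s
    using that \<open>0 < \<tau>\<close> by (auto simp: closure_atLeastLessThan)
  have "m * norm (snd c (\<gamma> \<tau>) - snd c (\<gamma> 0)) \<le> curve_length A g \<gamma>"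
  proof (rule length_lower[OF c \<gamma> \<tau>01(1) \<open>0 < m\<close> _ _ int])
    show "\<gamma> s \<in> fst c" if "s \<in> {0..\<tau>}" for s
      using C[OF that] by (simp add: C_def)
    show "m * norm v \<le> sqrt (g c (\<gamma> s) v v)" if "s \<in> {0..\<tau>}" for s v
      using C[OF that] r(2) by (intro m) (auto simp: C_def)
  qed
  then have "m * norm (snd c (\<gamma> \<tau>) - snd c (\<gamma> 0)) < m * (r / 3)"
    using short by linarith
  then have "dist (snd c (\<gamma> 0)) (snd c (\<gamma> \<tau>)) < r / 3"
    using \<open>0 < m\<close> by (simp add: dist_norm norm_minus_commute)
  then have "dist x0 (snd c (\<gamma> \<tau>)) < 2 * r / 3"
    using start(2) dist_triangle[of x0 "snd c (\<gamma> \<tau>)" "snd c (\<gamma> 0)"] by simp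
  then have "\<gamma> \<tau> \<in> V" using C[of \<tau>] \<tau>01(1) by (simp add: V_def C_def)
  with \<tau>01(2) show False by simp
qed

section \<open>Comparison of the geodesic and the coordinate distance\<close>

abbreviation "curves p q \<equiv> {\<gamma>. piecewise_C1_curve X A \<gamma> \<and> \<gamma> 0 = p \<and> \<gamma> 1 = q}"

lemma dist_eq_Inf: "dist p q = Inf (curve_length A g ` curves p q)"
  unfolding dist_eq geodesic_dist_def by (rule arg_cong[of _ _ Inf]) auto

lemma dist_le_length:
  assumes "\<gamma> \<in> curves p q"
  shows "dist p q \<le> curve_length A g \<gamma>"
  unfolding dist_eq_Inf using assms length_nonneg by (intro cInf_lower bdd_belowI2) auto

text \<open>A short curve stays in the chart and is measured there; any other curve has the length
  of the first alternative.\<close>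

lemma length_lower_cases:
  assumes c: "c \<in> A" and r: "cball x0 r \<subseteq> snd c ` fst c" "0 < r" and "0 < m"
    and m: "\<And>q v. q \<in> fst c \<Longrightarrow> snd c q \<in> cball x0 r \<Longrightarrow> m * norm v \<le> sqrt (g c q v v)"
    and p: "p \<in> fst c" "snd c p \<in> ball x0 (r / 3)" and \<gamma>: "\<gamma> \<in> curves p q"
  shows "m * (r / 3) \<le> curve_length A g \<gamma> \<or>
    q \<in> fst c \<and> m * norm (snd c p - snd c q) \<le> curve_length A g \<gamma>"
proof (cases "p = q")
  case True
  then show ?thesis using p length_nonneg by simp
next
  case False
  \<comment> \<open>Source of integrability: a speed without integral would give length 0, whereas
    distinct end points force positive length.\<close>
  then have "0 < curve_length A g \<gamma>"
    using dist_le_length[OF \<gamma>] by (meson less_le_trans zero_less_dist_iff)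
  then have int: "curve_speed A g \<gamma> integrable_on {0..1}"
    unfolding curve_length_def using not_integrable_integral by fastforce
  show ?thesis
  proof (cases "curve_length A g \<gamma> < m * (r / 3)")
    case True
    have stay: "\<gamma> t \<in> fst c \<and> snd c (\<gamma> t) \<in> ball x0 (2 * r / 3)" if "t \<in> {0..1}" for t
      using \<gamma> p by (intro short_curve_stays[OF c r \<open>0 < m\<close> m _ int _ _ True that]) auto
    have "m * norm (snd c (\<gamma> 1) - snd c (\<gamma> 0)) \<le> curve_length A g \<gamma>"
    proof (rule length_lower[OF c _ _ \<open>0 < m\<close> _ _ int])
      show "m * norm v \<le> sqrt (g c (\<gamma> s) v v)" if "s \<in> {0..1}" for s v
        using stay[OF that] r(2) by (intro m) auto
    qed (use stay \<gamma> in auto)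
    then show ?thesis
      using \<gamma> stay[of 1] by (auto simp: norm_minus_commute)
  qed simp
qed

text \<open>The curve is the coordinate segment pulled back to the manifold; at interior times its
  speed is the \<open>g\<close>-norm of the constant vector \<open>v\<close>.\<close>

lemma straight_curve:
  assumes c: "c \<in> A" and r: "cball x0 r \<subseteq> snd c ` fst c"
    and M: "\<And>q v. q \<in> fst c \<Longrightarrow> snd c q \<in> cball x0 r \<Longrightarrow> sqrt (g c q v v) \<le> M * norm v"
    and p: "p \<in> fst c" "snd c p \<in> cball x0 r" and q: "q \<in> fst c" "snd c q \<in> cball x0 r"
  shows "\<exists>\<gamma>\<in>curves p q. curve_length A g \<gamma> \<le> M * norm (snd c p - snd c q)"
proof -
  define v where "v = snd c q - snd c p"
  define \<xi> where "\<xi> t = snd c p + t *\<^sub>R v" for t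
  define \<gamma> where "\<gamma> t = inv_into (fst c) (snd c) (\<xi> t)" for t
  have \<xi>: "\<xi> t \<in> cball x0 r" if "t \<in> {0..1}" for t
  proof -
    have "\<xi> t = (1 - t) *\<^sub>R snd c p + t *\<^sub>R snd c q"
      by (simp add: \<xi>_def v_def algebra_simps)
    then show ?thesis
      using that p(2) q(2) convexD_alt[OF convex_cball, of "snd c p" x0 r "snd c q" t] by simp
  qed
  have \<gamma>U: "\<gamma> t \<in> fst c" "snd c (\<gamma> t) = \<xi> t" if "t \<in> {0..1}" for t
    using \<xi>[OF that] r f_inv_into_f[of "\<xi> t" "snd c" "fst c"] inv_into_into[of "\<xi> t" "snd c" "fst c"]
    by (auto simp: \<gamma>_def)
  have \<xi>_deriv: "(\<xi> has_vector_derivative v) (at t within S)" for t S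
    unfolding \<xi>_def by (auto intro!: derivative_eq_intros)
  have \<xi>_cont: "continuous_on S \<xi>" for S
    unfolding \<xi>_def by (intro continuous_intros)
  have C1: "C1_curve_on X A 0 1 \<gamma>"
    unfolding C1_curve_on_def
  proof (intro conjI ballI)
    have "continuous_map (top_of_set {0..1}) (top_of_set (snd c ` fst c)) \<xi>"
      using \<xi>_cont \<xi> r by (auto simp: continuous_map_in_subtopology)
    from continuous_map_compose[OF this continuous_inv_chart[OF c]]
    show "continuous_map (top_of_set {0..1}) X \<gamma>"
      by (simp add: comp_def \<gamma>_def[abs_def])
    fix c' assume c': "c' \<in> A"
    define D where "D t = frechet_derivative (transition c c') (at (\<xi> t)) v" for t
    have "continuous_on {t\<in>{0..1}. \<gamma> t \<in> fst c'} D"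
      unfolding D_def
    proof (rule continuous_on_compose2[OF transition_derivative_continuous[OF c c'] \<xi>_cont])
      show "\<xi> ` {t \<in> {0..1}. \<gamma> t \<in> fst c'} \<subseteq> snd c ` (fst c \<inter> fst c')"
      proof clarify
        fix t assume t: "t \<in> {0..1}" "\<gamma> t \<in> fst c'"
        then show "\<xi> t \<in> snd c ` (fst c \<inter> fst c')"
          using \<gamma>U[OF t(1)] by (metis IntI image_eqI)
      qed
    qed
    moreover have "((\<lambda>s. snd c' (\<gamma> s)) has_vector_derivative D t) (at t within {0..1})"
      if t: "t \<in> {0..1}" "\<gamma> t \<in> fst c'" for t
    proof -
      let ?F = "frechet_derivative (transition c c') (at (\<xi> t))"
      have F: "(transition c c' has_derivative ?F) (at (\<xi> t))"
        using transition_derivative[OF c c' \<gamma>U(1)[OF t(1)] t(2)] \<gamma>U(2)[OF t(1)] by simp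
      have "((\<lambda>s. transition c c' (\<xi> s)) has_derivative (\<lambda>x. ?F (x *\<^sub>R v))) (at t within {0..1})"
        by (rule has_derivative_compose[OF \<xi>_deriv[unfolded has_vector_derivative_def] F])
      moreover have "?F (x *\<^sub>R v) = x *\<^sub>R ?F v" for x
        by (rule linear_scale[OF has_derivative_linear[OF F]])
      ultimately show ?thesis
        by (simp add: has_vector_derivative_def D_def transition_def \<gamma>_def comp_def)
    qed
    ultimately show "case c' of (U, \<phi>) \<Rightarrow> \<exists>D. continuous_on {t\<in>{0..1}. \<gamma> t \<in> U} D \<and>
        (\<forall>t\<in>{0..1}. \<gamma> t \<in> U \<longrightarrow> ((\<lambda>s. \<phi> (\<gamma> s)) has_vector_derivative D t) (at t within {0..1}))"
      by (cases c') auto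
  qed
  then have pw: "piecewise_C1_curve X A \<gamma>"
    unfolding piecewise_C1_curve_def by (intro exI[of _ 1] exI[of _ real]) auto
  have ends: "\<gamma> 0 = p" "\<gamma> 1 = q"
    using inv_chart[OF c] p(1) q(1) by (simp_all add: \<gamma>_def \<xi>_def v_def)
  have M_nonneg: "0 \<le> M * norm v"
    using M[OF p, of v] metric_nonneg[OF c p(1), of v] real_sqrt_ge_zero by (meson order_trans)
  have length: "curve_length A g \<gamma> \<le> M * norm v"
  proof (cases "curve_speed A g \<gamma> integrable_on {0..1}")
    case True
    have speed: "curve_speed A g \<gamma> t \<le> M * norm v" if t: "t \<in> {0<..<1}" for t
    proof -
      have near: "\<forall>\<^sub>F s in nhds t. s \<in> {0<..<1}"
        using t by (intro eventually_nhds_in_open) auto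
      then have U: "\<forall>\<^sub>F s in nhds t. \<gamma> s \<in> fst c"
        by (rule eventually_mono) (use \<gamma>U(1) in auto)
      have "((\<lambda>s. snd c (\<gamma> s)) has_vector_derivative v) (at t)"
      proof (rule has_vector_derivative_transform_within_open[where S = "{0<..<1}", OF \<xi>_deriv])
        show "\<xi> s = snd c (\<gamma> s)" if "s \<in> {0<..<1}" for s
          using \<gamma>U(2)[of s] that by auto
      qed (use t in auto)
      from speed_eq[OF c U this] show ?thesis
        using M[of "\<gamma> t" v] \<gamma>U[of t] \<xi>[of t] t by auto
    qed
    have "integral {0..1} (curve_speed A g \<gamma>) \<le> integral {0..1} (\<lambda>t::real. M * norm v)"
    proof -
      \<comment> \<open>\<open>speed_eq\<close> asks for a neighbourhood of \<open>t\<close> on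
        which the curve is in the chart, so the end points are overwritten before comparing.\<close>
      define h where "h t = (if t \<in> {0, 1} then 0 else curve_speed A g \<gamma> t)" for t
      have "(h has_integral integral {0..1} (curve_speed A g \<gamma>)) {0..1}"
        using integrable_integral[OF True]
        by (rule has_integral_spike_finite[of "{0, 1}", rotated 2]) (auto simp: h_def)
      moreover have "h t \<le> M * norm v" if "t \<in> {0..1}" for t
        using speed[of t] M_nonneg that by (auto simp: h_def)
      ultimately show ?thesis
        by (intro has_integral_le[OF _ integrable_integral]) auto
    qed
    then show ?thesis by (simp add: curve_length_def)
  next
    case False
    then show ?thesis using M_nonneg by (simp add: curve_length_def not_integrable_integral)
  qed
  show ?thesis
    using pw ends length by (intro bexI[of _ \<gamma>]) (auto simp: v_def norm_minus_commute)
qed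

text \<open>Points in the ball of radius r / 6 are at most r / 3 apart in coordinates, so the length
  \<open>m * (r / 3)\<close> of a curve that leaves the chart also dominates \<open>m\<close> times
  their distance. Nonemptiness of \<open>curves\<close> is tracked because the infimum of the empty
  set is unspecified.\<close>

lemma local_comparison:
  "\<exists>c x0 r m M. c \<in> A \<and> p \<in> fst c \<and> x0 = snd c p \<and> 0 < r \<and> 0 < m \<and> 0 < M \<and>
    cball x0 r \<subseteq> snd c ` fst c \<and>
    (\<forall>q. curves p q \<noteq> {} \<longrightarrow> dist p q < m * (r / 3) \<longrightarrow>
      q \<in> fst c \<and> m * dist x0 (snd c q) \<le> dist p q) \<and>
    (\<forall>q\<in>fst c. \<forall>q'\<in>fst c. snd c q \<in> cball x0 r \<longrightarrow> snd c q' \<in> cball x0 r \<longrightarrow>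
      curves q q' \<noteq> {} \<and> dist q q' \<le> M * dist (snd c q) (snd c q')) \<and>
    (\<forall>q\<in>fst c. \<forall>q'\<in>fst c. snd c q \<in> ball x0 (r / 6) \<longrightarrow> snd c q' \<in> ball x0 (r / 6) \<longrightarrow>
      m * dist (snd c q) (snd c q') \<le> dist q q')"
proof -
  obtain c where c: "c \<in> A" "p \<in> fst c" using chart_exists by blast
  define x0 where "x0 = snd c p"
  have "x0 \<in> snd c ` fst c" using c(2) by (simp add: x0_def)
  then obtain r where r: "0 < r" "cball x0 r \<subseteq> snd c ` fst c"
    using open_chart_image[OF c(1)] open_contains_cball by blast
  have "cball x0 r \<noteq> {}" using r(1) by simp
  obtain m M where m: "0 < m" "0 < M"
    "\<And>q v. q \<in> fst c \<Longrightarrow> snd c q \<in> cball x0 r \<Longrightarrow>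
      m * norm v \<le> sqrt (g c q v v) \<and> sqrt (g c q v v) \<le> M * norm v"
    using metric_bounds[OF c(1) compact_cball \<open>cball x0 r \<noteq> {}\<close> r(2)] by metis
  have lower: "m * (r / 3) \<le> curve_length A g \<gamma> \<or>
      q' \<in> fst c \<and> m * dist (snd c q) (snd c q') \<le> curve_length A g \<gamma>"
    if "q \<in> fst c" "snd c q \<in> ball x0 (r / 3)" "\<gamma> \<in> curves q q'" for q q' \<gamma>
    using length_lower_cases[OF c(1) r(2,1) m(1) _ that] m(3) by (simp add: dist_norm[of "snd c q"])
  have upper: "curves q q' \<noteq> {} \<and> dist q q' \<le> M * dist (snd c q) (snd c q')"
    if "q \<in> fst c" "q' \<in> fst c" "snd c q \<in> cball x0 r" "snd c q' \<in> cball x0 r" for q q'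
  proof -
    note q = that
    have "\<exists>\<gamma>\<in>curves q q'. curve_length A g \<gamma> \<le> M * norm (snd c q - snd c q')"
      by (rule straight_curve[OF c(1) r(2) _ q(1,3) q(2,4)]) (simp add: m(3))
    then obtain \<gamma> where \<gamma>: "\<gamma> \<in> curves q q'" "curve_length A g \<gamma> \<le> M * norm (snd c q - snd c q')"
      by blast
    then show ?thesis
      using dist_le_length[OF \<gamma>(1)] by (auto simp: dist_norm[of "snd c q"])
  qed
  show ?thesis
  proof (intro exI conjI allI ballI impI)
    show "c \<in> A" "p \<in> fst c" "x0 = snd c p" "0 < r" "0 < m" "0 < M" "cball x0 r \<subseteq> snd c ` fst c"
      by (fact c x0_def r m(1,2))+
  next
    fix q assume q: "curves p q \<noteq> {}" "dist p q < m * (r / 3)"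
    have far: "q \<in> fst c \<and> m * dist x0 (snd c q) \<le> curve_length A g \<gamma>"
      if "\<gamma> \<in> curves p q" "curve_length A g \<gamma> < m * (r / 3)" for \<gamma>
      using lower[OF c(2) _ that(1)] that(2) r(1) by (auto simp: x0_def)
    have "Inf (curve_length A g ` curves p q) < m * (r / 3)"
      using q(2) by (simp add: dist_eq_Inf)
    then obtain \<gamma> where "\<gamma> \<in> curves p q" "curve_length A g \<gamma> < m * (r / 3)"
      using cInf_lessD[of "curve_length A g ` curves p q"] q(1) by blast
    from far[OF this] have "q \<in> fst c" by blast
    moreover have "m * dist x0 (snd c q) \<le> dist p q"
    proof (rule field_le_epsilon)
      fix \<epsilon> :: real assume "0 < \<epsilon>"
      \<comment> \<open>The minimum selects curves that are almost shortest and at the same time too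
        short to leave the chart.\<close>
      then have "Inf (curve_length A g ` curves p q) < min (m * (r / 3)) (dist p q + \<epsilon>)"
        using q(2) by (simp add: dist_eq_Inf[symmetric])
      then obtain \<gamma> where "\<gamma> \<in> curves p q" "curve_length A g \<gamma> < min (m * (r / 3)) (dist p q + \<epsilon>)"
        using cInf_lessD[of "curve_length A g ` curves p q"] q(1) by blast
      with far[of \<gamma>] show "m * dist x0 (snd c q) \<le> dist p q + \<epsilon>" by auto
    qed
    ultimately show "q \<in> fst c" "m * dist x0 (snd c q) \<le> dist p q" by blast+
  next
    fix q q' assume q: "q \<in> fst c" "q' \<in> fst c" "snd c q \<in> ball x0 (r / 6)" "snd c q' \<in> ball x0 (r / 6)"
    have "curves q q' \<noteq> {}"
      using upper[of q q'] q r(1) by auto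
    then show "m * dist (snd c q) (snd c q') \<le> dist q q'"
      unfolding dist_eq_Inf
    proof (intro cInf_greatest)
      fix l assume "l \<in> curve_length A g ` curves q q'"
      then obtain \<gamma> where \<gamma>: "\<gamma> \<in> curves q q'" "l = curve_length A g \<gamma>" by blast
      have "dist (snd c q) (snd c q') \<le> r / 3"
        using q(3,4) dist_triangle3[of "snd c q" "snd c q'" x0] by simp
      then have "m * dist (snd c q) (snd c q') \<le> m * (r / 3)"
        using m(1) by (intro mult_left_mono) auto
      then show "m * dist (snd c q) (snd c q') \<le> l"
        using lower[OF q(1) _ \<gamma>(1)] q(3) r(1) \<gamma>(2) by auto
    qed simp
  next
    fix q q' assume "q \<in> fst c" "q' \<in> fst c" "snd c q \<in> cball x0 r" "snd c q' \<in> cball x0 r"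
    from upper[OF this] show "curves q q' \<noteq> {}" "dist q q' \<le> M * dist (snd c q) (snd c q')" by blast+
  qed
qed

text \<open>The straight-segment bound puts a coordinate ball into every metric ball. So the metric
  topology is coarser than \<open>X\<close>, and compactness carries over.\<close>

lemma open_imp_openin:
  assumes "open S"
  shows "openin X S"
proof (subst openin_subopen, intro ballI)
  fix p assume "p \<in> S"
  then obtain e where e: "0 < e" "ball p e \<subseteq> S"
    using assms open_contains_ball by blast
  obtain c x0 r m M where c: "c \<in> A" "p \<in> fst c" "x0 = snd c p" "0 < r" "0 < M"
    and upper: "\<forall>q\<in>fst c. \<forall>q'\<in>fst c. snd c q \<in> cball x0 r \<longrightarrow> snd c q' \<in> cball x0 r \<longrightarrow>
      curves q q' \<noteq> {} \<and> dist q q' \<le> M * dist (snd c q) (snd c q')"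
    using local_comparison[of p] by (elim exE conjE) (rule that)
  let ?V = "{q \<in> fst c. snd c q \<in> ball x0 (min r (e / M))}"
  have "?V \<subseteq> S"
  proof
    fix q assume q: "q \<in> ?V"
    then have "dist p q \<le> M * dist (snd c p) (snd c q)"
      using upper c by auto
    also have "\<dots> < e"
      using q c by (simp add: pos_less_divide_eq mult.commute)
    finally show "q \<in> S" using e(2) by auto
  qed
  moreover have "p \<in> ?V" using c e(1) by auto
  moreover have "openin X ?V" by (intro openin_chart_preimage c) simp
  ultimately show "\<exists>T. openin X T \<and> p \<in> T \<and> T \<subseteq> S" by blast
qed

lemma compact_UNIV:
  assumes "compact_space X"
  shows "compact (UNIV :: 'm set)"
proof (rule compactI)
  fix \<C> :: "'m set set" assume \<C>: "\<forall>S\<in>\<C>. open S" "UNIV \<subseteq> \<Union>\<C>"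
  have "compactin X UNIV" using assms top by (simp add: compact_space_def)
  then show "\<exists>\<F>\<subseteq>\<C>. finite \<F> \<and> UNIV \<subseteq> \<Union>\<F>"
    using \<C> open_imp_openin unfolding compactin_def by (metis (no_types, lifting))
qed

text \<open>No curve need join \<open>p\<close> to \<open>q\<close>; the distance is then the unspecified value of the infimum of
  the empty set, and the ball is chosen smaller than that value.\<close>

lemma local_embedding:
  "\<exists>c x0 r m M. c \<in> A \<and> 0 < r \<and> 0 < m \<and> 0 < M \<and> ball x0 r \<subseteq> snd c ` fst c \<and>
    p \<in> interior {q \<in> fst c. snd c q \<in> ball x0 r} \<and>
    (\<forall>q\<in>fst c. \<forall>q'\<in>fst c. snd c q \<in> ball x0 r \<longrightarrow> snd c q' \<in> ball x0 r \<longrightarrow>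
      m * dist (snd c q) (snd c q') \<le> dist q q' \<and> dist q q' \<le> M * dist (snd c q) (snd c q'))"
proof -
  obtain c x0 r m M where c: "c \<in> A" "p \<in> fst c" "x0 = snd c p" "0 < r" "0 < m" "0 < M"
    "cball x0 r \<subseteq> snd c ` fst c"
    and near: "\<forall>q. curves p q \<noteq> {} \<longrightarrow> dist p q < m * (r / 3) \<longrightarrow>
      q \<in> fst c \<and> m * dist x0 (snd c q) \<le> dist p q"
    and upper: "\<forall>q\<in>fst c. \<forall>q'\<in>fst c. snd c q \<in> cball x0 r \<longrightarrow> snd c q' \<in> cball x0 r \<longrightarrow>
      curves q q' \<noteq> {} \<and> dist q q' \<le> M * dist (snd c q) (snd c q')"
    and lower: "\<forall>q\<in>fst c. \<forall>q'\<in>fst c. snd c q \<in> ball x0 (r / 6) \<longrightarrow> snd c q' \<in> ball x0 (r / 6) \<longrightarrow>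
      m * dist (snd c q) (snd c q') \<le> dist q q'"
    using local_comparison[of p] by (elim exE conjE) (rule that)
  let ?V = "{q \<in> fst c. snd c q \<in> ball x0 (r / 6)}"
  let ?d = "Inf {} :: real"
  define e where "e = min (m * (r / 6)) (if 0 < ?d then ?d else 1)"
  have "0 < e" using c by (simp add: e_def)
  have "ball p e \<subseteq> ?V"
  proof
    fix q assume "q \<in> ball p e"
    then have q: "dist p q < e" by simp
    have "curves p q \<noteq> {}"
    proof
      assume empty: "curves p q = {}"
      then have "dist p q = ?d" unfolding dist_eq_Inf by (simp only: image_empty)
      \<comment> \<open>By \<open>upper\<close> some curve joins \<open>p\<close> to itself, so
        \<open>q\<close> differs from \<open>p\<close> and the infimum of the empty set is a
        positive distance; \<open>e\<close> was chosen not to exceed it.\<close>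
      moreover have "p \<noteq> q" using upper[rule_format, of p p] empty c by auto
      ultimately have "0 < ?d" by (metis zero_less_dist_iff)
      with q \<open>dist p q = ?d\<close> show False by (simp add: e_def)
    qed
    moreover have "dist p q < m * (r / 6)" "m * (r / 6) \<le> m * (r / 3)"
      using q c by (auto simp: e_def)
    ultimately have "q \<in> fst c" "m * dist x0 (snd c q) < m * (r / 6)"
      using near by fastforce+
    then show "q \<in> ?V" using c(5) by simp
  qed
  then have interior: "p \<in> interior ?V"
    using \<open>0 < e\<close> mem_interior by blast
  have sub: "ball x0 (r / 6) \<subseteq> cball x0 r" using c(4) by auto
  show ?thesis
  proof (intro exI conjI ballI impI)
    show "c \<in> A" "0 < r / 6" "0 < m" "0 < M" using c by auto
    show "ball x0 (r / 6) \<subseteq> snd c ` fst c" using sub c(7) by blast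
    show "p \<in> interior ?V" by (rule interior)
    fix q q' assume q: "q \<in> fst c" "q' \<in> fst c" "snd c q \<in> ball x0 (r / 6)" "snd c q' \<in> ball x0 (r / 6)"
    show "m * dist (snd c q) (snd c q') \<le> dist q q'"
      using lower q by blast
    show "dist q q' \<le> M * dist (snd c q) (snd c q')"
      using upper[rule_format, of q q'] q sub by blast
  qed
qed

theorem locally_embeddable:
  "\<exists>U. (p::'m) \<in> interior U \<and> bilipschitz_embeddable U (UNIV :: (real ^ 'n) set)"
proof -
  obtain c x0 r m M where c: "c \<in> A" "0 < r" "0 < m" "0 < M" "ball x0 r \<subseteq> snd c ` fst c"
    and p: "p \<in> interior {q \<in> fst c. snd c q \<in> ball x0 r}"
    and comp: "\<forall>q\<in>fst c. \<forall>q'\<in>fst c. snd c q \<in> ball x0 r \<longrightarrow> snd c q' \<in> ball x0 r \<longrightarrow>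
      m * dist (snd c q) (snd c q') \<le> dist q q' \<and> dist q q' \<le> M * dist (snd c q) (snd c q')"
    using local_embedding[of p] by (elim exE conjE) (rule that)
  have "bilipschitz_on {q \<in> fst c. snd c q \<in> ball x0 r} (snd c)"
    unfolding bilipschitz_on_def
  proof (intro exI conjI ballI)
    show "0 < 1 / M" using c by simp
    fix q q' assume "q \<in> {q \<in> fst c. snd c q \<in> ball x0 r}" "q' \<in> {q \<in> fst c. snd c q \<in> ball x0 r}"
    then show "1 / M * dist q q' \<le> dist (snd c q) (snd c q')"
      "dist (snd c q) (snd c q') \<le> 1 / m * dist q q'"
      using comp[rule_format, of q q'] c by (simp_all add: field_simps)
  qed
  with p show ?thesis unfolding bilipschitz_embeddable_def by blast
qed

text \<open>The inverse chart around an arbitrary point is applied to a shrunken unit ball; the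
  factor r / 2 in place of r keeps the closed ball inside the open coordinate ball.\<close>

theorem ball_embeddable: "bilipschitz_embeddable (cball (0 :: real ^ 'n) 1) (UNIV :: 'm set)"
proof -
  obtain c x0 r m M where c: "c \<in> A" "0 < r" "0 < m" "0 < M" "ball x0 r \<subseteq> snd c ` fst c"
    and comp: "\<forall>q\<in>fst c. \<forall>q'\<in>fst c. snd c q \<in> ball x0 r \<longrightarrow> snd c q' \<in> ball x0 r \<longrightarrow>
      m * dist (snd c q) (snd c q') \<le> dist q q' \<and> dist q q' \<le> M * dist (snd c q) (snd c q')"
    using local_embedding[of undefined] by (elim exE conjE) (rule that)
  define \<zeta> where "\<zeta> z = x0 + (r / 2) *\<^sub>R z" for z
  define \<phi> where "\<phi> z = inv_into (fst c) (snd c) (\<zeta> z)" for z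
  have \<zeta>: "\<zeta> z \<in> ball x0 r" if "z \<in> cball 0 1" for z
  proof -
    have "r / 2 * norm z \<le> r / 2 * 1"
      using that c(2) by (intro mult_left_mono) auto
    then show ?thesis using c(2) by (simp add: \<zeta>_def dist_norm)
  qed
  have \<phi>: "\<phi> z \<in> fst c" "snd c (\<phi> z) = \<zeta> z" if "z \<in> cball 0 1" for z
    using \<zeta>[OF that] c(5) f_inv_into_f[of "\<zeta> z" "snd c" "fst c"] inv_into_into[of "\<zeta> z" "snd c" "fst c"]
    by (auto simp: \<phi>_def)
  have \<zeta>_dist: "dist (\<zeta> z) (\<zeta> z') = r / 2 * dist z z'" for z z'
    using c(2) by (simp add: \<zeta>_def dist_norm flip: scaleR_diff_right)
  have "bilipschitz_on (cball 0 1) \<phi>"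
    unfolding bilipschitz_on_def
  proof (intro exI conjI ballI)
    show "0 < m * (r / 2)" using c by simp
    fix z z' :: "real ^ 'n" assume z: "z \<in> cball 0 1" "z' \<in> cball 0 1"
    then show "m * (r / 2) * dist z z' \<le> dist (\<phi> z) (\<phi> z')" "dist (\<phi> z) (\<phi> z') \<le> M * (r / 2) * dist z z'"
      using comp[rule_format, of "\<phi> z" "\<phi> z'"] \<zeta>[OF z(1)] \<zeta>[OF z(2)] \<zeta>_dist[of z z'] by (simp_all add: \<phi>)
  qed
  then show ?thesis unfolding bilipschitz_embeddable_def by blast
qed

end

section \<open>Free spaces over compact Riemannian manifolds\<close>

lemma riemannian_isomorphic_Euclidean:
  fixes X :: "'m::pointed_metric_space topology" and A :: "('m, 'n::finite) chart set"
  assumes "riemannian_manifold X A g" "topspace X = UNIV" "compact_space X"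
    and "\<And>p q. dist p q = geodesic_dist X A g p q"
  shows "\<exists>T :: 'm lipfree \<Rightarrow> (real ^ 'n) lipfree. linear_isomorphism_onto T UNIV"
proof -
  have G: "geodesic_space X A g"
    using assms(1,2,4) by (rule geodesic_space.intro)
  show ?thesis
    by (rule lipfree_isomorphic_Euclidean[OF geodesic_space.compact_UNIV[OF G assms(3)]
          geodesic_space.locally_embeddable[OF G] geodesic_space.ball_embeddable[OF G]])
qed

theorem theorem3p7:
  fixes X :: "'m::pointed_metric_space topology"
    and A :: "('m, 'n::finite) chart set"
    and g :: "('m, 'n) chart \<Rightarrow> 'm \<Rightarrow> real ^ 'n \<Rightarrow> real ^ 'n \<Rightarrow> real"
  shows
    "(compact (UNIV :: 'a::pointed_metric_space set) \<and>
      (\<forall>x::'a. \<exists>U. x \<in> interior U \<and> bilipschitz_embeddable U (UNIV :: (real ^ 'n) set)) \<longrightarrow>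
        (\<exists>(Y :: (real ^ 'n) lipfree set) (T :: 'a lipfree \<Rightarrow> (real ^ 'n) lipfree).
           complemented_subspace Y \<and> linear_isomorphism_onto T Y) \<and>
        (bilipschitz_embeddable (cball (0 :: real ^ 'n) 1) (UNIV :: 'a set) \<longrightarrow>
          (\<exists>T :: 'a lipfree \<Rightarrow> (real ^ 'n) lipfree. linear_isomorphism_onto T UNIV))) \<and>
     (riemannian_manifold X A g \<and> topspace X = UNIV \<and> compact_space X \<and> connected_space X \<and>
      (\<forall>p q. dist p q = geodesic_dist X A g p q) \<longrightarrow>
        (\<exists>T :: 'm lipfree \<Rightarrow> (real ^ 'n) lipfree. linear_isomorphism_onto T UNIV))"
  using lipfree_complemented_in_Euclidean lipfree_isomorphic_Euclidean
    riemannian_isomorphic_Euclidean[of X A g] by blast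

end
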